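(* The field of invariants $K(\mathcal L^* )^L$ of the coadjoint representation of the Lie algebra $\mathcal L$ coincides with the field $K(P_\xi:\ \xi\in S)$ of rational functions of the elements $P_\xi$, $\xi\in S$.
   Context: Let $K$ be a field of characteristic zero, $N=\mathrm{UT}(n,K)$ the group of lower triangular $n\times n$ matrices over $K$ with units on the diagonal, and $\mathfrak n$ its Lie algebra of strictly lower triangular matrices with standard basis of matrix units $y_{ij}$, $(i,j)\in\Delta_+=\{(i,j): n\ge i>j\ge 1\}$. Let $M\subseteq\Delta_+$ be such that whenever $(i,j),(j,m)\in\Delta_+$ and at least one of them lies in $M$, then $(i,m)\in M$. Then $\mathfrak m=\mathrm{span}\{y_\eta:\eta\in M\}$ is an ideal of $\mathfrak n$. Put $\mathcal L=\mathfrak n/\mathfrak m$ and $L=N/\exp(\mathfrak m)$. $L$ acts on $\mathcal L^*$ by the coadjoint representation $\mathrm{Ad}^*_g f(x)=f(\mathrm{Ad}_g^{-1}x)$, hence on $K[\mathcal L^*]=S(\mathcal L)$ and on its field of fractions $K(\mathcal L^* )$. Order $\Delta_+$ by $(n,1)\succ(n-1,1)\succ\dots\succ(2,1)\succ(n,2)\succ\dots\succ(3,2)\succ\dots\succ(n,n-1)$. The diagram $\mathcal D_{\mathcal L}$ is the filling of the places of $\Delta_+$ in an $n\times n$ table constructed as follows. Step zero: put the symbol $\bullet$ on all places of $M$. Each next step: take the $\succ$-greatest empty place $(k,t)$ of $\Delta_+$ and put $\otimes$ on it; then for every $a$ with $k>a>t$ such that both places $(k,a)$ and $(a,t)$ are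 empty, put $-$ on $(k,a)$ and $+$ on $(a,t)$ (if at least one of the two is already filled, do nothing for this $a$). Continue until all places of $\Delta_+$ are filled. Let $S=\{\xi_1\succ\xi_2\succ\dots\succ\xi_s\}$ be the set of places filled by $\otimes$. For a pair $\eta=(i,j)$ let $r_\eta\in S_n$ be the transposition of $i$ and $j$. For $\xi=\xi_m\in S$ put $w_\xi=r_{\xi_1}r_{\xi_2}\cdots r_{\xi_m}$ (composition of maps). The permutation $w=w_{\mathcal L}\in S_n$ is defined by $w(1)=\max\{1\le i\le n:(i,1)\notin M\}$ and $w(t)=\max\{1\le i\le n:(i,t)\notin M,\ i\notin\{w(1),\dots,w(t-1)\}\}$ for $2\le t\le n$. Let $\xi=(k,t)\in S$, $h=w_\xi(t)$ (one always has $h\ne t$). Put $J(\xi)=\{1\le j\le t: w_\xi(j)\ge h\}$. If $h>t$, put $I(\xi)=wJ(\xi)$. If $h<t$, put $I(\xi)=\{h,h+1,\dots,t\}\sqcup\{i: t<i\le n,\ w_\xi(i)<h\}$. In both cases $|I(\xi)|=|J(\xi)|$. Let $\Phi_{\mathcal L}$ be the formal $n\times n$ matrix with $(i,j)$ entry $y_{ij}$ if $(i,j)\in\Delta_+\setminus M$ and $0$ otherwise, $\lambda$ a variable, $E$ the identity matrix. $M_\xi(\lambda)\in S(\mathcal L)[\lambda]$ denotes the minor of $\Phi_{\mathcal L}-\lambda E$ with system of rows $I(\xi)$ and system of columns $J(\xi)$, and $P_\xi\in S(\mathcal L)=K[\mathcal L^*]$ denotes its highest coefficient as a polynomial in $\lambda$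 (the minor is nonzero and $P_\xi$ is an invariant of the coadjoint representation). *)

theory Defs
  imports
    "HOL-Library.Poly_Mapping"
    "HOL-Library.Product_Lexorder"
    "HOL-Computational_Algebra.Polynomial"
    "HOL-Computational_Algebra.Fraction_Field"
    "HOL-Combinatorics.Transposition"
    "HOL-Algebra.Coset"
    "HOL-Algebra.Generated_Fields"
    "HOL-Algebra.Algebraic_Closure_Type"
    "Jordan_Normal_Form.Determinant"
    "Jordan_Normal_Form.DL_Submatrix"
begin

text \<open>Places \<open>(i, j)\<close>, the permutations and the index sets \<open>I\<close>, \<open>J\<close> are 1-based, as
  on paper; entries of a value of type \<open>'a mat\<close> are addressed 0-based, so the place
  \<open>(i, j)\<close> is the entry \<open>(i - 1, j - 1)\<close>.\<close>

section \<open>The combinatorics of the diagram\<close>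

type_synonym place = "nat \<times> nat"

definition Delta :: "nat \<Rightarrow> place set" where
  "Delta n = {(i, j). n \<ge> i \<and> i > j \<and> j \<ge> 1}"

definition ideal_places :: "nat \<Rightarrow> place set \<Rightarrow> bool" where
  "ideal_places n M \<longleftrightarrow> M \<subseteq> Delta n \<and>
    (\<forall>i j m. (i, j) \<in> Delta n \<longrightarrow> (j, m) \<in> Delta n \<longrightarrow> (i, j) \<in> M \<or> (j, m) \<in> M \<longrightarrow> (i, m) \<in> M)"

definition place_gt :: "place \<Rightarrow> place \<Rightarrow> bool" (infix \<open>\<succ>\<close> 50) where
  "\<eta> \<succ> \<xi> \<longleftrightarrow> snd \<eta> < snd \<xi> \<or> (snd \<eta> = snd \<xi> \<and> fst \<eta> > fst \<xi>)"

text \<open>All places in decreasing order (see \<open>set_places\<close>, \<open>sorted_places\<close> below).\<close>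

definition places :: "nat \<Rightarrow> place list" where
  "places n = concat (map (\<lambda>j. map (\<lambda>i. (i, j)) (rev [Suc j..<Suc n])) [1..<n])"

lemma set_places: "set (places n) = Delta n"
  by (auto simp: places_def Delta_def image_iff simp del: upt_Suc)

lemma sorted_places: "sorted_wrt (\<succ>) (places n)"
proof -
  have *: "sorted_wrt (\<succ>) (concat (map (\<lambda>j. map (\<lambda>i. (i, j)) (rev [Suc j..<Suc n])) js))"
    if "sorted_wrt (<) js" for js
    using that
  proof (induction js)
    case (Cons j js)
    have "sorted_wrt (\<succ>) (map (\<lambda>i. (i, j)) (rev [Suc j..<Suc n]))"
      unfolding sorted_wrt_map sorted_wrt_rev
      by (rule sorted_wrt_mono_rel[where P = "(<)"])
        (auto simp: place_gt_def simp del: upt_Suc)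
    moreover have "(i, j) \<succ> \<eta>" if "j' \<in> set js" "\<eta> \<in> (\<lambda>i. (i, j')) ` A" for i j' \<eta> A
      using that Cons.prems by (auto simp: place_gt_def)
    ultimately show ?case
      using Cons by (fastforce simp: sorted_wrt_append simp del: upt_Suc)
  qed simp
  show ?thesis
    unfolding places_def by (rule *) simp
qed

datatype symbol = Bullet | Otimes | Minus | Plus

type_synonym diagram = "place \<Rightarrow> symbol option"

definition diagram_init :: "place set \<Rightarrow> diagram" where
  "diagram_init M = (\<lambda>\<eta>. if \<eta> \<in> M then Some Bullet else None)"

text \<open>The places treated for different \<open>a\<close> are distinct, and none of them is \<open>(k, t)\<close>, so all
  \<open>a\<close> can be treated simultaneously.\<close>

definition fill :: "place \<Rightarrow> diagram \<Rightarrow> diagram" where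
  "fill \<xi> D = (case \<xi> of (k, t) \<Rightarrow> \<lambda>(i, j).
     if (i, j) = (k, t) then Some Otimes
     else if i = k \<and> t < j \<and> j < k \<and> D (k, j) = None \<and> D (j, t) = None then Some Minus
     else if j = t \<and> t < i \<and> i < k \<and> D (k, i) = None \<and> D (i, t) = None then Some Plus
     else D (i, j))"

definition diagram_step :: "nat \<Rightarrow> diagram \<Rightarrow> diagram" where
  "diagram_step n D = (case find (\<lambda>\<eta>. D \<eta> = None) (places n) of None \<Rightarrow> D | Some \<xi> \<Rightarrow> fill \<xi> D)"

text \<open>A step fills at least one empty place and does nothing on a full diagram, so
  \<open>card (Delta n)\<close> steps complete the filling (see \<open>diagram_full\<close> below).\<close>

definition diagram :: "nat \<Rightarrow> place set \<Rightarrow> diagram" where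
  "diagram n M = (diagram_step n ^^ card (Delta n)) (diagram_init M)"

lemma finite_Delta: "finite (Delta n)"
  by (metis List.finite_set set_places)

lemma diagram_full:
  assumes "\<eta> \<in> Delta n"
  shows "diagram n M \<eta> \<noteq> None"
proof -
  let ?e = "\<lambda>D::diagram. {\<eta> \<in> Delta n. D \<eta> = None}"
  have fin: "finite (?e D)" for D
    using finite_Delta by simp
  have step: "?e (diagram_step n D) \<subset> ?e D" if ne: "?e D \<noteq> {}" for D
  proof -
    obtain \<xi> where \<xi>: "find (\<lambda>\<eta>. D \<eta> = None) (places n) = Some \<xi>"
      using ne find_None_iff[of "\<lambda>\<eta>. D \<eta> = None" "places n"] unfolding set_places
      by (cases "find (\<lambda>\<eta>. D \<eta> = None) (places n)") blast+
    then have 1: "\<xi> \<in> ?e D"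
      by (auto simp: find_Some_iff set_places[symmetric])
    have 2: "\<xi> \<notin> ?e (fill \<xi> D)"
      by (cases \<xi>) (simp add: fill_def)
    have 3: "?e (fill \<xi> D) \<subseteq> ?e D"
      by (cases \<xi>) (auto simp: fill_def split: if_splits)
    have "?e (fill \<xi> D) \<subset> ?e D"
    proof (rule psubsetI[OF 3], rule notI)
      assume "?e (fill \<xi> D) = ?e D"
      with 1 2 show False
        by (simp only: simp_thms)
    qed
    then show ?thesis
      using \<xi> by (simp add: diagram_step_def)
  qed
  have "card (?e ((diagram_step n ^^ k) (diagram_init M))) \<le> card (Delta n) - k" for k
  proof (induction k)
    case 0
    then show ?case
      using finite_Delta by (auto intro: card_mono)
  next
    case (Suc k)
    let ?D = "(diagram_step n ^^ k) (diagram_init M)"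
    show ?case
    proof (cases "?e ?D = {}")
      case True
      then have "find (\<lambda>\<eta>. ?D \<eta> = None) (places n) = None"
        by (auto simp: find_None_iff set_places)
      then have "diagram_step n ?D = ?D"
        by (simp add: diagram_step_def)
      then have "(diagram_step n ^^ Suc k) (diagram_init M) = ?D"
        by simp
      then show ?thesis
        by (simp only: True card.empty le0)
    next
      case False
      then have "card (?e (diagram_step n ?D)) < card (?e ?D)"
        by (intro psubset_card_mono fin step)
      then show ?thesis
        unfolding funpow.simps comp_def using Suc by linarith
    qed
  qed
  from this[of "card (Delta n)"] have "card (?e (diagram n M)) = 0"
    unfolding diagram_def by linarith
  then have "?e (diagram n M) = {}"
    by (simp only: card_0_eq[OF fin])
  then have "\<eta> \<notin> ?e (diagram n M)"
    by (simp only: empty_iff not_False_eq_True)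
  then show ?thesis
    using assms by (simp only: mem_Collect_eq simp_thms)
qed

definition S_list :: "nat \<Rightarrow> place set \<Rightarrow> place list" where
  "S_list n M = filter (\<lambda>\<eta>. diagram n M \<eta> = Some Otimes) (places n)"

definition S_set :: "nat \<Rightarrow> place set \<Rightarrow> place set" where
  "S_set n M = set (S_list n M)"

definition w_xi :: "nat \<Rightarrow> place set \<Rightarrow> place \<Rightarrow> nat \<Rightarrow> nat" where
  "w_xi n M \<xi> =
     foldr (\<lambda>(i, j) f. Transposition.transpose i j \<circ> f)
       (filter (\<lambda>\<eta>. \<eta> \<succ> \<xi> \<or> \<eta> = \<xi>) (S_list n M)) id"

text \<open>Only the values at \<open>1, \<dots>, n\<close> are meaningful.\<close>

fun w_L :: "nat \<Rightarrow> place set \<Rightarrow> nat \<Rightarrow> nat" where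
  "w_L n M t = Max {i. 1 \<le> i \<and> i \<le> n \<and> (i, t) \<notin> M \<and> i \<notin> (\<lambda>s. w_L n M s) ` {1..<t}}"

declare w_L.simps [simp del]

definition J_xi :: "nat \<Rightarrow> place set \<Rightarrow> place \<Rightarrow> nat set" where
  "J_xi n M \<xi> = (let t = snd \<xi>; h = w_xi n M \<xi> t in {j. 1 \<le> j \<and> j \<le> t \<and> w_xi n M \<xi> j \<ge> h})"

definition I_xi :: "nat \<Rightarrow> place set \<Rightarrow> place \<Rightarrow> nat set" where
  "I_xi n M \<xi> = (let t = snd \<xi>; h = w_xi n M \<xi> t in
     if h > t then w_L n M ` J_xi n M \<xi>
     else {h..t} \<union> {i. t < i \<and> i \<le> n \<and> w_xi n M \<xi> i < h})"

section \<open>The algebra \<open>S(\<L>)\<close> and its field of fractions\<close>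

text \<open>Polynomials over \<open>'a\<close> in variables \<open>y\<^sub>\<eta>\<close> indexed by all places; \<open>S(\<L>)\<close> is the subring of
  those polynomials in which only \<open>y\<^sub>\<eta>\<close> with \<open>\<eta> \<in> \<Delta>\<^sub>+ \<setminus> M\<close> occur. The images of these \<open>y\<^sub>\<eta>\<close>
  form a basis of \<open>\<L> = \<nn>/\<mm>\<close>.\<close>

type_synonym 'a pol = "(place \<Rightarrow>\<^sub>0 nat) \<Rightarrow>\<^sub>0 'a"
type_synonym 'a ratfun = "'a pol fract"

definition pconst :: "'a::field_char_0 \<Rightarrow> 'a pol" where
  "pconst c = Poly_Mapping.single 0 c"

definition yvar :: "place \<Rightarrow> 'a::field_char_0 pol" where
  "yvar \<eta> = Poly_Mapping.single (Poly_Mapping.single \<eta> 1) 1"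

definition psubst :: "(place \<Rightarrow> 'a pol) \<Rightarrow> 'a pol \<Rightarrow> 'a::field_char_0 pol" where
  "psubst \<sigma> p = (\<Sum>m\<in>Poly_Mapping.keys p. pconst (Poly_Mapping.lookup p m) *
     (\<Prod>\<eta>\<in>Poly_Mapping.keys m. \<sigma> \<eta> ^ Poly_Mapping.lookup m \<eta>))"

definition S_alg :: "nat \<Rightarrow> place set \<Rightarrow> 'a::field_char_0 pol set" where
  "S_alg n M = {p. \<forall>m\<in>Poly_Mapping.keys p. Poly_Mapping.keys m \<subseteq> Delta n - M}"

definition K_L :: "nat \<Rightarrow> place set \<Rightarrow> 'a::field_char_0 ratfun set" where
  "K_L n M = {Fraction_Field.Fract p q | p q. p \<in> S_alg n M \<and> q \<in> S_alg n M \<and> q \<noteq> 0}"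

section \<open>The coadjoint representation\<close>

definition UT :: "nat \<Rightarrow> 'a::field_char_0 mat monoid" where
  "UT n = \<lparr> carrier = {g \<in> carrier_mat n n.
              (\<forall>i<n. g $$ (i, i) = 1) \<and> (\<forall>i j. i < j \<longrightarrow> j < n \<longrightarrow> g $$ (i, j) = 0)},
            monoid.mult = (*), one = 1\<^sub>m n \<rparr>"

definition mat_unit :: "nat \<Rightarrow> place \<Rightarrow> 'a::field_char_0 mat" where
  "mat_unit n \<eta> = mat n n (\<lambda>(i, j). if (Suc i, Suc j) = \<eta> then 1 else 0)"

text \<open>The span of the matrix units with index in \<open>M\<close>, an ideal of \<open>\<nn>\<close>.\<close>

definition m_ideal :: "nat \<Rightarrow> place set \<Rightarrow> 'a::field_char_0 mat set" where
  "m_ideal n M = {mat n n (\<lambda>(i, j). if (Suc i, Suc j) \<in> M then c (Suc i, Suc j) else 0) | c. True}"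

text \<open>The exponential of a nilpotent \<open>n \<times> n\<close> matrix; the powers from the \<open>n\<close>-th on vanish.\<close>

definition nil_exp :: "nat \<Rightarrow> 'a::field_char_0 mat \<Rightarrow> 'a mat" where
  "nil_exp n x = mat n n (\<lambda>ij. \<Sum>k<n. (x ^\<^sub>m k) $$ ij / fact k)"

definition L_group :: "nat \<Rightarrow> place set \<Rightarrow> 'a::field_char_0 mat set monoid" where
  "L_group n M = UT n Mod (nil_exp n ` m_ideal n M)"

definition Ad :: "nat \<Rightarrow> 'a::field_char_0 mat \<Rightarrow> 'a mat \<Rightarrow> 'a mat" where
  "Ad n g x = g * x * inv\<^bsub>UT n\<^esub> g"

definition coAd :: "nat \<Rightarrow> 'a::field_char_0 mat \<Rightarrow> ('a mat \<Rightarrow> 'b) \<Rightarrow> 'a mat \<Rightarrow> 'b" where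
  "coAd n g f = (\<lambda>x. f (Ad n (inv\<^bsub>UT n\<^esub> g) x))"

text \<open>The generic linear functional on \<open>\<nn>\<close> vanishing on \<open>\<mm>\<close>, i.e. the generic point of \<open>\<L>\<^sup>*\<close>:
  its value at the basis vector with index \<open>\<eta>\<close> is \<open>y\<^sub>\<eta>\<close>, and it specializes to an arbitrary
  functional by giving values to the \<open>y\<^sub>\<eta>\<close>. It is also the projection
  \<open>\<nn> \<rightarrow> \<nn>/\<mm> = \<L> \<subseteq> S(\<L>)\<close>.\<close>

definition generic_functional :: "nat \<Rightarrow> place set \<Rightarrow> 'a::field_char_0 mat \<Rightarrow> 'a pol" where
  "generic_functional n M x = (\<Sum>(i, j) \<in> Delta n - M. pconst (x $$ (i - 1, j - 1)) * yvar (i, j))"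

text \<open>\<open>(g\<cdot>p)(f) = p(Ad\<^sup>*\<^sub>g\<^sup>-\<^sup>1 f)\<close> for the generic \<open>f\<close>; the coordinate \<open>y\<^sub>\<eta>\<close> of a functional is its
  value at the matrix unit with index \<open>\<eta>\<close>. For \<open>p \<in> S(\<L>)\<close> this depends only on the class of \<open>g\<close>
  in \<open>L\<close>.\<close>

definition act_pol :: "nat \<Rightarrow> place set \<Rightarrow> 'a::field_char_0 mat \<Rightarrow> 'a pol \<Rightarrow> 'a pol" where
  "act_pol n M g p =
     psubst (\<lambda>\<eta>. coAd n (inv\<^bsub>UT n\<^esub> g) (generic_functional n M) (mat_unit n \<eta>)) p"

text \<open>The extension to fractions, for \<open>F \<in> K(\<L>\<^sup>*)\<close>. The fraction \<open>G\<close> is independent of the choice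
  of \<open>p\<close> and \<open>q\<close>, since \<open>g\<close> acts on \<open>S(\<L>)\<close> by automorphisms.\<close>

definition act_rat :: "nat \<Rightarrow> place set \<Rightarrow> 'a::field_char_0 mat \<Rightarrow> 'a ratfun \<Rightarrow> 'a ratfun" where
  "act_rat n M g F = (THE G. \<exists>p q. p \<in> S_alg n M \<and> q \<in> S_alg n M \<and> q \<noteq> 0 \<and>
     F = Fraction_Field.Fract p q \<and>
     G = Fraction_Field.Fract (act_pol n M g p) (act_pol n M g q))"

text \<open>An element of \<open>L\<close> is a coset; it acts through any of its representatives \<open>g\<close>.\<close>

definition invariant_field :: "nat \<Rightarrow> place set \<Rightarrow> 'a::field_char_0 ratfun set" where
  "invariant_field n M =
     {F \<in> K_L n M. \<forall>c \<in> carrier (L_group n M). \<forall>g \<in> c. act_rat n M g F = F}"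

section \<open>The invariants \<open>P\<^sub>\<xi>\<close>\<close>

definition Phi :: "nat \<Rightarrow> place set \<Rightarrow> 'a::field_char_0 pol mat" where
  "Phi n M = mat n n (\<lambda>(i, j). if (Suc i, Suc j) \<in> Delta n - M then yvar (Suc i, Suc j) else 0)"

definition Phi_lambda :: "nat \<Rightarrow> place set \<Rightarrow> 'a::field_char_0 pol poly mat" where
  "Phi_lambda n M = map_mat (\<lambda>p. [:p:]) (Phi n M) - [:0, 1:] \<cdot>\<^sub>m 1\<^sub>m n"

definition M_xi :: "nat \<Rightarrow> place set \<Rightarrow> place \<Rightarrow> 'a::field_char_0 pol poly" where
  "M_xi n M \<xi> =
     det (submatrix (Phi_lambda n M) {i. Suc i \<in> I_xi n M \<xi>} {j. Suc j \<in> J_xi n M \<xi>})"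

definition P_xi :: "nat \<Rightarrow> place set \<Rightarrow> place \<Rightarrow> 'a::field_char_0 pol" where
  "P_xi n M \<xi> = Polynomial.lead_coeff (M_xi n M \<xi>)"

text \<open>\<open>K(A)\<close>, the subfield generated by the constants and a set \<open>A\<close> of rational functions.\<close>

definition field_adjoin :: "'a::field_char_0 ratfun set \<Rightarrow> 'a ratfun set" where
  "field_adjoin A = generate_field ring_of_type_algebra
     (range (\<lambda>c. Fraction_Field.Fract (pconst c) 1) \<union> A)"

end

theory Submission
  imports Defs "HOL-Combinatorics.Permutations" "HOL-Computational_Algebra.Formal_Power_Series"
begin

text \<open>Write \<open>\<Phi>\<close> for the generic matrix. Up to transposition the group acts by \<open>\<Phi> \<mapsto> v \<Phi> v\<inverse>\<close>
  with \<open>v\<close> upper unitriangular, followed by forgetting everything outside \<open>\<Delta>\<^sub>+ \<setminus> M\<close>.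

  \<^item> Unipotence makes every invariant fraction a quotient of invariant polynomials: \<open>g q - q\<close> has
    smaller weight than \<open>q\<close>, and \<open>p/q = (g p - p)/(g q - q)\<close> whenever \<open>p/q\<close> is invariant and
    \<open>g q \<noteq> q\<close>. So a denominator of minimal weight is invariant.
  \<^item> An invariant polynomial is determined by its restriction to the subspace \<open>\<Sigma>\<close> on which only the
    coordinates \<open>y\<^sub>\<xi>\<close>, \<open>\<xi> \<in> S\<close>, are nonzero. If \<open>p \<noteq> 0\<close> vanishes on \<open>\<Sigma>\<close>, then among its monomials of
    least degree in the other variables and the factors \<open>y\<^sub>\<eta>\<close>, \<open>\<eta> \<notin> S\<close>, of these, an extremal
    choice produces a monomial that cannot cancel in the derivative of \<open>p\<close> along the root vector
    pairing \<open>\<eta>\<close> with the place \<open>\<xi> \<in> S\<close> of the step that fills \<open>\<eta>\<close>.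
  \<^item> After division by \<open>\<lambda>\<close> and with \<open>\<mu> = 1/\<lambda>\<close>, the minor \<open>M\<^sub>\<xi>\<close> becomes a minor of \<open>\<mu>\<Phi> - E\<close>, and
    \<open>P\<^sub>\<xi>\<close> is its lowest coefficient. Gaussian elimination over \<open>K[[\<mu>]]\<close>, column by column, computes it
    from the strictly lower triangular part alone, which gives the invariance. The rows and
    columns that the elimination picks are \<open>I(\<xi>)\<close> and \<open>J(\<xi>)\<close>: the diagram is a sequence of
    transpositions, a swap occurring exactly at the places of \<open>S\<close>.
  \<^item> On \<open>\<Sigma>\<close> one has \<open>P\<^sub>\<xi> = \<plusminus>(A y\<^sub>\<xi> + B)\<close> with \<open>A \<noteq> 0\<close> and \<open>A\<close>, \<open>B\<close> polynomials in earlier \<open>y\<^sub>\<zeta>\<close>.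
    Hence each \<open>y\<^sub>\<xi>\<close> is the restriction of a fraction in the \<open>P\<^sub>\<zeta>\<close>, and by the second point every
    invariant polynomial is such a fraction.\<close>

section \<open>The diagram as a sequence of transpositions\<close>

text \<open>The obstacle is that the action forgets the entries of a conjugate on and above the
  diagonal. So \<open>M_xi\<close> itself cannot be expected to be invariant; invariance is to be
  shown for a coefficient that these entries do not reach. An upper unitriangular v adds lower rows
  to higher ones, and its inverse adds left columns to right ones. A window formed by the rows h to
  n and the columns 1 to t is therefore respected by conjugation, and this is why everything is
  indexed by a threshold h and a column t, with \<open>h = w_xi n M (k, t) t\<close> for the place
  (k, t) of S. Inside the window the pivot rows need not be the lowest ones; what saves the argument
  is a bound on the orders in \<mu> of the multipliers, and it survives because a pivot of order 1
  is always taken in the bottommost row that can be non-zero. Non-vanishing comes from the same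
  elimination: each pivot of order 1 stands at a place of S and is affine in the variable there. The
  coefficient A of y_\<xi> belongs to the same threshold and the previous column; it is not
  identified with any of the generators, only shown to be a polynomial in earlier
  coordinates.\<close>

definition left_down :: "nat \<Rightarrow> place set \<Rightarrow> bool" where
  "left_down n M \<longleftrightarrow> (\<forall>i j i' j'. (i, j) \<in> M \<longrightarrow> i \<le> i' \<longrightarrow> i' \<le> n \<longrightarrow> 1 \<le> j' \<longrightarrow> j' \<le> j \<longrightarrow> (i', j') \<in> M)"

lemma left_downD: "left_down n M \<Longrightarrow> (i, j) \<in> M \<Longrightarrow> i \<le> i' \<Longrightarrow> i' \<le> n \<Longrightarrow> 1 \<le> j' \<Longrightarrow> j' \<le> j \<Longrightarrow> (i', j') \<in> M"
  unfolding left_down_def by blast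

text \<open>Multiplying by the root vectors of (i', i) on the left and of (j, j') on the right moves
  a place down and to the left, so an ideal occupies a staircase at the corner (n, 1). Later
  arguments use the ideal condition in this shape.\<close>

lemma ideal_places_left_down:
  assumes "ideal_places n M"
  shows "left_down n M"
  unfolding left_down_def
proof (intro allI impI)
  fix i j i' j' assume h: "(i, j) \<in> M" "i \<le> i'" "i' \<le> n" "1 \<le> j'" "j' \<le> j"
  have D: "(i, j) \<in> Delta n" using assms h(1) by (auto simp: ideal_places_def)
  have step: "(a, b) \<in> Delta n \<Longrightarrow> (b, c) \<in> Delta n \<Longrightarrow> (a, b) \<in> M \<or> (b, c) \<in> M \<Longrightarrow> (a, c) \<in> M" for a b c
    using assms by (auto simp: ideal_places_def)
  have "(i', j) \<in> M"
  proof (cases "i' = i")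
    case False
    then have "(i', i) \<in> Delta n" using h D by (auto simp: Delta_def)
    then show ?thesis using step D h(1) by blast
  qed (use h in simp)
  moreover have "(i', j) \<in> Delta n"
    using D h by (auto simp: Delta_def)
  ultimately show "(i', j') \<in> M"
    using step[of i' j j'] h by (cases "j' = j") (auto simp: Delta_def)
qed

text \<open>A running permutation \<open>\<sigma>\<close> encodes the diagram: a place \<open>(i, j) \<notin> M\<close> not yet scanned is empty
  iff \<open>\<sigma> j < \<sigma> i\<close> (see \<open>empties_before\<close>), so \<open>\<sigma>\<close> changes exactly at the places of \<open>S\<close>.\<close>

definition swapstep :: "place set \<Rightarrow> place \<Rightarrow> (nat \<Rightarrow> nat) \<Rightarrow> nat \<Rightarrow> nat" where
  "swapstep M \<eta> \<sigma> = (case \<eta> of (k, t) \<Rightarrow>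
     if (k, t) \<notin> M \<and> \<sigma> t < \<sigma> k then \<sigma> \<circ> Transposition.transpose k t else \<sigma>)"

definition upto_place :: "nat \<Rightarrow> nat \<Rightarrow> nat \<Rightarrow> place list" where
  "upto_place n k t = map (\<lambda>i. (i, t)) (rev [Suc k..<Suc n])"

lemma upto_place_n [simp]: "upto_place n n t = []"
  by (simp add: upto_place_def)

lemma upto_place_pred:
  assumes "1 \<le> k" "k \<le> n"
  shows "upto_place n (k - 1) t = upto_place n k t @ [(k, t)]"
proof -
  have "[k..<Suc n] = k # [Suc k..<Suc n]"
    using assms by (intro upt_conv_Cons) simp
  then show ?thesis using assms by (simp add: upto_place_def del: upt_Suc)
qed

definition col_places :: "nat \<Rightarrow> nat \<Rightarrow> place list" where
  "col_places n t = concat (map (\<lambda>j. upto_place n j j) [1..<Suc t])"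

lemma col_places_0 [simp]: "col_places n 0 = []"
  by (simp add: col_places_def)

lemma col_places_Suc: "col_places n (Suc t) = col_places n t @ upto_place n (Suc t) (Suc t)"
  by (simp add: col_places_def)

lemma upt_split:
  assumes "a \<le> b" "b < c"
  shows "[a..<c] = [a..<b] @ b # [Suc b..<c]"
  using upt_add_eq_append[OF assms(1), of "c - b"] upt_conv_Cons[OF assms(2)] assms by simp

lemma places_split:
  assumes "(k, t) \<in> Delta n"
  obtains ys where "places n = col_places n (t - 1) @ upto_place n k t @ (k, t) # ys"
proof -
  have kt: "1 \<le> t" "t < k" "k \<le> n"
    using assms by (auto simp: Delta_def)
  have "[1..<n] = [1..<t] @ t # [Suc t..<n]"
    using kt by (intro upt_split) auto
  then have "places n = col_places n (t - 1) @ upto_place n t t @ concat (map (\<lambda>j. upto_place n j j) [Suc t..<n])"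
    using kt by (simp add: places_def col_places_def upto_place_def del: upt_Suc)
  moreover have "\<exists>zs. upto_place n t t = upto_place n k t @ (k, t) # zs"
  proof -
    have "[Suc t..<Suc n] = [Suc t..<k] @ k # [Suc k..<Suc n]"
      using kt by (intro upt_split) auto
    then show ?thesis
      by (simp add: upto_place_def del: upt_Suc)
  qed
  ultimately show ?thesis
    using that by fastforce
qed

text \<open>The state when (k, t) is about to be scanned. For k = n the column has just begun; for k
  = t it is complete, its last place being (t + 1, t).\<close>

definition swaps_before :: "nat \<Rightarrow> place set \<Rightarrow> nat \<Rightarrow> nat \<Rightarrow> nat \<Rightarrow> nat" where
  "swaps_before n M k t = fold (swapstep M) (col_places n (t - 1) @ upto_place n k t) id"

definition sgm :: "nat \<Rightarrow> place set \<Rightarrow> nat \<Rightarrow> nat \<Rightarrow> nat" where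
  "sgm n M t = fold (swapstep M) (col_places n t) id"

lemma sgm_0 [simp]: "sgm n M 0 = id"
  by (simp add: sgm_def)

lemma swaps_before_n: "swaps_before n M n (Suc t) = sgm n M t"
  by (simp add: swaps_before_def sgm_def)

lemma swaps_before_diag: "swaps_before n M (Suc t) (Suc t) = sgm n M (Suc t)"
  by (simp add: swaps_before_def sgm_def col_places_Suc)

lemma swaps_before_pred: "1 \<le> k \<Longrightarrow> k \<le> n \<Longrightarrow> swaps_before n M (k - 1) t = swapstep M (k, t) (swaps_before n M k t)"
  unfolding swaps_before_def by (subst upto_place_pred) auto

section \<open>What the scan preserves\<close>

text \<open>A position beyond t holds its own value or one at most t, a row of M in column t has
  never been moved, and position t dominates the scanned rows outside M. The clause
  \<open>\<sigma> t \<le> t \<or> k < \<sigma> t\<close> says that a large value at t came from a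
  scanned row; it then exceeds whatever the remaining rows hold and ends the swaps of the
  column.\<close>

definition swaps_good :: "nat \<Rightarrow> place set \<Rightarrow> nat \<Rightarrow> nat \<Rightarrow> (nat \<Rightarrow> nat) \<Rightarrow> bool" where
  "swaps_good n M t k \<sigma> \<longleftrightarrow> \<sigma> permutes {1..n} \<and> (\<forall>i. t < i \<longrightarrow> i \<le> n \<longrightarrow> \<sigma> i = i \<or> \<sigma> i \<le> t) \<and> (\<sigma> t \<le> t \<or> k < \<sigma> t) \<and>
     (\<forall>i. t < i \<longrightarrow> i \<le> n \<longrightarrow> (i, t) \<in> M \<longrightarrow> \<sigma> i = i) \<and> (\<forall>i. k < i \<longrightarrow> i \<le> n \<longrightarrow> (i, t) \<notin> M \<longrightarrow> \<sigma> i < \<sigma> t)"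

lemma swaps_good_step:
  assumes g: "swaps_good n M t k \<sigma>" and kt: "t < k" "k \<le> n" "1 \<le> t"
  shows "swaps_good n M t (k - 1) (swapstep M (k, t) \<sigma>)"
proof (cases "(k, t) \<notin> M \<and> \<sigma> t < \<sigma> k")
  case True
  let ?s = "\<sigma> \<circ> Transposition.transpose k t"
  have p: "\<sigma> permutes {1..n}" using g by (simp add: swaps_good_def)
  have v: "?s k = \<sigma> t" "?s t = \<sigma> k" "\<And>i. i \<noteq> k \<Longrightarrow> i \<noteq> t \<Longrightarrow> ?s i = \<sigma> i"
    by simp_all
  \<comment> \<open>A value above t at position t would exceed k, hence also the value at k, and no
    swap could take place.\<close>
  have st: "\<sigma> t \<le> t"
  proof (rule ccontr)
    assume "\<not> \<sigma> t \<le> t"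
    then have "k < \<sigma> t" "t < \<sigma> t" using g by (auto simp: swaps_good_def)
    moreover have "\<sigma> k = k \<or> \<sigma> k \<le> t" using g kt by (auto simp: swaps_good_def)
    ultimately show False using True by auto
  qed
  have 1: "?s permutes {1..n}"
    using kt by (intro permutes_compose[OF permutes_swap_id p]) auto
  have 2: "?s i = i \<or> ?s i \<le> t" if "t < i" "i \<le> n" for i
    using g st that by (cases "i = k") (auto simp: swaps_good_def v)
  have 3: "?s t \<le> t \<or> k - 1 < ?s t"
  proof -
    have "\<sigma> k = k \<or> \<sigma> k \<le> t" using g kt by (auto simp: swaps_good_def)
    then show ?thesis using kt unfolding v by auto
  qed
  have 4: "?s i = i" if "t < i" "i \<le> n" "(i, t) \<in> M" for i
    using g that True v(3)[of i] by (cases "i = k") (auto simp: swaps_good_def)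
  have 5: "?s i < ?s t" if "k - 1 < i" "i \<le> n" "(i, t) \<notin> M" for i
  proof (cases "i = k")
    case False
    then have "\<sigma> i < \<sigma> t" using g that kt by (auto simp: swaps_good_def)
    moreover have "i \<noteq> t" using that kt by linarith
    ultimately show ?thesis using True unfolding v(2) v(3)[OF False \<open>i \<noteq> t\<close>] by linarith
  qed (use True in simp)
  have e: "swapstep M (k, t) \<sigma> = ?s" using True by (simp add: swapstep_def)
  show ?thesis
    unfolding swaps_good_def e by (intro conjI allI impI 1 2 3 4 5)
next
  case False
  then have e: "swapstep M (k, t) \<sigma> = \<sigma>" by (auto simp: swapstep_def)
  have "\<sigma> k \<noteq> \<sigma> t"
    using g kt by (auto simp: swaps_good_def dest: permutes_inj injD)
  then have k: "\<sigma> k < \<sigma> t" if "(k, t) \<notin> M"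
    using False that by auto
  have "\<sigma> i < \<sigma> t" if "k - 1 < i" "i \<le> n" "(i, t) \<notin> M" for i
  proof (cases "i = k")
    case False
    then show ?thesis using g that kt by (auto simp: swaps_good_def)
  qed (use k that in simp)
  then show ?thesis
    using g unfolding e swaps_good_def by auto
qed

lemma swaps_good_next:
  assumes "swaps_good n M t k \<sigma>" "left_down n M" "1 \<le> t" "Suc t \<le> n"
  shows "swaps_good n M (Suc t) n \<sigma>"
proof -
  have "(i, Suc t) \<in> M \<Longrightarrow> i \<le> n \<Longrightarrow> (i, t) \<in> M" for i
    by (rule left_downD[OF assms(2)]) (use assms(3) in auto)
  moreover have "\<sigma> i = i \<or> \<sigma> i \<le> t" if "t < i" "i \<le> n" for i
    using assms(1) that by (simp add: swaps_good_def)
  then have "\<sigma> i = i \<or> \<sigma> i \<le> Suc t" if "t < i" "i \<le> n" for i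
    using that le_SucI by blast
  moreover from this[of "Suc t"] have "\<sigma> (Suc t) \<le> Suc t"
    using assms(4) by auto
  ultimately show ?thesis
    using assms(1) unfolding swaps_good_def by (intro conjI allI impI) (auto dest: Suc_lessD)
qed

lemma swaps_good_before:
  assumes M: "left_down n M"
  shows "1 \<le> t \<Longrightarrow> t \<le> k \<Longrightarrow> k \<le> n \<Longrightarrow> swaps_good n M t k (swaps_before n M k t)"
proof (induction t arbitrary: k)
  case (Suc t)
  have base: "swaps_good n M (Suc t) n (swaps_before n M n (Suc t))"
  proof (cases "t = 0")
    case True
    then show ?thesis
      using Suc.prems by (auto simp: swaps_before_n swaps_good_def permutes_id)
  next
    case False
    then have "swaps_good n M t t (swaps_before n M t t)"
      using Suc by simp
    moreover have "swaps_before n M t t = sgm n M t"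
      using swaps_before_diag[of n M "t - 1"] False by simp
    ultimately show ?thesis
      using swaps_good_next[OF _ M] False Suc.prems by (simp add: swaps_before_n)
  qed
  show ?case
    using Suc.prems(3,2)
  proof (induction k rule: inc_induct)
    case (step k)
    have "swaps_good n M (Suc t) (Suc k - 1) (swapstep M (Suc k, Suc t) (swaps_before n M (Suc k) (Suc t)))"
      using step by (intro swaps_good_step) auto
    then show ?case
      using swaps_before_pred[of "Suc k" n M "Suc t"] step by simp
  qed (rule base)
qed simp

lemma swaps_good_sgm:
  assumes "left_down n M" "1 \<le> t" "t \<le> n"
  shows "swaps_good n M t t (sgm n M t)"
  using swaps_good_before[OF assms(1,2) le_refl assms(3)] swaps_before_diag[of n M "t - 1"] assms(2) by simp

lemma sgm_permutes: "left_down n M \<Longrightarrow> t \<le> n \<Longrightarrow> sgm n M t permutes {1..n}"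
  using swaps_good_sgm[of n M t] by (cases "t = 0") (auto simp: swaps_good_def permutes_id)

lemma sgm_above: "left_down n M \<Longrightarrow> t < i \<Longrightarrow> i \<le> n \<Longrightarrow> sgm n M t i = i \<or> sgm n M t i \<le> t"
  using swaps_good_sgm[of n M t] by (cases "t = 0") (auto simp: swaps_good_def)

lemma swaps_before_stable:
  assumes "j < t"
  shows "k \<le> n \<Longrightarrow> t \<le> k \<Longrightarrow> swaps_before n M k t j = sgm n M (t - 1) j"
proof (induction k rule: inc_induct)
  case base
  then show ?case using swaps_before_n[of n M "t - 1"] assms by simp
next
  case (step k)
  then show ?case
    using swaps_before_pred[of "Suc k" n M t] assms by (auto simp: swapstep_def)
qed

lemma sgm_stable: "j \<le> t \<Longrightarrow> t \<le> n \<Longrightarrow> sgm n M t j = sgm n M j j"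
proof (induction t)
  case (Suc t)
  show ?case
  proof (cases "j = Suc t")
    case False
    then have "sgm n M (Suc t) j = sgm n M t j"
      using swaps_before_stable[of j "Suc t" "Suc t" n M] Suc.prems swaps_before_diag[of n M t] by simp
    then show ?thesis using Suc False by simp
  qed simp
qed simp

lemma w_L_sgm:
  assumes M: "left_down n M" "M \<subseteq> Delta n"
  shows "1 \<le> t \<Longrightarrow> t \<le> n \<Longrightarrow> w_L n M t = sgm n M t t"
proof (induction t rule: less_induct)
  case (less t)
  let ?s = "sgm n M t"
  let ?A = "{i. 1 \<le> i \<and> i \<le> n \<and> (i, t) \<notin> M \<and> i \<notin> (\<lambda>s. w_L n M s) ` {1..<t}}"
  have g: "swaps_good n M t t ?s" using swaps_good_sgm[OF M(1) less.prems] .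
  then have p: "?s permutes {1..n}" by (simp add: swaps_good_def)
  have im: "(\<lambda>s. w_L n M s) ` {1..<t} = ?s ` {1..<t}"
  proof (rule image_cong[OF refl])
    fix j assume "j \<in> {1..<t}"
    then have j: "1 \<le> j" "j < t" by auto
    then have "w_L n M j = sgm n M j j" using less.IH less.prems by simp
    also have "\<dots> = ?s j" by (rule sgm_stable[symmetric]) (use j less.prems in auto)
    finally show "w_L n M j = ?s j" .
  qed
  have "Max ?A = ?s t"
  proof (rule Max_eqI)
    show "finite ?A" by (rule finite_subset[of _ "{..n}"]) auto
    show "?s t \<in> ?A"
    proof -
      have "?s t \<in> {1..n}" using permutes_in_image[OF p] less.prems by auto
      \<comment> \<open>A row of M still holds its own index, so a value r with (r, t) in M sits at
        position r and not at t.\<close>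
      moreover have "(?s t, t) \<notin> M"
      proof
        assume "(?s t, t) \<in> M"
        moreover then have "t < ?s t" "?s t \<le> n" using M(2) by (auto simp: Delta_def)
        ultimately have "?s (?s t) = ?s t" using g by (auto simp: swaps_good_def)
        then have "?s t = t" by (rule injD[OF permutes_inj[OF p]])
        then show False using \<open>t < ?s t\<close> by simp
      qed
      moreover have "?s t \<notin> ?s ` {1..<t}"
        using inj_image_mem_iff[OF permutes_inj[OF p]] by simp
      ultimately show ?thesis unfolding im by simp
    qed
    fix v assume "v \<in> ?A"
    then have v: "v \<in> {1..n}" "(v, t) \<notin> M" "v \<notin> ?s ` {1..<t}" unfolding im by auto
    obtain i where i: "v = ?s i" "i \<in> {1..n}"
      using v(1) permutes_image[OF p] by blast
    then have "t \<le> i" using v(3) by (meson atLeastAtMost_iff atLeastLessThan_iff image_eqI not_le)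
    then show "v \<le> ?s t"
    proof (cases "i = t")
      case False
      then have it: "t < i" "i \<le> n" using \<open>t \<le> i\<close> i(2) by auto
      have "(i, t) \<notin> M"
      proof
        assume "(i, t) \<in> M"
        then have "?s i = i" using g it by (simp add: swaps_good_def)
        then show False using \<open>(i, t) \<in> M\<close> v(2) i(1) by simp
      qed
      then have "?s i < ?s t" using g it by (simp add: swaps_good_def)
      then show ?thesis using i(1) by simp
    qed (use i in simp)
  qed
  then show ?case by (subst w_L.simps)
qed

text \<open>For a fixed threshold \<open>h\<close>, the positions carrying a value below \<open>h\<close> behave like chips: while
  column \<open>t\<close> is scanned, a chip on \<open>t\<close> moves to the bottommost admissible row, and all others stay. The
  elimination below picks its pivot rows by the same rule.\<close>

definition chips :: "(nat \<Rightarrow> nat) \<Rightarrow> nat \<Rightarrow> nat set" where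
  "chips \<sigma> h = {i. \<sigma> i < h}"

lemma chips_transpose:
  assumes "k \<noteq> t"
  shows "(\<sigma> k < h \<longleftrightarrow> \<sigma> t < h) \<Longrightarrow> chips (\<sigma> \<circ> Transposition.transpose k t) h = chips \<sigma> h"
    and "\<sigma> t < h \<Longrightarrow> h \<le> \<sigma> k \<Longrightarrow> chips (\<sigma> \<circ> Transposition.transpose k t) h = insert k (chips \<sigma> h - {t})"
  using assms by (auto simp: chips_def Transposition.transpose_def split: if_splits)

text \<open>Rows are judged by the state before column t. This is legitimate because scanning column
  t touches a row only at the moment when that row is scanned.\<close>

definition landing :: "nat \<Rightarrow> place set \<Rightarrow> nat \<Rightarrow> nat \<Rightarrow> nat set" where
  "landing n M h t = {i. t < i \<and> i \<le> n \<and> (i, t) \<notin> M \<and> h \<le> sgm n M (t - 1) i}"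

lemma finite_landing [simp]: "finite (landing n M h t)"
  by (rule finite_subset[of _ "{..n}"]) (auto simp: landing_def)

text \<open>A swap needs \<open>\<sigma> t < \<sigma> k\<close>, so it can carry a chip from t to k
  but never back. Hence the chip on t leaves at the first scanned row that is outside M and carries
  no chip; scanning from the bottom, this is the maximum of \<open>landing\<close>.\<close>

lemma chips_before:
  assumes t: "1 \<le> t" and C: "C = chips (sgm n M (t - 1)) h"
  shows "k \<le> n \<Longrightarrow> t \<le> k \<Longrightarrow> chips (swaps_before n M k t) h =
     (if t \<in> C \<and> (\<exists>i\<in>landing n M h t. k < i) then insert (Max (landing n M h t)) (C - {t}) else C)"
proof (induction k rule: inc_induct)
  case base
  then show ?case using swaps_before_n[of n M "t - 1"] t by (auto simp: C landing_def)
next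
  case (step k)
  let ?K = "landing n M h t" and ?b = "swaps_before n M (Suc k) t"
  note IH = step.IH[OF le_SucI[OF step.prems]]
  have bp: "swaps_before n M k t = swapstep M (Suc k, t) ?b"
    using swaps_before_pred[of "Suc k" n M t] step.hyps by simp
  have kt: "Suc k \<noteq> t" "Suc k \<le> n" "t < Suc k" using step by auto
  have sw: "chips (swapstep M (Suc k, t) ?b) h = chips ?b h"
    if "Suc k \<in> chips ?b h \<longleftrightarrow> t \<in> chips ?b h"
  proof -
    have "?b (Suc k) < h \<longleftrightarrow> ?b t < h"
      using that unfolding chips_def mem_Collect_eq .
    from chips_transpose(1)[OF kt(1) this] show ?thesis
      by (simp only: swapstep_def prod.case split: if_split) blast
  qed
  have sw0: "swapstep M (Suc k, t) ?b = ?b" if "(Suc k, t) \<in> M \<or> ?b (Suc k) < h \<and> h \<le> ?b t"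
    using that by (auto simp: swapstep_def)
  have out: "chips (swapstep M (Suc k, t) ?b) h = chips ?b h" if "t \<notin> chips ?b h"
  proof (cases "Suc k \<in> chips ?b h")
    case True
    then have "?b (Suc k) < h \<and> h \<le> ?b t" using that by (simp add: chips_def)
    then show ?thesis using sw0 by simp
  qed (use that sw in blast)
  have inK: "Suc k \<in> ?K \<longleftrightarrow> (Suc k, t) \<notin> M \<and> Suc k \<notin> C"
    using kt by (auto simp: landing_def C chips_def)
  have ex: "(\<exists>i\<in>?K. k < i) \<longleftrightarrow> (\<exists>i\<in>?K. Suc k < i) \<or> Suc k \<in> ?K"
  proof -
    have "k < i \<longleftrightarrow> Suc k < i \<or> i = Suc k" for i by auto
    then show ?thesis by blast
  qed
  consider "t \<notin> C" | "t \<in> C" "\<exists>i\<in>?K. Suc k < i" | "t \<in> C" "\<not> (\<exists>i\<in>?K. Suc k < i)" "Suc k \<in> ?K"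
    | "t \<in> C" "\<not> (\<exists>i\<in>?K. Suc k < i)" "Suc k \<notin> ?K" by blast
  then show ?case
  proof cases
    case 1
    then have c: "chips ?b h = C" using IH by simp
    then have "t \<notin> chips ?b h" using 1 by simp
    from out[OF this] show ?thesis using 1 unfolding bp c by simp
  next
    case 2
    then have c: "chips ?b h = insert (Max ?K) (C - {t})" using IH by simp
    have "Max ?K \<in> ?K" using 2 by (intro Max_in) auto
    then have "Max ?K \<noteq> t" by (auto simp: landing_def)
    then have "t \<notin> chips ?b h" using c by simp
    from out[OF this] show ?thesis using 2 ex unfolding bp c by simp
  next
    case 3
    then have c: "chips ?b h = C" using IH by simp
    have "t \<in> chips ?b h" "Suc k \<notin> chips ?b h" using 3 c inK by simp_all
    then have b: "?b t < h" "h \<le> ?b (Suc k)" by (simp_all add: chips_def)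
    have sw: "swapstep M (Suc k, t) ?b = ?b \<circ> Transposition.transpose (Suc k) t"
      using 3(3) inK b by (simp add: swapstep_def)
    have "Max ?K = Suc k"
    proof (rule Max_eqI)
      fix i assume "i \<in> ?K"
      with 3(2) show "i \<le> Suc k" by (meson not_le)
    qed (use 3 in simp_all)
    then show ?thesis
      using 3 ex unfolding bp sw chips_transpose(2)[OF kt(1) b] c by simp
  next
    case 4
    then have c: "chips ?b h = C" using IH by simp
    have "chips (swapstep M (Suc k, t) ?b) h = C"
    proof (cases "(Suc k, t) \<in> M")
      case True
      then show ?thesis using c sw0 by simp
    next
      case False
      then have "Suc k \<in> C" using 4 inK by simp
      then show ?thesis using sw 4(1) unfolding c by simp
    qed
    then show ?thesis using 4 ex unfolding bp by simp
  qed
qed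

section \<open>Leading coefficients of minors of a characteristic matrix\<close>

text \<open>Lists and not sets, because pivots are appended in the order in which they are found.
  The sign lost on reordering is accounted for in \<open>lminor_perm\<close>.\<close>

definition lminor :: "(nat \<Rightarrow> nat \<Rightarrow> 'b::comm_ring_1) \<Rightarrow> nat list \<Rightarrow> nat list \<Rightarrow> 'b" where
  "lminor A rs cs = det (mat (length rs) (length rs) (\<lambda>(a, b). A (rs ! a) (cs ! b)))"

lemma lminor_Nil [simp]: "lminor A [] cs = 1"
  by (simp add: lminor_def)

lemma sum_set_nth:
  assumes "distinct rs"
  shows "(\<Sum>a\<in>set rs. f a) = (\<Sum>i<length rs. f (rs ! i))"
  using assms by (metis bij_betw_nth sum.reindex_bij_betw)

lemma lminor_mult_left:
  assumes "length cs = length rs" "distinct rs"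
    and B: "\<And>a j. a \<in> set rs \<Longrightarrow> j \<in> set cs \<Longrightarrow> B a j = (\<Sum>a'\<in>set rs. V a a' * A a' j)"
  shows "lminor B rs cs = lminor V rs rs * lminor A rs cs"
proof -
  let ?r = "length rs"
  let ?V = "mat ?r ?r (\<lambda>(a, b). V (rs ! a) (rs ! b))" and ?A = "mat ?r ?r (\<lambda>(a, b). A (rs ! a) (cs ! b))"
  have "mat ?r ?r (\<lambda>(a, b). B (rs ! a) (cs ! b)) = ?V * ?A"
    by (rule eq_matI) (simp_all add: B assms sum_set_nth scalar_prod_def atLeast0LessThan)
  then show ?thesis
    unfolding lminor_def by (simp add: det_mult[of _ ?r])
qed

text \<open>Schur complement: on the columns \<open>cs\<close> the new row is a combination of the
  old rows, and after subtracting it the matrix is block triangular with a single corner entry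
  left.\<close>

lemma lminor_snoc:
  fixes A :: "nat \<Rightarrow> nat \<Rightarrow> 'b::idom"
  assumes len: "length cs = length rs" and "distinct rs"
    and rel: "\<And>j. j \<in> set cs \<Longrightarrow> A k j = (\<Sum>a\<in>set rs. m a * A a j)"
  shows "lminor A (rs @ [k]) (cs @ [t]) = lminor A rs cs * (A k t - (\<Sum>a\<in>set rs. m a * A a t))"
proof -
  let ?r = "length rs"
  let ?A = "mat (Suc ?r) (Suc ?r) (\<lambda>(a, b). A ((rs @ [k]) ! a) ((cs @ [t]) ! b))"
  let ?L = "mat (Suc ?r) (Suc ?r) (\<lambda>(a, b). if a = b then 1 else if a = ?r then - m (rs ! b) else 0)"
  let ?A1 = "mat ?r ?r (\<lambda>(a, b). A (rs ! a) (cs ! b))"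
  let ?A2 = "mat ?r 1 (\<lambda>(a, b). A (rs ! a) t)"
  let ?A4 = "mat 1 1 (\<lambda>(a, b). A k t - (\<Sum>a\<in>set rs. m a * A a t))"
  have detL: "det ?L = 1"
    by (subst det_lower_triangular[of "Suc ?r"])
      (auto simp: prod_list_diag_prod)
  have LA: "?L * ?A = four_block_mat ?A1 ?A2 (0\<^sub>m 1 ?r) ?A4"
  proof (rule eq_matI)
    fix i j assume "i < dim_row (four_block_mat ?A1 ?A2 (0\<^sub>m 1 ?r) ?A4)"
      "j < dim_col (four_block_mat ?A1 ?A2 (0\<^sub>m 1 ?r) ?A4)"
    then have i: "i < Suc ?r" and j: "j < Suc ?r" by auto
    let ?c = "(cs @ [t]) ! j"
    have "(?L * ?A) $$ (i, j) =
       (\<Sum>l<?r. (if i = l then 1 else if i = ?r then - m (rs ! l) else 0) * A ((rs @ [k]) ! l) ?c)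
        + (if i = ?r then A k ?c else 0)"
      using i j by (simp add: scalar_prod_def atLeast0LessThan)
    also have "\<dots> = (if i = ?r then A k ?c - (\<Sum>a\<in>set rs. m a * A a ?c) else A (rs ! i) ?c)"
    proof (cases "i = ?r")
      case True
      then have "(\<Sum>l<?r. (if i = l then 1 else if i = ?r then - m (rs ! l) else 0) * A ((rs @ [k]) ! l) ?c)
          = (\<Sum>l<?r. - (m (rs ! l) * A (rs ! l) ?c))"
        by (intro sum.cong) (auto simp: nth_append)
      then show ?thesis
        using True by (simp add: sum_set_nth assms sum_negf)
    next
      case False
      then have "(\<Sum>l<?r. (if i = l then 1 else if i = ?r then - m (rs ! l) else 0) * A ((rs @ [k]) ! l) ?c)
          = (\<Sum>l<?r. if l = i then A (rs ! l) ?c else 0)"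
        by (intro sum.cong) (auto simp: nth_append)
      then show ?thesis
        using False i by simp
    qed
    also have "\<dots> = four_block_mat ?A1 ?A2 (0\<^sub>m 1 ?r) ?A4 $$ (i, j)"
      using i j len rel[of "cs ! j"] by (auto simp: nth_append less_Suc_eq)
    finally show "(?L * ?A) $$ (i, j) = four_block_mat ?A1 ?A2 (0\<^sub>m 1 ?r) ?A4 $$ (i, j)" .
  qed auto
  have "det ?A = det (?L * ?A)"
    by (subst det_mult[of _ "Suc ?r"]) (auto simp: detL)
  also have "\<dots> = det ?A1 * det ?A4"
    unfolding LA by (rule det_four_block_mat_lower_left_zero) auto
  also have "det ?A4 = A k t - (\<Sum>a\<in>set rs. m a * A a t)"
    by (subst det_single) auto
  finally show ?thesis
    by (simp add: lminor_def)
qed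

text \<open>\<open>\<mu>Z - E\<close> over \<open>K[[\<mu>]]\<close>: with \<open>\<mu> = 1/\<lambda>\<close>, highest coefficients in \<open>\<lambda>\<close> of minors of \<open>Z - \<lambda>E\<close> become
  lowest coefficients in \<open>\<mu>\<close>.\<close>

definition charmat :: "(nat \<Rightarrow> nat \<Rightarrow> 'f::field) \<Rightarrow> nat \<Rightarrow> nat \<Rightarrow> 'f fps" where
  "charmat Z i j = fps_const (Z i j) * fps_X - (if i = j then 1 else 0)"

lemma charmat_nth_0: "fps_nth (charmat Z i j) 0 = (if i = j then -1 else 0)"
  by (simp add: charmat_def)

lemma charmat_nth_1: "fps_nth (charmat Z i j) (Suc 0) = Z i j"
  by (simp add: charmat_def)

text \<open>Right multiplication by an upper triangular w: column j receives multiples of the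
  columns up to j.\<close>

definition colop :: "(nat \<Rightarrow> nat \<Rightarrow> 'b::comm_ring_1) \<Rightarrow> (nat \<Rightarrow> nat \<Rightarrow> 'b) \<Rightarrow> nat \<Rightarrow> nat \<Rightarrow> 'b" where
  "colop A w i j = (\<Sum>l\<in>{1..j}. A i l * w l j)"

definition cand :: "nat \<Rightarrow> place set \<Rightarrow> nat \<Rightarrow> nat \<Rightarrow> nat list \<Rightarrow> nat set" where
  "cand n M h t rs = {b. b \<le> n \<and> t < b \<and> h \<le> b \<and> (b, t) \<notin> M \<and> b \<notin> set rs}"

text \<open>The rows and columns of the pivots found by eliminating the columns \<open>1, \<dots>, t\<close> of \<open>charmat Z\<close> using
  the rows from \<open>h\<close> on only, and the order in \<open>\<mu>\<close> of the corresponding minor. The diagonal entry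
  \<open>-1\<close> is the pivot if its row is available; otherwise the pivot, of order \<open>1\<close>, is in the bottommost row
  that is available and not forced to vanish by \<open>M\<close>.\<close>

primrec proc :: "nat \<Rightarrow> place set \<Rightarrow> nat \<Rightarrow> nat \<Rightarrow> nat list \<times> nat list \<times> nat" where
  "proc n M h 0 = ([], [], 0)"
| "proc n M h (Suc t) = (case proc n M h t of (rs, cs, d) \<Rightarrow>
     if h \<le> Suc t \<and> Suc t \<notin> set rs then (rs @ [Suc t], cs @ [Suc t], d)
     else if cand n M h (Suc t) rs = {} then (rs, cs, d)
     else (rs @ [Max (cand n M h (Suc t) rs)], cs @ [Suc t], Suc d))"

text \<open>The coefficient of \<open>\<mu>\<close> in the entry \<open>(b, t)\<close> after elimination (see \<open>row_rel\<close> for \<open>q\<close>). The term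
  \<open>q b t\<close> comes from the entry \<open>-1\<close> on the diagonal.\<close>

definition psi :: "(nat \<Rightarrow> nat \<Rightarrow> 'f::field) \<Rightarrow> (nat \<Rightarrow> nat \<Rightarrow> 'f) \<Rightarrow> nat list \<Rightarrow> nat \<Rightarrow> nat \<Rightarrow> 'f" where
  "psi y q rs t b = y b t - (\<Sum>a\<in>{a \<in> set rs. b < a}. q b a * y a t) + (if t \<in> set rs then q b t else 0)"

text \<open>The first component is the matrix \<open>q\<close> of \<open>row_rel\<close>, the second the lowest coefficient of the
  minor. Both are computed from the strictly lower part of \<open>Z\<close> alone.\<close>

primrec lead :: "nat \<Rightarrow> place set \<Rightarrow> nat \<Rightarrow> (nat \<Rightarrow> nat \<Rightarrow> 'f::field) \<Rightarrow> nat \<Rightarrow> (nat \<Rightarrow> nat \<Rightarrow> 'f) \<times> 'f" where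
  "lead n M h y 0 = ((\<lambda>_ _. 0), 1)"
| "lead n M h y (Suc t) = (case proc n M h t of (rs, cs, d) \<Rightarrow> case lead n M h y t of (q, p) \<Rightarrow>
     let f = psi y q rs (Suc t); k = Max (cand n M h (Suc t) rs) in
     if h \<le> Suc t \<and> Suc t \<notin> set rs then
       ((\<lambda>b a. if a = Suc t then - f b else if a < b then q b a + f b * (if a < Suc t then 0 else q (Suc t) a)
          else q b a), - p)
     else if cand n M h (Suc t) rs = {} then ((\<lambda>_ _. 0), p)
     else ((\<lambda>b a. if (b, Suc t) \<in> M then 0 else if a = k then f b / f k
          else if a < b then q b a - f b / f k * q k a
          else q b a - f b / f k * (if a < k then 0 else q k a)), p * f k))"

text \<open>The clause on \<open>{h..t}\<close> holds because the diagonal row is taken at its own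
  column unless it has been taken before. It puts every remaining row of the window strictly below
  row t. The element 0 allows for h = 0.\<close>

lemma proc_facts:
  assumes "proc n M h t = (rs, cs, d)" "t \<le> n"
  shows "distinct rs \<and> set rs \<subseteq> {h..n} \<and> length cs = length rs \<and> distinct cs \<and> set cs \<subseteq> {1..t}
    \<and> {h..t} \<subseteq> set rs \<union> {0} \<and> d \<le> length rs"
  using assms
proof (induction t arbitrary: rs cs d)
  case (Suc t)
  obtain rs' cs' d' where p: "proc n M h t = (rs', cs', d')" by (cases "proc n M h t")
  have IH: "distinct rs'" "set rs' \<subseteq> {h..n}" "length cs' = length rs'" "distinct cs'" "set cs' \<subseteq> {1..t}"
    "{h..t} \<subseteq> set rs' \<union> {0}" "d' \<le> length rs'"
    using Suc.IH[OF p] Suc.prems by auto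
  have fin: "finite (cand n M h (Suc t) rs')"
    by (rule finite_subset[of _ "{..n}"]) (auto simp: cand_def)
  have IH2: "h \<le> x \<and> x \<le> n" if "x \<in> set rs'" for x
    using IH(2) that by auto
  have IH5: "1 \<le> x \<and> x \<le> t" if "x \<in> set cs'" for x
    using IH(5) that by auto
  have IH6: "x \<in> set rs' \<or> x = 0" if "h \<le> x" "x \<le> t" for x
    using IH(6) that by auto
  note IH' = IH(1,3,4,7)
  have notin: "Suc t \<notin> set cs'"
    using IH5 by fastforce
  have le: "x \<le> Suc t \<longleftrightarrow> x = Suc t \<or> x \<le> t" for x
    by auto
  consider "h \<le> Suc t" "Suc t \<notin> set rs'" | "\<not> (h \<le> Suc t \<and> Suc t \<notin> set rs')" "cand n M h (Suc t) rs' = {}"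
    | "\<not> (h \<le> Suc t \<and> Suc t \<notin> set rs')" "cand n M h (Suc t) rs' \<noteq> {}" by blast
  then show ?case
  proof cases
    case 1
    then have e: "rs = rs' @ [Suc t]" "cs = cs' @ [Suc t]" "d = d'"
      using Suc.prems p by auto
    show ?thesis
      unfolding e using IH' 1 notin Suc.prems(2) IH2 IH5 IH6 by (auto simp: subset_iff le)
  next
    case 2
    then have e: "rs = rs'" "cs = cs'" "d = d'"
      using Suc.prems p by auto
    show ?thesis
      unfolding e using IH' 2(1) IH2 IH5 IH6 by (auto simp: subset_iff le)
  next
    case 3
    define k where "k = Max (cand n M h (Suc t) rs')"
    have "k \<in> cand n M h (Suc t) rs'"
      using fin 3 by (simp add: k_def)
    then have k: "k \<notin> set rs'" "h \<le> k" "k \<le> n"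
      by (auto simp: cand_def)
    have e: "rs = rs' @ [k]" "cs = cs' @ [Suc t]" "d = Suc d'"
      using Suc.prems p 3 by (auto simp: k_def)
    show ?thesis
      unfolding e using IH' 3(1) notin k IH2 IH5 IH6 by (auto simp: subset_iff le)
  qed
qed auto

section \<open>The elimination over power series\<close>

definition unitri :: "nat \<Rightarrow> (nat \<Rightarrow> nat \<Rightarrow> 'b::comm_ring_1) \<Rightarrow> bool" where
  "unitri n w \<longleftrightarrow> (\<forall>i\<in>{1..n}. w i i = 1) \<and> (\<forall>i\<in>{1..n}. \<forall>j\<in>{1..n}. j < i \<longrightarrow> w i j = 0)"

text \<open>The remaining rows are combinations of the pivot rows. The multipliers of pivot rows further up
  have order at least \<open>1\<close> in \<open>\<mu>\<close>; this is what keeps entries on and above the diagonal out of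
  the lowest coefficients.\<close>

definition row_rel :: "nat \<Rightarrow> nat \<Rightarrow> nat \<Rightarrow> nat list \<Rightarrow> (nat \<Rightarrow> nat \<Rightarrow> 'f::field) \<Rightarrow> (nat \<Rightarrow> nat \<Rightarrow> 'f) \<Rightarrow> (nat \<Rightarrow> nat \<Rightarrow> 'f fps) \<Rightarrow> bool" where
  "row_rel n h t rs Z q m \<longleftrightarrow> (\<forall>b\<in>{h..n} - set rs.
     (\<forall>j\<in>{1..t}. charmat Z b j = (\<Sum>a\<in>set rs. m b a * charmat Z a j)) \<and>
     (\<forall>a\<in>set rs. if a < b then fps_nth (m b a) 0 = 0 \<and> fps_nth (m b a) 1 = q b a else fps_nth (m b a) 0 = q b a))"

lemma row_relD:
  assumes "row_rel n h t rs Z q m" "b \<in> {h..n}" "b \<notin> set rs"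
  shows "j \<in> {1..t} \<Longrightarrow> charmat Z b j = (\<Sum>a\<in>set rs. m b a * charmat Z a j)"
    and "a \<in> set rs \<Longrightarrow> a < b \<Longrightarrow> fps_nth (m b a) 0 = 0"
    and "a \<in> set rs \<Longrightarrow> a < b \<Longrightarrow> fps_nth (m b a) (Suc 0) = q b a"
    and "a \<in> set rs \<Longrightarrow> b < a \<Longrightarrow> fps_nth (m b a) 0 = q b a"
  using assms unfolding row_rel_def by force+

text \<open>p may be zero: the order is at least d, and it is d only if p \<noteq> 0.\<close>

definition lead_at :: "'f::field fps \<Rightarrow> nat \<Rightarrow> 'f \<Rightarrow> bool" where
  "lead_at f d p \<longleftrightarrow> fps_nth f d = p \<and> (\<forall>i<d. fps_nth f i = 0)"

lemma lead_at_mult: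
  assumes "lead_at f d p" "lead_at g e r"
  shows "lead_at (f * g) (d + e) (p * r)"
proof -
  have "fps_nth (f * g) i = (if i = d + e then p * r else 0)" if "i \<le> d + e" for i
  proof -
    have "fps_nth (f * g) i = (\<Sum>j=0..i. fps_nth f j * fps_nth g (i - j))"
      by (simp add: fps_mult_nth)
    also have "\<dots> = (\<Sum>j=0..i. if j = d then (if i = d + e then p * r else 0) else 0)"
    proof (rule sum.cong)
      fix j assume "j \<in> {0..i}"
      have "j < d \<or> j = d \<and> i = d + e \<or> j = d \<and> i < d + e \<or> j > d"
        using that by linarith
      then consider "j < d" | "j = d" "i = d + e" | "j = d" "i < d + e" | "j > d" by blast
      then show "fps_nth f j * fps_nth g (i - j) = (if j = d then (if i = d + e then p * r else 0) else 0)"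
      proof cases
        case 3
        then have "i - j < e" using \<open>j \<in> {0..i}\<close> by auto
        then show ?thesis using 3 assms unfolding lead_at_def by auto
      next
        case 4
        then have "i - j < e" using that \<open>j \<in> {0..i}\<close> by auto
        then show ?thesis using 4 assms unfolding lead_at_def by auto
      qed (use assms in \<open>auto simp: lead_at_def\<close>)
    qed simp
    also have "\<dots> = (if i = d + e then p * r else 0)"
      by auto
    finally show ?thesis .
  qed
  then show ?thesis
    unfolding lead_at_def by auto
qed

definition pivot_inv :: "nat \<Rightarrow> place set \<Rightarrow> nat \<Rightarrow> nat \<Rightarrow> (nat \<Rightarrow> nat \<Rightarrow> 'f::field) \<Rightarrow> (nat \<Rightarrow> nat \<Rightarrow> 'f) \<Rightarrow> 'f \<Rightarrow> bool" where
  "pivot_inv n M h t Z q p \<longleftrightarrow> (case proc n M h t of (rs, cs, d) \<Rightarrow>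
     (\<exists>m. row_rel n h t rs Z q m) \<and> lead_at (lminor (charmat Z) rs cs) d p \<and>
     (\<forall>w. unitri n w \<longrightarrow> lminor (colop (charmat Z) w) rs cs = lminor (charmat Z) rs cs))"

definition residual :: "(nat \<Rightarrow> nat \<Rightarrow> 'b::comm_ring_1) \<Rightarrow> nat list \<Rightarrow> (nat \<Rightarrow> nat \<Rightarrow> 'b) \<Rightarrow> nat \<Rightarrow> nat \<Rightarrow> 'b" where
  "residual A rs m t b = A b t - (\<Sum>a\<in>set rs. m b a * A a t)"

text \<open>Subtracting the combination of pivot rows kills all columns up to t, skipped ones
  included. Adding multiples of these to column \<open>Suc t\<close> therefore leaves the pivot
  unchanged, so a minor with gaps in its column list is not affected by upper unitriangular column
  operations.\<close>

lemma residual_colop: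
  assumes "unitri n w" "Suc t \<le> n"
    and "\<And>j. j \<in> {1..t} \<Longrightarrow> A b j = (\<Sum>a\<in>set rs. m b a * A a j)"
  shows "residual (colop A w) rs m (Suc t) b = residual A rs m (Suc t) b"
    and "j \<in> {1..t} \<Longrightarrow> colop A w b j = (\<Sum>a\<in>set rs. m b a * colop A w a j)"
proof -
  have comm: "(\<Sum>a\<in>set rs. m b a * colop A w a j) = (\<Sum>l\<in>{1..j}. (\<Sum>a\<in>set rs. m b a * A a l) * w l j)" for j
    unfolding colop_def sum_distrib_left sum_distrib_right by (subst sum.swap) (simp add: mult.assoc)
  show "j \<in> {1..t} \<Longrightarrow> colop A w b j = (\<Sum>a\<in>set rs. m b a * colop A w a j)"
    unfolding comm by (simp add: colop_def assms(3))
  have "w (Suc t) (Suc t) = 1"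
    using assms by (simp add: unitri_def)
  then show "residual (colop A w) rs m (Suc t) b = residual A rs m (Suc t) b"
    unfolding residual_def comm by (simp add: colop_def assms(3) sum.atLeastLessThan_Suc)
qed

text \<open>A pivot row below b meets column \<open>Suc t\<close> strictly below the diagonal, and
  its multiplier may have a constant term. A pivot row above b has a multiplier of order at least 1,
  which in degree 1 can only meet the constant -1 in row \<open>Suc t\<close>. So no entry of Z on
  or above the diagonal reaches the coefficient of \<mu>.\<close>

lemma residual_nth:
  assumes rel: "row_rel n h t rs Z q m" and b: "b \<in> {h..n}" "b \<notin> set rs" "Suc t \<le> b"
  shows "fps_nth (residual (charmat Z) rs m (Suc t) b) 0 = (if b = Suc t then -1 else 0)"
    and "b \<noteq> Suc t \<Longrightarrow> fps_nth (residual (charmat Z) rs m (Suc t) b) (Suc 0) = psi Z q rs (Suc t) b"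
proof -
  \<comment> \<open>The only entry with a constant term is in row \<open>Suc t\<close>; as a pivot
    row it lies above b, so its multiplier has none.\<close>
  have *: "fps_nth (m b a) 0 * (if a = Suc t then -1 else 0) = (0::'a)" if "a \<in> set rs" for a
    using row_relD(2)[OF rel b(1,2), of a] that b by (cases "a = Suc t"; cases "b = Suc t") auto
  show "fps_nth (residual (charmat Z) rs m (Suc t) b) 0 = (if b = Suc t then -1 else 0)"
    unfolding residual_def by (simp add: fps_sum_nth charmat_nth_0 * del: mult_minus_right)
  assume ne: "b \<noteq> Suc t"
  have "fps_nth (m b a * charmat Z a (Suc t)) (Suc 0)
      = (if b < a then q b a * Z a (Suc t) else 0) - (if a = Suc t then q b (Suc t) else 0)" if a: "a \<in> set rs" for a
  proof -
    have "a \<noteq> b" using a b by auto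
    then consider "b < a" | "a < b" by linarith
    then show ?thesis
      using row_relD(2-4)[OF rel b(1,2), of a] a b ne
      by cases (auto simp: fps_mult_nth_1 charmat_nth_0 charmat_nth_1)
  qed
  then have "fps_nth (\<Sum>a\<in>set rs. m b a * charmat Z a (Suc t)) (Suc 0)
      = (\<Sum>a\<in>set rs. (if b < a then q b a * Z a (Suc t) else 0) - (if a = Suc t then q b (Suc t) else 0))"
    by (simp add: fps_sum_nth)
  also have "\<dots> = (\<Sum>a\<in>{a \<in> set rs. b < a}. q b a * Z a (Suc t)) - (if Suc t \<in> set rs then q b (Suc t) else 0)"
    by (simp add: sum_subtractf sum.inter_filter)
  finally show "fps_nth (residual (charmat Z) rs m (Suc t) b) (Suc 0) = psi Z q rs (Suc t) b"
    by (simp add: residual_def psi_def charmat_nth_1)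
qed

lemma lminor_step:
  assumes rel: "\<And>j. j \<in> {1..t} \<Longrightarrow> charmat Z k j = (\<Sum>a\<in>set rs. m k a * charmat Z a j)"
    and "distinct rs" "length cs = length rs" "set cs \<subseteq> {1..t}" "Suc t \<le> n"
  shows "lminor (charmat Z) (rs @ [k]) (cs @ [Suc t]) = lminor (charmat Z) rs cs * residual (charmat Z) rs m (Suc t) k"
    and "unitri n w \<Longrightarrow> lminor (colop (charmat Z) w) (rs @ [k]) (cs @ [Suc t])
       = lminor (colop (charmat Z) w) rs cs * residual (charmat Z) rs m (Suc t) k"
proof -
  show "lminor (charmat Z) (rs @ [k]) (cs @ [Suc t]) = lminor (charmat Z) rs cs * residual (charmat Z) rs m (Suc t) k"
    unfolding residual_def by (rule lminor_snoc) (use assms in auto)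
  assume w: "unitri n w"
  have rc: "residual (colop (charmat Z) w) rs m (Suc t) k = residual (charmat Z) rs m (Suc t) k"
    "j \<in> {1..t} \<Longrightarrow> colop (charmat Z) w k j = (\<Sum>a\<in>set rs. m k a * colop (charmat Z) w a j)" for j
    by (rule residual_colop[OF w assms(5)]; use rel in simp)+
  have "lminor (colop (charmat Z) w) (rs @ [k]) (cs @ [Suc t])
       = lminor (colop (charmat Z) w) rs cs * residual (colop (charmat Z) w) rs m (Suc t) k"
    unfolding residual_def by (rule lminor_snoc) (use assms rc(2) in auto)
  then show "lminor (colop (charmat Z) w) (rs @ [k]) (cs @ [Suc t])
       = lminor (colop (charmat Z) w) rs cs * residual (charmat Z) rs m (Suc t) k"
    by (simp add: rc(1))
qed

lemma pivot_rel:
  fixes m :: "nat \<Rightarrow> nat \<Rightarrow> 'b::comm_ring_1"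
  assumes "\<And>j. j \<in> {1..t} \<Longrightarrow> A b j = (\<Sum>a\<in>set rs. m b a * A a j)"
    and "\<And>j. j \<in> {1..t} \<Longrightarrow> A k j = (\<Sum>a\<in>set rs. m k a * A a j)"
    and "r * residual A rs m (Suc t) k = residual A rs m (Suc t) b" and "k \<notin> set rs"
    and j: "j \<in> {1..Suc t}"
  shows "A b j = (\<Sum>a\<in>set (rs @ [k]). (if a = k then r else m b a - r * m k a) * A a j)"
proof -
  have "(\<Sum>a\<in>set (rs @ [k]). (if a = k then r else m b a - r * m k a) * A a j)
    = r * A k j + (\<Sum>a\<in>set rs. (if a = k then r else m b a - r * m k a) * A a j)"
    using assms(4) by (simp add: insert_absorb)
  also have "(\<Sum>a\<in>set rs. (if a = k then r else m b a - r * m k a) * A a j)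
     = (\<Sum>a\<in>set rs. m b a * A a j - r * (m k a * A a j))"
    using assms(4) by (intro sum.cong) (auto simp: algebra_simps)
  also have "\<dots> = (\<Sum>a\<in>set rs. m b a * A a j) - r * (\<Sum>a\<in>set rs. m k a * A a j)"
    by (simp add: sum_subtractf sum_distrib_left)
  also have "r * A k j + \<dots> = A b j"
  proof (cases "j = Suc t")
    case True
    then show ?thesis using assms(3) by (simp add: residual_def algebra_simps)
  next
    case False
    then show ?thesis using j assms(1,2)[of j] by simp
  qed
  finally show ?thesis by simp
qed

text \<open>On and above the diagonal Z is unconstrained. This freedom lets Z be a conjugate of the
  generic matrix while y describes the transformed functional.\<close>

definition lower_part :: "nat \<Rightarrow> place set \<Rightarrow> (nat \<Rightarrow> nat \<Rightarrow> 'f::field) \<Rightarrow> (nat \<Rightarrow> nat \<Rightarrow> 'f) \<Rightarrow> bool" where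
  "lower_part n M Z y \<longleftrightarrow> (\<forall>i\<in>{1..n}. \<forall>j\<in>{1..n}. j < i \<longrightarrow> Z i j = y i j) \<and> (\<forall>(i, j)\<in>M. j < i \<longrightarrow> Z i j = 0)"

lemma psi_cong:
  assumes "\<And>a. a \<in> set rs \<Longrightarrow> b < a \<Longrightarrow> Z a t = y a t" "Z b t = y b t"
  shows "psi Z q rs t b = psi y q rs t b"
  using assms by (simp add: psi_def)

text \<open>With a diagonal pivot the residual is a unit. With no candidate all remaining rows lie
  in M and vanish on the columns so far. Otherwise all remaining residuals are divisible by \<mu>,
  and the bottommost candidate k is taken: remaining rows below k vanish, so a multiplier with
  constant term arises only for rows above their pivot, as \<open>row_rel\<close> demands. Only the
  second conclusion divides by the new pivot, so it alone asks for a non-zero lead.\<close>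

lemma pivot_inv_step:
  fixes Z :: "nat \<Rightarrow> nat \<Rightarrow> 'f::field"
  assumes inv: "pivot_inv n M h t Z (fst (lead n M h y t)) (snd (lead n M h y t))"
    and t: "Suc t \<le> n" and h: "1 \<le> h" and M: "left_down n M" and Z: "lower_part n M Z y"
  shows "case proc n M h (Suc t) of (rs, cs, d) \<Rightarrow> lead_at (lminor (charmat Z) rs cs) d (snd (lead n M h y (Suc t)))"
    and "snd (lead n M h y (Suc t)) \<noteq> 0 \<Longrightarrow>
      pivot_inv n M h (Suc t) Z (fst (lead n M h y (Suc t))) (snd (lead n M h y (Suc t)))"
proof -
  obtain rs cs d where p: "proc n M h t = (rs, cs, d)" by (cases "proc n M h t")
  obtain q l where ql: "lead n M h y t = (q, l)" by (cases "lead n M h y t")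
  obtain m where rel: "row_rel n h t rs Z q m" and la: "lead_at (lminor (charmat Z) rs cs) d l"
    and w: "\<And>w. unitri n w \<Longrightarrow> lminor (colop (charmat Z) w) rs cs = lminor (charmat Z) rs cs"
    using inv by (auto simp: pivot_inv_def p ql)
  note relD = row_relD[OF rel]
  have facts: "distinct rs" "set rs \<subseteq> {h..n}" "length cs = length rs" "set cs \<subseteq> {1..t}" "{h..t} \<subseteq> set rs"
    using proc_facts[OF p] t h by auto
  let ?Y = "charmat Z" and ?x = "residual (charmat Z) rs m (Suc t)"
  define f where "f = psi y q rs (Suc t)"
  have gt: "Suc t \<le> b" if "b \<in> {h..n}" "b \<notin> set rs" for b
    using facts(5) that by (meson atLeastAtMost_iff not_less_eq_eq subsetD)
  have x0: "fps_nth (?x b) 0 = (if b = Suc t then -1 else 0)" if "b \<in> {h..n}" "b \<notin> set rs" for b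
    using residual_nth(1)[OF rel that gt[OF that]] .
  have x1: "fps_nth (?x b) (Suc 0) = f b" if "b \<in> {h..n}" "b \<notin> set rs" "b \<noteq> Suc t" for b
  proof -
    have "psi Z q rs (Suc t) b = psi y q rs (Suc t) b"
      using Z gt[OF that(1,2)] that facts(2) t h
      by (intro psi_cong) (auto simp: lower_part_def subset_iff)
    then show ?thesis
      using residual_nth(2)[OF rel that(1,2) gt[OF that(1,2)] that(3)] by (simp add: f_def)
  qed
  \<comment> \<open>M is closed to the left, so the row segment up to column \<open>Suc t\<close>
    vanishes; it stops short of the diagonal.\<close>
  have zero: "?Y b j = 0" if "(b, Suc t) \<in> M" "Suc t < b" "b \<le> n" "j \<in> {1..Suc t}" for b j
  proof -
    have "(b, j) \<in> M"
      using M that unfolding left_down_def by (metis atLeastAtMost_iff order_refl)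
    then have "Z b j = 0"
      using Z that by (auto simp: lower_part_def)
    then show ?thesis
      using that by (auto simp: charmat_def)
  qed
  have fin: "finite (cand n M h (Suc t) rs)"
    by (rule finite_subset[of _ "{..n}"]) (auto simp: cand_def)
  let ?G = "(case proc n M h (Suc t) of (rs, cs, d) \<Rightarrow> lead_at (lminor (charmat Z) rs cs) d (snd (lead n M h y (Suc t)))) \<and>
     (snd (lead n M h y (Suc t)) \<noteq> 0 \<longrightarrow> pivot_inv n M h (Suc t) Z (fst (lead n M h y (Suc t))) (snd (lead n M h y (Suc t))))"
  consider (new) "h \<le> Suc t" "Suc t \<notin> set rs"
    | (stay) "\<not> (h \<le> Suc t \<and> Suc t \<notin> set rs)" "cand n M h (Suc t) rs = {}"
    | (jump) "\<not> (h \<le> Suc t \<and> Suc t \<notin> set rs)" "cand n M h (Suc t) rs \<noteq> {}" by blast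
  then have G: ?G
  proof cases
    case new
    have R: "Suc t \<in> {h..n}" using new t by auto
    have relk: "?Y (Suc t) j = (\<Sum>a\<in>set rs. m (Suc t) a * ?Y a j)" if "j \<in> {1..t}" for j
      using relD(1)[OF R new(2) that] .
    have step: "lminor ?Y (rs @ [Suc t]) (cs @ [Suc t]) = lminor ?Y rs cs * ?x (Suc t)"
      "unitri n w \<Longrightarrow> lminor (colop ?Y w) (rs @ [Suc t]) (cs @ [Suc t]) = lminor (colop ?Y w) rs cs * ?x (Suc t)" for w
      by (rule lminor_step[where n = n]; use relk facts(1,3,4) t in simp)+
    have la': "lead_at (lminor ?Y (rs @ [Suc t]) (cs @ [Suc t])) d (- l)"
    proof -
      have "lead_at (?x (Suc t)) 0 (- 1)"
        using x0[OF R new(2)] by (simp add: lead_at_def)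
      from lead_at_mult[OF la this] show ?thesis
        by (simp add: step(1))
    qed
    define r where "r b = ?x b * inverse (?x (Suc t))" for b
    have u: "fps_nth (?x (Suc t)) 0 \<noteq> 0" using x0[OF R new(2)] by simp
    have rx: "r b * ?x (Suc t) = ?x b" for b
      unfolding r_def using inverse_mult_eq_1[OF u] by (simp add: mult.assoc)
    have r0: "fps_nth (r b) 0 = 0" "fps_nth (r b) (Suc 0) = - f b" if "b \<in> {h..n}" "b \<notin> set rs" "b \<noteq> Suc t" for b
      using x0[OF that(1,2)] x1[OF that] x0[OF R new(2)] that
      by (simp_all add: r_def fps_mult_nth_1)
    let ?m = "\<lambda>b a. if a = Suc t then r b else m b a - r b * m (Suc t) a"
    let ?q = "\<lambda>b a. if a = Suc t then - f b else if a < b then q b a + f b * (if a < Suc t then 0 else q (Suc t) a) else q b a"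
    have "row_rel n h (Suc t) (rs @ [Suc t]) Z ?q ?m"
      unfolding row_rel_def
    proof (intro ballI conjI)
      fix b assume b: "b \<in> {h..n} - set (rs @ [Suc t])"
      then have b': "b \<in> {h..n}" "b \<notin> set rs" "b \<noteq> Suc t" by auto
      show "?Y b j = (\<Sum>a\<in>set (rs @ [Suc t]). ?m b a * ?Y a j)" if "j \<in> {1..Suc t}" for j
        by (rule pivot_rel[OF _ _ rx new(2) that]) (use relD(1) b' R new in auto)
      fix a assume a: "a \<in> set (rs @ [Suc t])"
      show "if a < b then fps_nth (?m b a) 0 = 0 \<and> fps_nth (?m b a) 1 = ?q b a else fps_nth (?m b a) 0 = ?q b a"
      proof (cases "a = Suc t")
        case True
        then show ?thesis using r0[OF b'] gt[OF b'(1,2)] b'(3) by auto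
      next
        case False
        then have a: "a \<in> set rs" using a by auto
        have "a \<noteq> b" using a b' by auto
        moreover have "fps_nth (m (Suc t) a) 0 = (if a < Suc t then 0 else q (Suc t) a)"
          using relD(2,4)[OF R new(2) a] False by auto
        ultimately show ?thesis
          using relD(2-4)[OF b'(1,2) a] r0[OF b'] False by (auto simp: fps_mult_nth_1)
      qed
    qed
    moreover have "lminor (colop ?Y w) (rs @ [Suc t]) (cs @ [Suc t]) = lminor ?Y (rs @ [Suc t]) (cs @ [Suc t])"
      if "unitri n w" for w
      using step(2)[OF that] step(1) w[OF that] by simp
    ultimately have "pivot_inv n M h (Suc t) Z ?q (- l)"
      using la' new p by (auto simp: pivot_inv_def)
    then have pi: "pivot_inv n M h (Suc t) Z (\<lambda>b a. if a = Suc t then - psi y q rs (Suc t) b else if a < b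
       then q b a + psi y q rs (Suc t) b * (if a < Suc t then 0 else q (Suc t) a) else q b a) (- l)"
      unfolding f_def .
    have pr: "proc n M h (Suc t) = (rs @ [Suc t], cs @ [Suc t], d)"
      using new p by simp
    have le: "lead n M h y (Suc t) = (\<lambda>b a. if a = Suc t then - psi y q rs (Suc t) b else if a < b
       then q b a + psi y q rs (Suc t) b * (if a < Suc t then 0 else q (Suc t) a) else q b a, - l)"
      using new by (simp add: p ql Let_def)
    show ?thesis
      unfolding pr le fst_conv snd_conv prod.case using la' pi by blast
  next
    case stay
    have b': "(b, Suc t) \<in> M \<and> Suc t < b \<and> b \<le> n" if "b \<in> {h..n}" "b \<notin> set rs" for b
    proof -
      have "b \<noteq> Suc t" using stay(1) that by auto
      then show ?thesis using stay(2) that gt[OF that] by (auto simp: cand_def)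
    qed
    have "row_rel n h (Suc t) rs Z (\<lambda>_ _. 0) (\<lambda>_ _. 0)"
      unfolding row_rel_def using b' zero by auto
    then have "\<exists>m. row_rel n h (Suc t) rs Z (\<lambda>_ _. 0) m" by blast
    then have pi: "pivot_inv n M h (Suc t) Z (\<lambda>_ _. 0) l"
      using la w stay p by (auto simp: pivot_inv_def)
    have pr: "proc n M h (Suc t) = (rs, cs, d)"
      using stay p by auto
    have le: "lead n M h y (Suc t) = (\<lambda>_ _. 0, l)"
      using stay by (auto simp: p ql Let_def)
    show ?thesis
      unfolding pr le fst_conv snd_conv prod.case using la pi by blast
  next
    case jump
    define k where "k = Max (cand n M h (Suc t) rs)"
    have "k \<in> cand n M h (Suc t) rs" using fin jump(2) by (simp add: k_def)
    then have k: "k \<in> {h..n}" "k \<notin> set rs" "k \<noteq> Suc t" "(k, Suc t) \<notin> M" "Suc t < k"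
      by (auto simp: cand_def)
    have kmax: "b \<le> k \<or> (b, Suc t) \<in> M" if "b \<in> {h..n}" "b \<notin> set rs" for b
    proof -
      have "b \<noteq> Suc t" using jump(1) that by auto
      then have "(b, Suc t) \<in> M \<or> b \<in> cand n M h (Suc t) rs"
        using that gt[OF that] by (auto simp: cand_def)
      then show ?thesis using fin by (auto simp: k_def)
    qed
    have neq: "b \<noteq> Suc t" if "b \<in> {h..n}" "b \<notin> set rs" for b
      using jump(1) that by auto
    have relk: "?Y k j = (\<Sum>a\<in>set rs. m k a * ?Y a j)" if "j \<in> {1..t}" for j
      using relD(1)[OF k(1,2) that] .
    have step: "lminor ?Y (rs @ [k]) (cs @ [Suc t]) = lminor ?Y rs cs * ?x k"
      "unitri n w \<Longrightarrow> lminor (colop ?Y w) (rs @ [k]) (cs @ [Suc t]) = lminor (colop ?Y w) rs cs * ?x k" for w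
      by (rule lminor_step[where n = n]; use relk facts(1,3,4) t in simp)+
    have la': "lead_at (lminor ?Y (rs @ [k]) (cs @ [Suc t])) (Suc d) (l * f k)"
    proof -
      have "lead_at (?x k) 1 (f k)"
        using x0[OF k(1,2)] x1[OF k(1-3)] k(3) by (simp add: lead_at_def)
      from lead_at_mult[OF la this] show ?thesis
        by (simp add: step(1))
    qed
    have inv': "pivot_inv n M h (Suc t) Z (fst (lead n M h y (Suc t))) (snd (lead n M h y (Suc t)))" if nz: "f k \<noteq> 0"
    proof -
      \<comment> \<open>Both residuals have order at least 1. Dividing out \<mu> makes the pivot a
        unit, so the quotient of the residuals is a power series with constant term
        \<open>f b / f k\<close>.\<close>
      define s where "s b = fps_shift 1 (?x b)" for b
      have xs: "?x b = s b * fps_X" if "b \<in> {h..n}" "b \<notin> set rs" for b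
        using x0[OF that] neq[OF that] by (auto simp: s_def fps_eq_iff)
      have s0: "fps_nth (s b) 0 = f b" if "b \<in> {h..n}" "b \<notin> set rs" for b
        using x1[OF that neq[OF that]] by (simp add: s_def)
      define r where "r b = s b * inverse (s k)" for b
      have u: "fps_nth (s k) 0 \<noteq> 0" using s0[OF k(1,2)] nz by simp
      have rx: "r b * ?x k = ?x b" if "b \<in> {h..n}" "b \<notin> set rs" for b
      proof -
        have "r b * ?x k = s b * (inverse (s k) * s k) * fps_X"
          unfolding r_def xs[OF k(1,2)] by (simp only: mult_ac)
        then show ?thesis
          unfolding inverse_mult_eq_1[OF u] xs[OF that] by simp
      qed
      have r0: "fps_nth (r b) 0 = f b / f k" if "b \<in> {h..n}" "b \<notin> set rs" for b
        using s0[OF that] s0[OF k(1,2)] by (simp add: r_def divide_inverse)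
      let ?m = "\<lambda>b a. if (b, Suc t) \<in> M then 0 else if a = k then r b else m b a - r b * m k a"
      let ?q = "\<lambda>b a. if (b, Suc t) \<in> M then 0 else if a = k then f b / f k
          else if a < b then q b a - f b / f k * q k a
          else q b a - f b / f k * (if a < k then 0 else q k a)"
      have "row_rel n h (Suc t) (rs @ [k]) Z ?q ?m"
        unfolding row_rel_def
      proof (intro ballI conjI)
        fix b assume b: "b \<in> {h..n} - set (rs @ [k])"
        then have b': "b \<in> {h..n}" "b \<notin> set rs" "b \<noteq> k" by auto
        have bt: "Suc t < b" using gt[OF b'(1,2)] neq[OF b'(1,2)] by auto
        show "?Y b j = (\<Sum>a\<in>set (rs @ [k]). ?m b a * ?Y a j)" if j: "j \<in> {1..Suc t}" for j
        proof (cases "(b, Suc t) \<in> M")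
          case True
          then show ?thesis using zero[OF True bt] b' j by simp
        next
          case False
          have "?Y b j = (\<Sum>a\<in>set (rs @ [k]). (if a = k then r b else m b a - r b * m k a) * ?Y a j)"
            by (rule pivot_rel[OF _ _ rx[OF b'(1,2)] k(2) j]) (use relD(1) b' k in auto)
          then show ?thesis using False by simp
        qed
        fix a assume a: "a \<in> set (rs @ [k])"
        show "if a < b then fps_nth (?m b a) 0 = 0 \<and> fps_nth (?m b a) 1 = ?q b a else fps_nth (?m b a) 0 = ?q b a"
        proof (cases "(b, Suc t) \<in> M")
          case False
          then have bk: "b < k" using kmax[OF b'(1,2)] b'(3) by auto
          show ?thesis
          proof (cases "a = k")
            case True
            then show ?thesis using r0[OF b'(1,2)] bk False by auto
          next
            case ak: False
            then have a: "a \<in> set rs" using a by auto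
            have "a \<noteq> b" using a b' by auto
            moreover have "fps_nth (m k a) 0 = (if a < k then 0 else q k a)"
              using relD(2,4)[OF k(1,2) a] ak by auto
            moreover have "a < k \<Longrightarrow> fps_nth (m k a) (Suc 0) = q k a"
              using relD(3)[OF k(1,2) a] by auto
            ultimately show ?thesis
              using relD(2-4)[OF b'(1,2) a] r0[OF b'(1,2)] False ak bk by (auto simp: fps_mult_nth_1)
          qed
        qed auto
      qed
      moreover have "lminor (colop ?Y w) (rs @ [k]) (cs @ [Suc t]) = lminor ?Y (rs @ [k]) (cs @ [Suc t])"
        if "unitri n w" for w
        using step(2)[OF that] step(1) w[OF that] by simp
      moreover have "proc n M h (Suc t) = (rs @ [k], cs @ [Suc t], Suc d)"
        using jump p by (auto simp: k_def)
      moreover have "lead n M h y (Suc t) = (?q, l * f k)"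
        using jump unfolding f_def k_def by (auto simp: p ql Let_def)
      ultimately show ?thesis
        using la' by (simp add: pivot_inv_def del: proc.simps lead.simps) blast
    qed
    have pr: "proc n M h (Suc t) = (rs @ [k], cs @ [Suc t], Suc d)"
      using jump p by (auto simp: k_def)
    have le: "snd (lead n M h y (Suc t)) = l * f k"
      using jump by (auto simp add: p ql Let_def k_def f_def)
    show ?thesis
      using la' inv' unfolding pr le by auto
  qed
  show "case proc n M h (Suc t) of (rs, cs, d) \<Rightarrow> lead_at (lminor (charmat Z) rs cs) d (snd (lead n M h y (Suc t)))"
    by (rule conjunct1[OF G])
  show "snd (lead n M h y (Suc t)) \<noteq> 0 \<Longrightarrow>
      pivot_inv n M h (Suc t) Z (fst (lead n M h y (Suc t))) (snd (lead n M h y (Suc t)))"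
    by (rule mp[OF conjunct2[OF G]])
qed

lemma pivot_inv_lead:
  fixes Z :: "nat \<Rightarrow> nat \<Rightarrow> 'f::field"
  assumes h: "1 \<le> h" and M: "left_down n M" and Z: "lower_part n M Z y"
  shows "t \<le> n \<Longrightarrow> snd (lead n M h y t) \<noteq> 0 \<Longrightarrow> pivot_inv n M h t Z (fst (lead n M h y t)) (snd (lead n M h y t))"
proof (induction t)
  case 0
  then show ?case by (auto simp: pivot_inv_def row_rel_def lead_at_def)
next
  case (Suc t)
  then have "snd (lead n M h y t) \<noteq> 0"
    by (auto split: prod.splits if_splits simp: Let_def)
  then show ?case
    using Suc pivot_inv_step(2)[OF _ Suc.prems(1) h M Z] by auto
qed

lemma lead_Suc_nonzero: "snd (lead n M h y (Suc t)) \<noteq> 0 \<Longrightarrow> snd (lead n M h y t) \<noteq> 0"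
  by (auto split: prod.splits if_splits simp: Let_def)

text \<open>Non-vanishing is asked for only up to column t, so this applies also while the lead for
  \<open>Suc t\<close> is not yet known to be non-zero.\<close>

lemma lead_at_lminor:
  fixes Z :: "nat \<Rightarrow> nat \<Rightarrow> 'f::field"
  assumes "1 \<le> h" "left_down n M" "lower_part n M Z y" "Suc t \<le> n" "snd (lead n M h y t) \<noteq> 0"
    and "proc n M h (Suc t) = (rs, cs, d)"
  shows "lead_at (lminor (charmat Z) rs cs) d (snd (lead n M h y (Suc t)))"
  using pivot_inv_step(1)[OF pivot_inv_lead[OF assms(1-3) _ assms(5)] assms(4,1-3)] assms(4,6) by simp

section \<open>Conjugation by unitriangular matrices\<close>

text \<open>The list need not be sorted, so the matrix is triangular only up to a simultaneous
  permutation. In the Leibniz sum a permutation other than the identity must take some position to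
  one with a smaller row index, because the sums of \<open>rs ! i\<close> and of
  \<open>rs ! p i\<close> agree.\<close>

lemma lminor_unitri:
  fixes U :: "nat \<Rightarrow> nat \<Rightarrow> 'b::comm_ring_1"
  assumes "distinct rs" "\<And>a. a \<in> set rs \<Longrightarrow> U a a = 1"
    "\<And>a a'. a \<in> set rs \<Longrightarrow> a' \<in> set rs \<Longrightarrow> a' < a \<Longrightarrow> U a a' = 0"
  shows "lminor U rs rs = 1"
proof -
  let ?r = "length rs"
  let ?f = "\<lambda>p. signof p * (\<Prod>i = 0..<?r. U (rs ! i) (rs ! p i))"
  have "lminor U rs rs = (\<Sum>p\<in>{p. p permutes {0..<?r}}. ?f p)"
    unfolding lminor_def by (subst det_def'[of _ ?r]) (auto intro!: sum.cong prod.cong simp: permutes_in_image)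
  also have "\<dots> = (\<Sum>p\<in>{id}. ?f p)"
  proof (rule sum.mono_neutral_right)
    show "finite {p. p permutes {0..<?r}}" by (rule finite_permutations) simp
    show "{id} \<subseteq> {p. p permutes {0..<?r}}" by (simp add: permutes_id)
    show "\<forall>p\<in>{p. p permutes {0..<?r}} - {id}. ?f p = 0"
    proof
      fix p assume "p \<in> {p. p permutes {0..<?r}} - {id}"
      then have p: "p permutes {0..<?r}" "p \<noteq> id" by auto
      have "\<exists>i<?r. rs ! p i < rs ! i"
      proof (rule ccontr)
        assume "\<not> (\<exists>i<?r. rs ! p i < rs ! i)"
        then have le: "rs ! i \<le> rs ! p i" if "i \<in> {0..<?r}" for i
          using that by (meson atLeastLessThan_iff not_le)
        have "(\<Sum>i\<in>{0..<?r}. rs ! i) = (\<Sum>i\<in>{0..<?r}. rs ! p i)"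
          using sum.permute[OF p(1), of "\<lambda>i. rs ! i"] by simp
        then have eq: "rs ! i = rs ! p i" if "i \<in> {0..<?r}" for i
          using sum_mono_inv[of "\<lambda>i. rs ! i" "{0..<?r}" "\<lambda>i. rs ! p i" i] le that by simp
        have "p i = i" for i
        proof (cases "i \<in> {0..<?r}")
          case True
          then show ?thesis
            using eq[OF True] permutes_in_image[OF p(1), of i] assms(1) by (simp add: nth_eq_iff_index_eq)
        qed (use p(1) in \<open>simp add: permutes_not_in\<close>)
        with p(2) show False by auto
      qed
      then obtain i where i: "i < ?r" "rs ! p i < rs ! i" by blast
      then have "U (rs ! i) (rs ! p i) = 0"
        using permutes_in_image[OF p(1), of i] by (intro assms(3)) auto
      then have "(\<Prod>i = 0..<?r. U (rs ! i) (rs ! p i)) = 0"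
        using i(1) by (intro prod_zero) auto
      then show "?f p = 0" by simp
    qed
  qed
  also have "\<dots> = 1"
    by (simp add: assms(2))
  finally show ?thesis .
qed

lemma lminor_hom:
  assumes "comm_ring_hom \<phi>" "length cs = length rs"
  shows "lminor (\<lambda>i j. \<phi> (A i j)) rs cs = \<phi> (lminor A rs cs)"
proof -
  interpret comm_ring_hom \<phi> by fact
  let ?r = "length rs"
  have "map_mat \<phi> (mat ?r ?r (\<lambda>(a, b). A (rs ! a) (cs ! b))) = mat ?r ?r (\<lambda>(a, b). \<phi> (A (rs ! a) (cs ! b)))"
    by (rule eq_matI) auto
  then show ?thesis
    unfolding lminor_def using hom_det by metis
qed

lemma comm_ring_hom_fps_nth_0: "comm_ring_hom (\<lambda>f :: 'b::comm_ring_1 fps. fps_nth f 0)"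
  by unfold_locales (auto simp: fps_mult_nth_0)

lemma sum_interval_split:
  fixes f :: "nat \<Rightarrow> 'b::comm_ring_1"
  assumes "a \<in> {h..n}" "set rs \<subseteq> {h..n}" "1 \<le> h" "\<And>i. i \<in> {1..n} \<Longrightarrow> i < a \<Longrightarrow> f i = 0"
  shows "(\<Sum>i\<in>{1..n}. f i) = (\<Sum>i\<in>set rs. f i) + (\<Sum>i\<in>{h..n} - set rs. f i)"
proof -
  have "(\<Sum>i\<in>{1..n}. f i) = (\<Sum>i\<in>{h..n}. f i)"
    using assms by (intro sum.mono_neutral_right) auto
  also have "\<dots> = (\<Sum>i\<in>{h..n} - set rs. f i) + (\<Sum>i\<in>set rs. f i)"
    using assms by (intro sum.subset_diff) auto
  finally show ?thesis by simp
qed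

definition conj_by :: "nat \<Rightarrow> (nat \<Rightarrow> nat \<Rightarrow> 'b::comm_ring_1) \<Rightarrow> (nat \<Rightarrow> nat \<Rightarrow> 'b) \<Rightarrow> (nat \<Rightarrow> nat \<Rightarrow> 'b) \<Rightarrow> nat \<Rightarrow> nat \<Rightarrow> 'b" where
  "conj_by n v Z w i j = (\<Sum>k\<in>{1..n}. \<Sum>l\<in>{1..n}. v i k * Z k l * w l j)"

text \<open>Since v and w are inverse to each other, conjugating Z conjugates
  \<open>\<mu>Z - E\<close>.\<close>

lemma charmat_conj_by:
  fixes Z :: "nat \<Rightarrow> nat \<Rightarrow> 'f::field"
  assumes w: "unitri n w" and vw: "\<And>i j. i \<in> {1..n} \<Longrightarrow> j \<in> {1..n} \<Longrightarrow> (\<Sum>k\<in>{1..n}. v i k * w k j) = (if i = j then 1 else 0)"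
    and i: "i \<in> {1..n}" and j: "j \<in> {1..n}"
  shows "charmat (conj_by n v Z w) i j =
    (\<Sum>k\<in>{1..n}. fps_const (v i k) * colop (charmat Z) (\<lambda>k l. fps_const (w k l)) k j)"
proof -
  have col: "colop (charmat Z) (\<lambda>k l. fps_const (w k l)) k j = (\<Sum>l\<in>{1..n}. charmat Z k l * fps_const (w l j))" for k
    unfolding colop_def using w j by (intro sum.mono_neutral_left) (auto simp: unitri_def)
  have "(\<Sum>k\<in>{1..n}. fps_const (v i k) * colop (charmat Z) (\<lambda>k l. fps_const (w k l)) k j)
     = (\<Sum>k\<in>{1..n}. \<Sum>l\<in>{1..n}. fps_const (v i k * Z k l * w l j) * fps_X - (if k = l then fps_const (v i k * w k j) else 0))"
    unfolding col sum_distrib_left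
    by (intro sum.cong refl) (auto simp: charmat_def algebra_simps simp flip: fps_const_mult)
  also have "\<dots> = (\<Sum>k\<in>{1..n}. \<Sum>l\<in>{1..n}. fps_const (v i k * Z k l * w l j)) * fps_X
      - (\<Sum>k\<in>{1..n}. fps_const (v i k * w k j))"
    by (simp add: sum_subtractf sum_distrib_right)
  also have "(\<Sum>k\<in>{1..n}. fps_const (v i k * w k j)) = fps_const (\<Sum>k\<in>{1..n}. v i k * w k j)"
    by (simp add: fps_eq_iff fps_sum_nth)
  also have "(\<Sum>k\<in>{1..n}. \<Sum>l\<in>{1..n}. fps_const (v i k * Z k l * w l j)) = fps_const (conj_by n v Z w i j)"
    by (auto simp: conj_by_def fps_eq_iff fps_sum_nth)
  finally show ?thesis
    unfolding vw[OF i j] charmat_def[of "conj_by n v Z w"] by (cases "i = j") simp_all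
qed

text \<open>v adds to a pivot row other rows further down the window, and the non-pivot ones among
  them are rewritten by \<open>row_rel\<close>. So the pivot rows change by a matrix V whose
  constant term is unitriangular: a correction to the entry (a, a') with a' \<le> a passes through a
  row b > a \<ge> a', whose multiplier has order at least 1. Hence \<open>lminor V rs rs\<close>
  starts with 1, and the column operation is harmless by \<open>pivot_inv\<close>.\<close>

lemma lead_at_conj_by:
  fixes Z :: "nat \<Rightarrow> nat \<Rightarrow> 'f::field"
  assumes inv: "pivot_inv n M h t Z q p" and h: "1 \<le> h" and t: "t \<le> n"
    and v: "unitri n v" and w: "unitri n w"
    and vw: "\<And>i j. i \<in> {1..n} \<Longrightarrow> j \<in> {1..n} \<Longrightarrow> (\<Sum>k\<in>{1..n}. v i k * w k j) = (if i = j then 1 else 0)"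
    and pr: "proc n M h t = (rs, cs, d)"
  shows "lead_at (lminor (charmat (conj_by n v Z w)) rs cs) d p"
proof -
  obtain m where rel: "row_rel n h t rs Z q m" and la: "lead_at (lminor (charmat Z) rs cs) d p"
    and inv_w: "\<And>w. unitri n w \<Longrightarrow> lminor (colop (charmat Z) w) rs cs = lminor (charmat Z) rs cs"
    using inv by (auto simp: pivot_inv_def pr)
  have facts: "distinct rs" "set rs \<subseteq> {h..n}" "length cs = length rs" "set cs \<subseteq> {1..t}"
    using proc_facts[OF pr t] by auto
  define w' where "w' k l = fps_const (w k l)" for k l
  have w': "unitri n w'"
    using w by (auto simp: unitri_def w'_def)
  let ?C = "colop (charmat Z) w'"
  have C: "?C b j = (\<Sum>a\<in>set rs. m b a * ?C a j)" if "b \<in> {h..n} - set rs" "j \<in> {1..t}" for b j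
  proof -
    have "(\<Sum>a\<in>set rs. m b a * ?C a j) = (\<Sum>l\<in>{1..j}. (\<Sum>a\<in>set rs. m b a * charmat Z a l) * w' l j)"
      unfolding colop_def sum_distrib_left sum_distrib_right by (subst sum.swap) (simp add: mult.assoc)
    also have "\<dots> = (\<Sum>l\<in>{1..j}. charmat Z b l * w' l j)"
      using row_relD(1)[OF rel] that by (intro sum.cong) auto
    finally show ?thesis by (simp add: colop_def)
  qed
  define V where "V a a' = fps_const (v a a') + (\<Sum>b\<in>{h..n} - set rs. fps_const (v a b) * m b a')" for a a'
  have eq: "lminor (charmat (conj_by n v Z w)) rs cs = lminor V rs rs * lminor ?C rs cs"
  proof (rule lminor_mult_left[OF facts(3,1)])
    fix a j assume a: "a \<in> set rs" and j: "j \<in> set cs"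
    have a': "a \<in> {h..n}" "a \<in> {1..n}" and j': "j \<in> {1..n}" "j \<in> {1..t}"
      using a j facts(2,4) t h by auto
    have "charmat (conj_by n v Z w) a j = (\<Sum>k\<in>{1..n}. fps_const (v a k) * ?C k j)"
      unfolding w'_def by (rule charmat_conj_by[OF w vw a'(2) j'(1)])
    also have "\<dots> = (\<Sum>k\<in>set rs. fps_const (v a k) * ?C k j) + (\<Sum>k\<in>{h..n} - set rs. fps_const (v a k) * ?C k j)"
      using v a' by (intro sum_interval_split[OF a'(1) facts(2) h]) (auto simp: unitri_def)
    also have "(\<Sum>k\<in>{h..n} - set rs. fps_const (v a k) * ?C k j)
       = (\<Sum>k\<in>{h..n} - set rs. \<Sum>a'\<in>set rs. fps_const (v a k) * m k a' * ?C a' j)"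
      using C j'(2) by (intro sum.cong refl) (simp add: sum_distrib_left mult.assoc)
    also have "\<dots> = (\<Sum>a'\<in>set rs. (\<Sum>k\<in>{h..n} - set rs. fps_const (v a k) * m k a') * ?C a' j)"
      by (subst sum.swap) (simp add: sum_distrib_right)
    finally show "charmat (conj_by n v Z w) a j = (\<Sum>a'\<in>set rs. V a a' * ?C a' j)"
      by (simp add: V_def distrib_right sum.distrib)
  qed
  have "lminor (\<lambda>a a'. fps_nth (V a a') 0) rs rs = 1"
  proof (rule lminor_unitri[OF facts(1)])
    have m0: "v a b * fps_nth (m b a') 0 = 0"
      if "a \<in> set rs" "a' \<in> set rs" "b \<in> {h..n} - set rs" "a' \<le> a" for a a' b
    proof (cases "b < a")
      case True
      have "a \<in> {1..n}" "b \<in> {1..n}"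
        using that facts(2) h by (auto simp: subset_iff)
      then show ?thesis using True v by (simp add: unitri_def)
    next
      case False
      moreover have "b \<noteq> a" using that by auto
      ultimately have "a' < b" using that by simp
      then show ?thesis using row_relD(2)[OF rel] that by simp
    qed
    have rs1: "a \<in> {1..n}" if "a \<in> set rs" for a
      using that facts(2) h by auto
    have V0: "fps_nth (V a a') 0 = v a a'" if "a \<in> set rs" "a' \<in> set rs" "a' \<le> a" for a a'
    proof -
      have "(\<Sum>b\<in>{h..n} - set rs. v a b * fps_nth (m b a') 0) = 0"
        using m0[OF that(1,2)] that(3) by (intro sum.neutral) blast
      then show ?thesis by (simp add: V_def fps_sum_nth)
    qed
    show "fps_nth (V a a) 0 = 1" if "a \<in> set rs" for a
      using V0[OF that that] rs1[OF that] v by (simp add: unitri_def)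
    show "fps_nth (V a a') 0 = 0" if "a \<in> set rs" "a' \<in> set rs" "a' < a" for a a'
      using V0[OF that(1,2)] that rs1[OF that(1)] rs1[OF that(2)] v by (simp add: unitri_def)
  qed
  then have "lead_at (lminor V rs rs) 0 1"
    using lminor_hom[OF comm_ring_hom_fps_nth_0, of rs rs V] by (simp add: lead_at_def)
  from lead_at_mult[OF this la] show ?thesis
    unfolding eq inv_w[OF w'] by simp
qed

text \<open>One minor of the conjugate is read in two ways: by comparison with the minor of Z, and
  through the elimination for y', which sees the strictly lower part only. The induction supplies
  non-vanishing for y' in the earlier columns.\<close>

theorem lead_conj_by:
  fixes Z :: "nat \<Rightarrow> nat \<Rightarrow> 'f::field"
  assumes h: "1 \<le> h" and M: "left_down n M"
    and v: "unitri n v" and w: "unitri n w"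
    and vw: "\<And>i j. i \<in> {1..n} \<Longrightarrow> j \<in> {1..n} \<Longrightarrow> (\<Sum>k\<in>{1..n}. v i k * w k j) = (if i = j then 1 else 0)"
    and y: "lower_part n M Z y" and y': "lower_part n M (conj_by n v Z w) y'"
  shows "t \<le> n \<Longrightarrow> snd (lead n M h y t) \<noteq> 0 \<Longrightarrow> snd (lead n M h y' t) = snd (lead n M h y t)"
proof (induction t)
  case (Suc t)
  obtain rs cs d where p: "proc n M h (Suc t) = (rs, cs, d)" by (cases "proc n M h (Suc t)")
  have "snd (lead n M h y t) \<noteq> 0"
    using lead_Suc_nonzero[OF Suc.prems(2)] .
  then have "snd (lead n M h y' t) \<noteq> 0"
    using Suc by simp
  from lead_at_lminor[OF h M y' Suc.prems(1) this p]
  have "lead_at (lminor (charmat (conj_by n v Z w)) rs cs) d (snd (lead n M h y' (Suc t)))" .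
  moreover have "lead_at (lminor (charmat (conj_by n v Z w)) rs cs) d (snd (lead n M h y (Suc t)))"
    by (rule lead_at_conj_by[OF pivot_inv_lead[OF h M y Suc.prems] h Suc.prems(1) v w vw p])
  ultimately show ?case
    by (simp add: lead_at_def)
qed simp

section \<open>Reading off the index sets of the minors\<close>

text \<open>Unlike \<open>diagram_step\<close>, which searches for an empty place, this visits each
  place once and passes over the filled ones, so its fold runs in parallel with that of
  \<open>swapstep\<close>. The two constructions agree because filled places never change.\<close>

definition dstep :: "place \<Rightarrow> diagram \<Rightarrow> diagram" where
  "dstep \<eta> D = (if D \<eta> = None then fill \<eta> D else D)"

lemma fill_keeps: "D \<eta> \<noteq> None \<Longrightarrow> D \<xi> = None \<Longrightarrow> fill \<xi> D \<eta> = D \<eta>"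
  by (cases \<xi>; cases \<eta>) (auto simp: fill_def)

lemma dstep_keeps: "D \<eta> \<noteq> None \<Longrightarrow> dstep \<xi> D \<eta> = D \<eta>"
  by (simp add: dstep_def fill_keeps)

lemma fold_dstep_keeps: "D \<eta> \<noteq> None \<Longrightarrow> fold dstep xs D \<eta> = D \<eta>"
  by (induction xs arbitrary: D) (auto simp: dstep_keeps)

lemma dstep_self: "dstep \<eta> D \<eta> \<noteq> None"
  by (cases \<eta>) (simp add: dstep_def fill_def)

lemma fold_dstep_steps:
  assumes "\<forall>\<eta>\<in>set xs. D \<eta> \<noteq> None" "places n = xs @ ys"
  shows "\<exists>m\<le>length ys. fold dstep ys D = (diagram_step n ^^ m) D \<and> (\<forall>\<eta>\<in>Delta n. fold dstep ys D \<eta> \<noteq> None)"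
  using assms
proof (induction ys arbitrary: xs D)
  case Nil
  then show ?case using set_places[of n] by auto
next
  case (Cons y ys)
  have "\<forall>\<eta>\<in>set (xs @ [y]). dstep y D \<eta> \<noteq> None"
    using Cons.prems(1) dstep_keeps[of D _ y] dstep_self[of y D] by auto
  from Cons.IH[OF this] Cons.prems(2) obtain m where m: "m \<le> length ys"
    "fold dstep ys (dstep y D) = (diagram_step n ^^ m) (dstep y D)" "\<forall>\<eta>\<in>Delta n. fold dstep ys (dstep y D) \<eta> \<noteq> None"
    by auto
  show ?case
  proof (cases "D y = None")
    case True
    have "find (\<lambda>\<eta>. D \<eta> = None) (xs @ y # ys) = Some y"
      using Cons.prems(1) True by (induction xs) auto
    then have "dstep y D = diagram_step n D"
      using True Cons.prems(2) by (simp add: dstep_def diagram_step_def)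
    then have "fold dstep (y # ys) D = (diagram_step n ^^ Suc m) D"
      using m(2) by (simp add: funpow_swap1)
    then show ?thesis using m by (intro exI[of _ "Suc m"]) auto
  next
    case False
    then have "dstep y D = D" by (auto simp: dstep_def)
    then show ?thesis using m by (intro exI[of _ m]) simp
  qed
qed

lemma distinct_places: "distinct (places n)"
  unfolding distinct_conv_nth
proof (intro allI impI)
  fix i j assume ij: "i < length (places n)" "j < length (places n)" "i \<noteq> j"
  have irr: "\<not> \<eta> \<succ> \<eta>" for \<eta> by (simp add: place_gt_def)
  have "places n ! i \<succ> places n ! j \<or> places n ! j \<succ> places n ! i"
    using sorted_wrt_nth_less[OF sorted_places[of n]] ij by (meson linorder_neqE_nat)
  then show "places n ! i \<noteq> places n ! j" using irr by metis
qed

text \<open>The single pass uses at most \<open>card (Delta n)\<close> proper steps, and the surplus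
  iterations in \<open>diagram\<close> do nothing on a full diagram.\<close>

lemma diagram_fold: "diagram n M = fold dstep (places n) (diagram_init M)"
proof -
  obtain m where m: "m \<le> length (places n)" "fold dstep (places n) (diagram_init M) = (diagram_step n ^^ m) (diagram_init M)"
    "\<forall>\<eta>\<in>Delta n. fold dstep (places n) (diagram_init M) \<eta> \<noteq> None"
    using fold_dstep_steps[of "[]" "diagram_init M" n "places n"] by auto
  let ?D = "fold dstep (places n) (diagram_init M)"
  have "find (\<lambda>\<eta>. ?D \<eta> = None) (places n) = None"
    using m(3) by (simp add: find_None_iff set_places)
  then have fix1: "diagram_step n ?D = ?D" by (simp add: diagram_step_def)
  have fix2: "(diagram_step n ^^ j) ?D = ?D" for j
    by (induction j) (auto simp: fix1)
  have "length (places n) = card (Delta n)"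
    using distinct_card[OF distinct_places] by (simp add: set_places)
  then have "card (Delta n) = (card (Delta n) - m) + m" using m(1) by simp
  then have "diagram n M = (diagram_step n ^^ (card (Delta n) - m)) ((diagram_step n ^^ m) (diagram_init M))"
    unfolding diagram_def by (metis funpow_add comp_apply)
  then show ?thesis using m(2) fix2 by simp
qed

definition dbefore :: "nat \<Rightarrow> place set \<Rightarrow> nat \<Rightarrow> nat \<Rightarrow> diagram" where
  "dbefore n M k t = fold dstep (col_places n (t - 1) @ upto_place n k t) (diagram_init M)"

lemma dbefore_pred: "1 \<le> k \<Longrightarrow> k \<le> n \<Longrightarrow> dbefore n M (k - 1) t = dstep (k, t) (dbefore n M k t)"
  unfolding dbefore_def by (subst upto_place_pred) auto

lemma dbefore_next: "dbefore n M n (Suc (Suc t)) = dbefore n M (Suc t) (Suc t)"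
  by (simp add: dbefore_def col_places_Suc)

definition empties :: "nat \<Rightarrow> place set \<Rightarrow> nat \<Rightarrow> nat \<Rightarrow> (nat \<Rightarrow> nat) \<Rightarrow> diagram \<Rightarrow> bool" where
  "empties n M t k \<sigma> D \<longleftrightarrow> (\<forall>i j. (i, j) \<in> Delta n \<longrightarrow> t < j \<or> (t = j \<and> i \<le> k) \<longrightarrow>
     (D (i, j) = None \<longleftrightarrow> (i, j) \<notin> M \<and> \<sigma> j < \<sigma> i) \<and> D (i, j) \<noteq> Some Otimes)"

text \<open>For t < j < k the places (k, j) and (j, t) are both empty iff \<sigma> j lies between
  \<sigma> t and \<sigma> k, which is exactly when exchanging these two values reverses both
  comparisons. A place (i, k) keeps its status because \<sigma> i does not lie between them: it is
  below both, or row i belongs to M in column t and still holds i.\<close>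

lemma empties_step:
  assumes e: "empties n M t k \<sigma> D" and g: "swaps_good n M t k \<sigma>" and M: "left_down n M" and kt: "t < k" "k \<le> n" "1 \<le> t"
  shows "empties n M t (k - 1) (swapstep M (k, t) \<sigma>) (dstep (k, t) D)"
proof (cases "(k, t) \<notin> M \<and> \<sigma> t < \<sigma> k")
  case False
  have "D (k, t) = None \<longleftrightarrow> (k, t) \<notin> M \<and> \<sigma> t < \<sigma> k"
    using e kt by (auto simp: empties_def Delta_def)
  then have "swapstep M (k, t) \<sigma> = \<sigma>" "dstep (k, t) D = D"
    using False by (auto simp: swapstep_def dstep_def)
  then show ?thesis using e unfolding empties_def by auto
next
  case True
  have ktD: "(k, t) \<in> Delta n" using kt by (auto simp: Delta_def)
  have eD: "D (i, j) = None \<longleftrightarrow> (i, j) \<notin> M \<and> \<sigma> j < \<sigma> i" "D (i, j) \<noteq> Some Otimes"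
    if "(i, j) \<in> Delta n" "t < j \<or> (t = j \<and> i \<le> k)" for i j
    using e that by (auto simp: empties_def)
  have p: "\<sigma> permutes {1..n}" using g by (simp add: swaps_good_def)
  have neq: "\<sigma> i \<noteq> \<sigma> j" if "i \<noteq> j" for i j
    using permutes_inj[OF p] that by (auto dest: injD)
  let ?s = "\<sigma> \<circ> Transposition.transpose k t"
  have v: "?s k = \<sigma> t" "?s t = \<sigma> k" "\<And>i. i \<noteq> k \<Longrightarrow> i \<noteq> t \<Longrightarrow> ?s i = \<sigma> i"
    by simp_all
  have eqs: "swapstep M (k, t) \<sigma> = ?s" "dstep (k, t) D = fill (k, t) D"
    using True eD(1)[OF ktD] by (auto simp: swapstep_def dstep_def)
  have notM: "(k, j) \<notin> M" "(j, t) \<notin> M" if "t < j" "j < k" for j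
    using left_downD[OF M, of k j k t] left_downD[OF M, of j t k t] that True kt by auto
  have "(fill (k, t) D (i, j) = None \<longleftrightarrow> (i, j) \<notin> M \<and> ?s j < ?s i) \<and> fill (k, t) D (i, j) \<noteq> Some Otimes"
    if ij: "(i, j) \<in> Delta n" and pos: "t < j \<or> (t = j \<and> i \<le> k - 1)" for i j
  proof -
    have b: "i \<le> n" "j < i" "1 \<le> j" using ij by (auto simp: Delta_def)
    have D: "D (i, j) = None \<longleftrightarrow> (i, j) \<notin> M \<and> \<sigma> j < \<sigma> i" "D (i, j) \<noteq> Some Otimes"
    proof -
      have "t < j \<or> t = j \<and> i \<le> k" using pos by auto
      then show "D (i, j) = None \<longleftrightarrow> (i, j) \<notin> M \<and> \<sigma> j < \<sigma> i" "D (i, j) \<noteq> Some Otimes"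
        using eD[OF ij] by simp_all
    qed
    consider "j = t" "i < k" | "i = k" "t < j" | "j = k" "k < i" | "j \<noteq> t" "i \<noteq> k" "j \<noteq> k" "t < j"
      using pos b kt by fastforce
    then show ?thesis
    proof cases
      case 1
      have "D (k, i) = None \<longleftrightarrow> \<sigma> i < \<sigma> k"
        using eD(1)[of k i] 1 b kt notM[of i] by (auto simp: Delta_def)
      then show ?thesis
        using 1 D True v neq[of i k] b notM[of i] by (auto simp: fill_def simp del: o_apply)
    next
      case 2
      have "D (j, t) = None \<longleftrightarrow> \<sigma> t < \<sigma> j"
        using eD(1)[of j t] 2 b kt notM[of j] by (auto simp: Delta_def)
      then show ?thesis
        using 2 D True v neq[of j t] b notM[of j] by (auto simp: fill_def simp del: o_apply)
    next
      case 3
      have "fill (k, t) D (i, j) = D (i, j)"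
        using 3 b kt by (auto simp: fill_def)
      moreover have "\<sigma> k < \<sigma> i \<longleftrightarrow> \<sigma> t < \<sigma> i" if "(i, k) \<notin> M"
      proof (cases "(i, t) \<in> M")
        case True
        then have i: "\<sigma> i = i" using g b 3 kt by (auto simp: swaps_good_def)
        have "\<sigma> k = k \<or> \<sigma> k \<le> t" using g kt by (auto simp: swaps_good_def)
        then show ?thesis using i 3 kt \<open>(k, t) \<notin> M \<and> \<sigma> t < \<sigma> k\<close> by auto
      next
        case False
        then have "\<sigma> i < \<sigma> t" using g b 3 by (auto simp: swaps_good_def)
        then show ?thesis using True by auto
      qed
      ultimately show ?thesis using 3 D v b kt by (auto simp del: o_apply)
    next
      case 4
      have "fill (k, t) D (i, j) = D (i, j)"
        using 4 by (auto simp: fill_def)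
      moreover have "i \<noteq> t" using 4 b by auto
      ultimately show ?thesis using 4 D v by (auto simp del: o_apply)
    qed
  qed
  then show ?thesis unfolding empties_def eqs by blast
qed

lemma empties_before:
  assumes M: "left_down n M"
  shows "1 \<le> t \<Longrightarrow> t \<le> k \<Longrightarrow> k \<le> n \<Longrightarrow> empties n M t k (swaps_before n M k t) (dbefore n M k t)"
proof (induction t arbitrary: k)
  case (Suc t)
  have base: "empties n M (Suc t) n (swaps_before n M n (Suc t)) (dbefore n M n (Suc t))"
  proof (cases "t = 0")
    case True
    then show ?thesis
      by (auto simp: swaps_before_n empties_def dbefore_def diagram_init_def Delta_def)
  next
    case False
    then have "empties n M t t (swaps_before n M t t) (dbefore n M t t)"
      using Suc by simp
    moreover have "swaps_before n M t t = swaps_before n M n (Suc t)"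
      using swaps_before_diag[of n M "t - 1"] False by (simp add: swaps_before_n)
    moreover have "dbefore n M t t = dbefore n M n (Suc t)"
      using dbefore_next[of n M "t - 1"] False by simp
    ultimately show ?thesis
      unfolding empties_def by auto
  qed
  show ?case
    using Suc.prems(3,2)
  proof (induction k rule: inc_induct)
    case (step k)
    have "empties n M (Suc t) (Suc k - 1) (swapstep M (Suc k, Suc t) (swaps_before n M (Suc k) (Suc t)))
       (dstep (Suc k, Suc t) (dbefore n M (Suc k) (Suc t)))"
      using step by (intro empties_step[OF _ swaps_good_before[OF M] M]) auto
    then show ?case
      using swaps_before_pred[of "Suc k" n M "Suc t"] dbefore_pred[of "Suc k" n M "Suc t"] step by simp
  qed (rule base)
qed simp

lemma S_set_iff:
  assumes M: "left_down n M" and D: "(k, t) \<in> Delta n"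
  shows "(k, t) \<in> S_set n M \<longleftrightarrow> (k, t) \<notin> M \<and> swaps_before n M k t t < swaps_before n M k t k"
proof -
  have kt: "1 \<le> t" "t < k" "k \<le> n" using D by (auto simp: Delta_def)
  obtain ys where ys: "places n = col_places n (t - 1) @ upto_place n k t @ (k, t) # ys"
    using places_split[OF D] .
  let ?D = "dbefore n M k t"
  have e: "?D (k, t) = None \<longleftrightarrow> (k, t) \<notin> M \<and> swaps_before n M k t t < swaps_before n M k t k" "?D (k, t) \<noteq> Some Otimes"
    using empties_before[OF M, of t k] kt D by (auto simp: empties_def)
  have "diagram n M (k, t) = fold dstep ys (dstep (k, t) ?D) (k, t)"
    by (simp add: diagram_fold ys dbefore_def)
  also have "\<dots> = dstep (k, t) ?D (k, t)"
    by (rule fold_dstep_keeps[OF dstep_self])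
  finally have "diagram n M (k, t) = Some Otimes \<longleftrightarrow> ?D (k, t) = None"
    using e(2) by (auto simp: dstep_def fill_def)
  then show ?thesis
    using D e(1) by (simp add: S_set_def S_list_def set_places)
qed

section \<open>The permutations of the places of S and the index sets\<close>

lemma foldr_transpose_comp:
  "foldr (\<lambda>(i, j) f. Transposition.transpose i j \<circ> f) xs g = foldr (\<lambda>(i, j) f. Transposition.transpose i j \<circ> f) xs id \<circ> g"
proof (induction xs)
  case (Cons x xs)
  show ?case
    unfolding foldr_Cons o_apply[of _ _ g] o_apply[of _ _ id] Cons.IH by (cases x) (simp add: comp_assoc)
qed simp

lemma prefix_before:
  assumes "places n = xs @ (k, t) # ys"
  shows "xs = col_places n (t - 1) @ upto_place n k t"
proof -
  have "(k, t) \<in> Delta n" using assms set_places[of n] by auto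
  then obtain zs where zs: "places n = (col_places n (t - 1) @ upto_place n k t) @ (k, t) # zs"
    using places_split by (metis append.assoc)
  have "(k, t) \<notin> set xs" "(k, t) \<notin> set ys"
    using distinct_places[of n] unfolding assms by auto
  then show ?thesis
    using append_Cons_eq_iff[of "(k, t)" xs ys "col_places n (t - 1) @ upto_place n k t" zs] zs unfolding assms by blast
qed

lemma foldr_S_eq:
  assumes M: "left_down n M"
  shows "places n = zs @ ys \<Longrightarrow>
    foldr (\<lambda>(i, j) f. Transposition.transpose i j \<circ> f) (filter (\<lambda>\<eta>. \<eta> \<in> S_set n M) zs) id = fold (swapstep M) zs id"
proof (induction zs arbitrary: ys rule: rev_induct)
  case (snoc \<eta> zs)
  obtain k t where \<eta>: "\<eta> = (k, t)" by (cases \<eta>)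
  have pl: "places n = zs @ (k, t) # ys" using snoc.prems \<eta> by simp
  then have D: "(k, t) \<in> Delta n" using set_places[of n] by auto
  have IH: "foldr (\<lambda>(i, j) f. Transposition.transpose i j \<circ> f) (filter (\<lambda>\<eta>. \<eta> \<in> S_set n M) zs) id = fold (swapstep M) zs id"
    using snoc.IH[OF pl] .
  have b: "fold (swapstep M) zs id = swaps_before n M k t"
    using prefix_before[OF pl] by (simp add: swaps_before_def)
  have f: "fold (swapstep M) (zs @ [\<eta>]) id = swapstep M (k, t) (swaps_before n M k t)"
    unfolding b[symmetric] \<eta> by simp
  show ?case
  proof (cases "(k, t) \<in> S_set n M")
    case True
    then have "filter (\<lambda>\<eta>. \<eta> \<in> S_set n M) (zs @ [\<eta>]) = filter (\<lambda>\<eta>. \<eta> \<in> S_set n M) zs @ [(k, t)]"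
      by (simp add: \<eta>)
    then have "foldr (\<lambda>(i, j) f. Transposition.transpose i j \<circ> f) (filter (\<lambda>\<eta>. \<eta> \<in> S_set n M) (zs @ [\<eta>])) id
        = foldr (\<lambda>(i, j) f. Transposition.transpose i j \<circ> f) (filter (\<lambda>\<eta>. \<eta> \<in> S_set n M) zs) (Transposition.transpose k t)"
      by simp
    also have "\<dots> = swaps_before n M k t \<circ> Transposition.transpose k t"
      unfolding IH[unfolded b, symmetric] by (rule foldr_transpose_comp)
    also have "\<dots> = swapstep M (k, t) (swaps_before n M k t)"
      using True S_set_iff[OF M D] by (simp add: swapstep_def)
    finally show ?thesis unfolding f .
  next
    case False
    then have "filter (\<lambda>\<eta>. \<eta> \<in> S_set n M) (zs @ [\<eta>]) = filter (\<lambda>\<eta>. \<eta> \<in> S_set n M) zs"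
      by (simp add: \<eta>)
    moreover have "swapstep M (k, t) (swaps_before n M k t) = swaps_before n M k t"
      using False S_set_iff[OF M D] by (auto simp: swapstep_def)
    ultimately show ?thesis
      using IH unfolding f b by (simp only:)
  qed
qed simp

text \<open>\<open>w_xi\<close> includes the transposition of its own place, so it is the state
  after (k, t), that is, before (k - 1, t).\<close>

lemma w_xi_before:
  assumes M: "left_down n M" and S: "(k, t) \<in> S_set n M"
  shows "w_xi n M (k, t) = swaps_before n M (k - 1) t"
proof -
  have D: "(k, t) \<in> Delta n"
    using S by (auto simp: S_set_def S_list_def set_places)
  then have kt: "1 \<le> k" "k \<le> n" by (auto simp: Delta_def)
  define xs where "xs = col_places n (t - 1) @ upto_place n k t"
  obtain ys where ys: "places n = xs @ (k, t) # ys"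
    using places_split[OF D] unfolding xs_def by (metis append.assoc)
  let ?Q = "\<lambda>\<eta>. diagram n M \<eta> = Some Otimes"
  have Q: "?Q \<eta> \<longleftrightarrow> \<eta> \<in> S_set n M" if "\<eta> \<in> set (places n)" for \<eta>
    using that by (simp add: S_set_def S_list_def)
  have srt: "sorted_wrt (\<succ>) (xs @ (k, t) # ys)"
    using sorted_places[of n] ys by simp
  have gt: "\<eta> \<succ> (k, t)" if "\<eta> \<in> set xs" for \<eta>
    using srt that by (simp add: sorted_wrt_append)
  have lt: "\<not> (\<eta> \<succ> (k, t) \<or> \<eta> = (k, t))" if "\<eta> \<in> set ys" for \<eta>
  proof -
    have "(k, t) \<succ> \<eta>" using srt that by (simp add: sorted_wrt_append)
    then show ?thesis by (cases \<eta>) (auto simp: place_gt_def)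
  qed
  have "filter (\<lambda>\<eta>. \<eta> \<succ> (k, t) \<or> \<eta> = (k, t)) (S_list n M)
     = filter (\<lambda>\<eta>. (\<eta> \<succ> (k, t) \<or> \<eta> = (k, t)) \<and> ?Q \<eta>) ((xs @ [(k, t)]) @ ys)"
    by (simp add: S_list_def ys conj_commute)
  also have "\<dots> = filter (\<lambda>\<eta>. (\<eta> \<succ> (k, t) \<or> \<eta> = (k, t)) \<and> ?Q \<eta>) (xs @ [(k, t)]) @ filter (\<lambda>_. False) ys"
    unfolding filter_append by (intro arg_cong2[where f = "(@)"] filter_cong refl) (use lt in blast)
  also have "\<dots> = filter (\<lambda>\<eta>. \<eta> \<in> S_set n M) (xs @ [(k, t)])"
  proof -
    have "filter (\<lambda>\<eta>. (\<eta> \<succ> (k, t) \<or> \<eta> = (k, t)) \<and> ?Q \<eta>) (xs @ [(k, t)]) = filter (\<lambda>\<eta>. \<eta> \<in> S_set n M) (xs @ [(k, t)])"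
    proof (rule filter_cong[OF refl])
      fix \<eta> assume "\<eta> \<in> set (xs @ [(k, t)])"
      then have "\<eta> \<in> set (places n)" "\<eta> \<succ> (k, t) \<or> \<eta> = (k, t)"
        using gt[of \<eta>] unfolding ys by auto
      then show "((\<eta> \<succ> (k, t) \<or> \<eta> = (k, t)) \<and> ?Q \<eta>) = (\<eta> \<in> S_set n M)"
        using Q by simp
    qed
    then show ?thesis by simp
  qed
  finally have "w_xi n M (k, t) = fold (swapstep M) (xs @ [(k, t)]) id"
    unfolding w_xi_def using foldr_S_eq[OF M, of "xs @ [(k, t)]" ys] ys by simp
  also have "\<dots> = swaps_before n M (k - 1) t"
    unfolding swaps_before_def xs_def using upto_place_pred[OF kt] by simp
  finally show ?thesis .
qed

lemma chips_sgm:
  assumes "1 \<le> t" "t \<le> n"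
  shows "chips (sgm n M t) h = (if t \<in> chips (sgm n M (t - 1)) h \<and> landing n M h t \<noteq> {}
    then insert (Max (landing n M h t)) (chips (sgm n M (t - 1)) h - {t}) else chips (sgm n M (t - 1)) h)"
proof -
  have "(\<exists>i\<in>landing n M h t. t < i) \<longleftrightarrow> landing n M h t \<noteq> {}"
    by (auto simp: landing_def)
  then show ?thesis
    using chips_before[OF assms(1) refl assms(2) order_refl, of M h] swaps_before_diag[of n M "t - 1"] assms(1) by simp
qed

text \<open>When the maximal row is scanned, t still carries a chip and that row does not, which
  forces a swap.\<close>

lemma landing_in_S:
  assumes M: "left_down n M" and t: "1 \<le> t" "t \<le> n" and C: "t \<in> chips (sgm n M (t - 1)) h" and ne: "landing n M h t \<noteq> {}"
  shows "(Max (landing n M h t), t) \<in> S_set n M"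
proof -
  let ?k = "Max (landing n M h t)"
  have k: "?k \<in> landing n M h t" using ne by (intro Max_in) auto
  then have kt: "t < ?k" "?k \<le> n" "(?k, t) \<notin> M" "?k \<notin> chips (sgm n M (t - 1)) h"
    by (auto simp: landing_def chips_def)
  have "\<not> (\<exists>i\<in>landing n M h t. ?k < i)"
    using Max_ge[OF finite_landing] by (meson not_le)
  then have "chips (swaps_before n M ?k t) h = chips (sgm n M (t - 1)) h"
    using chips_before[OF t(1) refl kt(2), of M h] kt(1) by simp
  then have "t \<in> chips (swaps_before n M ?k t) h" "?k \<notin> chips (swaps_before n M ?k t) h"
    using C kt by simp_all
  then have "swaps_before n M ?k t t < swaps_before n M ?k t ?k"
    by (simp add: chips_def)
  then show ?thesis
    using S_set_iff[OF M] kt t by (auto simp: Delta_def)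
qed

lemma cand_landing:
  assumes M: "left_down n M" and t: "Suc t \<le> n" and rs: "set rs = {i\<in>{h..n}. i \<le> t \<or> i \<in> chips (sgm n M t) h}"
  shows "cand n M h (Suc t) rs = landing n M h (Suc t)"
proof -
  have "h \<le> b" if "Suc t < b" "b \<le> n" "h \<le> sgm n M t b" for b
    using sgm_above[OF M, of t b] that by auto
  then show ?thesis
    by (auto simp: cand_def landing_def rs chips_def)
qed

text \<open>Elimination and chips obey the same rule: the diagonal row is available iff it carries
  no chip, and otherwise the pivot is taken in the row where the chip lands. So the pivot rows are
  the window rows passed so far together with those holding a chip, and the pivot columns are the
  ones left without a chip.\<close>

lemma proc_sgm:
  assumes M: "left_down n M" and h: "1 \<le> h"
  shows "t \<le> n \<Longrightarrow> proc n M h t = (rs, cs, d) \<Longrightarrow>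
    set rs = {i\<in>{h..n}. i \<le> t \<or> i \<in> chips (sgm n M t) h} \<and> set cs = {j\<in>{1..t}. j \<notin> chips (sgm n M t) h}"
proof (induction t arbitrary: rs cs d)
  case 0
  then show ?case using h by (auto simp: chips_def)
next
  case (Suc t)
  obtain rs' cs' d' where p: "proc n M h t = (rs', cs', d')" by (cases "proc n M h t")
  let ?C = "chips (sgm n M t) h" and ?K = "landing n M h (Suc t)"
  have rs': "set rs' = {i\<in>{h..n}. i \<le> t \<or> i \<in> ?C}" and cs': "set cs' = {j\<in>{1..t}. j \<notin> ?C}"
    using Suc.IH[OF _ p] Suc.prems by auto
  have cand: "cand n M h (Suc t) rs' = ?K"
    by (rule cand_landing[OF M Suc.prems(1) rs'])
  have C: "h \<le> Suc t \<and> Suc t \<notin> set rs' \<longleftrightarrow> Suc t \<notin> ?C"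
    using sgm_above[OF M, of t "Suc t"] Suc.prems(1) unfolding rs' by (auto simp: chips_def)
  have cs: "chips (sgm n M (Suc t)) h = (if Suc t \<in> ?C \<and> ?K \<noteq> {} then insert (Max ?K) (?C - {Suc t}) else ?C)"
    using chips_sgm[of "Suc t" n M h] Suc.prems(1) by simp
  have pr: "proc n M h (Suc t) = (if Suc t \<notin> ?C then (rs' @ [Suc t], cs' @ [Suc t], d')
     else if ?K = {} then (rs', cs', d') else (rs' @ [Max ?K], cs' @ [Suc t], Suc d'))"
    unfolding proc.simps p prod.case C cand ..
  have split: "j \<le> Suc t \<longleftrightarrow> j \<le> t \<or> j = Suc t" for j by auto
  consider "Suc t \<notin> ?C" | "Suc t \<in> ?C" "?K = {}" | "Suc t \<in> ?C" "?K \<noteq> {}" by blast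
  then show ?case
  proof cases
    case 1
    then have e: "rs = rs' @ [Suc t]" "cs = cs' @ [Suc t]" "chips (sgm n M (Suc t)) h = ?C"
      using Suc.prems(2) unfolding pr cs by simp_all
    have "h \<le> Suc t" using 1 C by simp
    then show ?thesis
      using 1 Suc.prems(1) unfolding e(1,2) e(3) set_append rs' cs' by (auto simp: split)
  next
    case 2
    then have e: "rs = rs'" "cs = cs'" "chips (sgm n M (Suc t)) h = ?C"
      using Suc.prems(2) 2 unfolding pr cs by simp_all
    show ?thesis
      using 2 Suc.prems(1) unfolding e(1,2) e(3) rs' cs' by (auto simp: split)
  next
    case 3
    have e: "rs = rs' @ [Max ?K]" "cs = cs' @ [Suc t]" "chips (sgm n M (Suc t)) h = insert (Max ?K) (?C - {Suc t})"
      using Suc.prems(2) 3 unfolding pr cs by simp_all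
    have "Max ?K \<in> ?K" using Max_in[OF finite_landing 3(2)] .
    then have "Suc t < Max ?K \<and> Max ?K \<le> n \<and> Max ?K \<notin> ?C"
      by (simp add: landing_def chips_def not_less)
    moreover have "Max ?K \<in> cand n M h (Suc t) rs'" using \<open>Max ?K \<in> ?K\<close> cand by simp
    then have "h \<le> Max ?K" by (simp add: cand_def)
    ultimately have K: "Suc t < Max ?K" "Max ?K \<le> n" "Max ?K \<notin> ?C" "h \<le> Max ?K"
      by simp_all
    show ?thesis
      using 3(1) Suc.prems(1) K unfolding e(1,2) e(3) set_append rs' cs' by (auto simp: split)
  qed
qed

text \<open>h is the value that the swap at (k, t) brings to t. With this threshold t carries a chip
  before the swap, k does not, and k is where the chip lands. For h \<le> t the definition of
  \<open>I_xi\<close> describes the pivot rows directly; for h > t it lists the values moved to the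
  columns of \<open>J_xi\<close>, and a row v \<ge> h holds a chip iff its own value v has been
  moved to such a column. The last clause keeps those places of S in column t that are scanned after
  (k, t) out of the minor.\<close>

lemma xi_facts:
  assumes M: "left_down n M" and MD: "M \<subseteq> Delta n" and S: "(k, t) \<in> S_set n M"
    and h: "h = w_xi n M (k, t) t"
  shows "1 \<le> h" "h \<le> n" "t \<in> chips (sgm n M (t - 1)) h" "landing n M h t \<noteq> {}" "Max (landing n M h t) = k"
    and "I_xi n M (k, t) = {i\<in>{h..n}. i \<le> t \<or> i \<in> chips (sgm n M t) h}"
    and "J_xi n M (k, t) = {j\<in>{1..t}. j \<notin> chips (sgm n M t) h}"
    and "\<And>a. t < a \<Longrightarrow> a < k \<Longrightarrow> a \<in> chips (sgm n M t) h \<Longrightarrow> (a, t) \<notin> S_set n M"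
proof -
  have D: "(k, t) \<in> Delta n"
    using S by (auto simp: S_set_def S_list_def set_places)
  then have kt: "1 \<le> t" "t < k" "k \<le> n" by (auto simp: Delta_def)
  let ?b = "swaps_before n M k t" and ?C = "chips (sgm n M (t - 1)) h" and ?K = "landing n M h t"
  have lt: "?b t < ?b k" and nM: "(k, t) \<notin> M"
    using S_set_iff[OF M D] S by auto
  have pm: "?b permutes {1..n}"
    using swaps_good_before[OF M kt(1) _ kt(3)] kt by (simp add: swaps_good_def)
  have w: "w_xi n M (k, t) = ?b \<circ> Transposition.transpose k t"
    using w_xi_before[OF M S] swaps_before_pred[of k n M t] kt lt nM by (simp add: swapstep_def)
  have hb: "h = ?b k" using h w by simp
  show "1 \<le> h" "h \<le> n"
    using permutes_in_image[OF pm, of k] kt hb by auto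
  have tb: "t \<in> chips ?b h" and kb: "k \<notin> chips ?b h"
    using lt hb by (auto simp: chips_def)
  have cb: "chips ?b h = (if t \<in> ?C \<and> (\<exists>i\<in>?K. k < i) then insert (Max ?K) (?C - {t}) else ?C)"
    using chips_before[OF kt(1) refl kt(3)] kt by simp
  \<comment> \<open>Had the chip landed in an earlier row, t would carry none when (k, t) is
    scanned.\<close>
  have no: "\<not> (t \<in> ?C \<and> (\<exists>i\<in>?K. k < i))"
  proof
    assume a: "t \<in> ?C \<and> (\<exists>i\<in>?K. k < i)"
    then have "Max ?K \<in> ?K" by (intro Max_in) auto
    then have "Max ?K \<noteq> t" by (auto simp: landing_def)
    then show False using tb a cb by auto
  qed
  then have cC: "chips ?b h = ?C" unfolding cb by (rule if_not_P)
  then show tC: "t \<in> ?C" using tb by simp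
  have kK: "k \<in> ?K"
  proof -
    have "k \<notin> ?C" using kb cC by simp
    then have "h \<le> sgm n M (t - 1) k" unfolding chips_def mem_Collect_eq not_less .
    then show ?thesis using kt nM by (simp add: landing_def)
  qed
  then show K: "?K \<noteq> {}" by auto
  show Mx: "Max ?K = k"
  proof (rule Max_eqI)
    fix i assume "i \<in> ?K" then show "i \<le> k" using no tC by (meson not_le)
  qed (use kK in auto)
  have cs: "chips (sgm n M t) h = insert k (?C - {t})"
  proof -
    have "chips (sgm n M t) h = (if t \<in> ?C \<and> ?K \<noteq> {} then insert (Max ?K) (?C - {t}) else ?C)"
      by (rule chips_sgm) (use kt in simp_all)
    then show ?thesis unfolding Mx using tC K by simp
  qed
  have ca: "chips (swaps_before n M a t) h = chips (sgm n M t) h" if "t \<le> a" "a < k" for a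
  proof -
    have "chips (swaps_before n M a t) h = (if t \<in> ?C \<and> (\<exists>i\<in>?K. a < i) then insert (Max ?K) (?C - {t}) else ?C)"
      by (rule chips_before[OF kt(1) refl]) (use that kt in simp_all)
    moreover have "\<exists>i\<in>?K. a < i" using kK that by blast
    ultimately show ?thesis unfolding Mx cs using tC by simp
  qed
  have w': "w_xi n M (k, t) = swaps_before n M (k - 1) t"
    by (rule w_xi_before[OF M S])
  have cw: "chips (w_xi n M (k, t)) h = chips (sgm n M t) h"
    unfolding w' by (rule ca) (use kt in simp_all)
  show J: "J_xi n M (k, t) = {j\<in>{1..t}. j \<notin> chips (sgm n M t) h}"
    unfolding J_xi_def Let_def snd_conv h[symmetric] cw[symmetric] by (auto simp: chips_def)
  show "(a, t) \<notin> S_set n M" if "t < a" "a < k" "a \<in> chips (sgm n M t) h" for a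
  proof -
    have "a \<in> chips (swaps_before n M a t) h" "t \<notin> chips (swaps_before n M a t) h"
      using that cs kt unfolding ca[OF less_imp_le[OF that(1)] that(2)] by simp_all
    then have "\<not> swaps_before n M a t t < swaps_before n M a t a"
      unfolding chips_def by simp
    moreover have D: "(a, t) \<in> Delta n" using that kt by (simp add: Delta_def)
    ultimately show ?thesis
      unfolding S_set_iff[OF M D] by simp
  qed
  show "I_xi n M (k, t) = {i\<in>{h..n}. i \<le> t \<or> i \<in> chips (sgm n M t) h}"
  proof (cases "h > t")
    case False
    have "I_xi n M (k, t) = {h..t} \<union> {i. t < i \<and> i \<le> n \<and> i \<in> chips (w_xi n M (k, t)) h}"
      using False unfolding I_xi_def Let_def snd_conv h[symmetric] chips_def mem_Collect_eq by simp
    moreover have "{h..t} \<union> {i. t < i \<and> i \<le> n \<and> i \<in> A} = {i\<in>{h..n}. i \<le> t \<or> i \<in> A}" for A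
    proof (rule Set.set_eqI)
      fix i
      have "h \<le> t" "t \<le> n" using False kt(2,3) by linarith+
      then show "i \<in> {h..t} \<union> {i. t < i \<and> i \<le> n \<and> i \<in> A} \<longleftrightarrow> i \<in> {i\<in>{h..n}. i \<le> t \<or> i \<in> A}"
        by (cases "i \<le> t") auto
    qed
    ultimately show ?thesis unfolding cw by (simp only:)
  next
    case True
    let ?s = "sgm n M t"
    have ps: "?s permutes {1..n}" using sgm_permutes[OF M] kt by simp
    have "I_xi n M (k, t) = w_L n M ` J_xi n M (k, t)"
      using True unfolding I_xi_def Let_def snd_conv h[symmetric] by simp
    also have "\<dots> = ?s ` J_xi n M (k, t)"
    proof (rule image_cong[OF refl])
      fix j assume "j \<in> J_xi n M (k, t)"
      then have j: "1 \<le> j" "j \<le> t" unfolding J by auto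
      then show "w_L n M j = ?s j"
        using w_L_sgm[OF M MD, of j] sgm_stable[of j t n M] kt by simp
    qed
    also have "\<dots> = {i\<in>{h..n}. i \<le> t \<or> i \<in> chips ?s h}"
    proof (intro equalityI subsetI)
      fix v assume "v \<in> ?s ` J_xi n M (k, t)"
      then obtain j where j: "v = ?s j" "1 \<le> j" "j \<le> t" "h \<le> ?s j"
        unfolding J by (auto simp: chips_def)
      have vn: "v \<le> n" using permutes_in_image[OF ps, of j] j kt by auto
      have "v \<in> chips ?s h"
      proof (rule ccontr)
        assume "v \<notin> chips ?s h"
        then have "h \<le> ?s v" by (simp add: chips_def)
        moreover have "t < v" using j True by simp
        ultimately have "?s v = v" using sgm_above[OF M, of t v] vn True by auto
        then have "?s v = ?s j" using j by simp
        then have "v = j" by (rule injD[OF permutes_inj[OF ps]])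
        then show False using \<open>t < v\<close> j by simp
      qed
      then show "v \<in> {i\<in>{h..n}. i \<le> t \<or> i \<in> chips ?s h}" using vn j by simp
    next
      fix v assume v: "v \<in> {i\<in>{h..n}. i \<le> t \<or> i \<in> chips ?s h}"
      then have v': "h \<le> v" "v \<le> n" "?s v < h" using True by (auto simp: chips_def)
      have "v \<in> ?s ` {1..n}" using permutes_image[OF ps] v' \<open>1 \<le> h\<close> by simp
      then obtain j where j: "v = ?s j" "1 \<le> j" "j \<le> n" by auto
      have "j \<le> t"
      proof (rule ccontr)
        assume "\<not> j \<le> t"
        then have "?s j = j \<or> ?s j \<le> t" using sgm_above[OF M, of t j] j by simp
        then have "?s j = j" using j v' True by auto
        then show False using j v' by simp
      qed
      then show "v \<in> ?s ` J_xi n M (k, t)"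
        unfolding J using j v' by (auto simp: chips_def)
    qed
    finally show ?thesis .
  qed
qed

section \<open>Polynomials in the variables attached to places\<close>

definition eval_monom :: "(place \<Rightarrow> 'b::comm_ring_1) \<Rightarrow> (place \<Rightarrow>\<^sub>0 nat) \<Rightarrow> 'b" where
  "eval_monom \<sigma> m = (\<Prod>\<eta>\<in>Poly_Mapping.keys m. \<sigma> \<eta> ^ Poly_Mapping.lookup m \<eta>)"

text \<open>The coefficient map is arbitrary so that substitution into polynomials and into
  polynomials in a further variable, as in \<open>invariant_derivation\<close>, are one
  construction.\<close>

definition peval :: "('a::field_char_0 \<Rightarrow> 'b::comm_ring_1) \<Rightarrow> (place \<Rightarrow> 'b) \<Rightarrow> 'a pol \<Rightarrow> 'b" where
  "peval \<phi> \<sigma> p = (\<Sum>m\<in>Poly_Mapping.keys p. \<phi> (Poly_Mapping.lookup p m) * eval_monom \<sigma> m)"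

lemma psubst_peval: "psubst = peval pconst"
  by (intro ext) (simp add: psubst_def peval_def eval_monom_def)

lemma eval_monom_superset:
  assumes "finite A" "Poly_Mapping.keys m \<subseteq> A"
  shows "eval_monom \<sigma> m = (\<Prod>\<eta>\<in>A. \<sigma> \<eta> ^ Poly_Mapping.lookup m \<eta>)"
  unfolding eval_monom_def using assms by (intro prod.mono_neutral_left) (auto simp: in_keys_iff)

lemma eval_monom_0 [simp]: "eval_monom \<sigma> 0 = 1"
  by (simp add: eval_monom_def)

lemma eval_monom_add: "eval_monom \<sigma> (m + m') = eval_monom \<sigma> m * eval_monom \<sigma> m'"
proof -
  let ?A = "Poly_Mapping.keys m \<union> Poly_Mapping.keys m'"
  have "Poly_Mapping.keys (m + m') \<subseteq> ?A" by (rule keys_add)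
  then show ?thesis
    using eval_monom_superset[of ?A m \<sigma>] eval_monom_superset[of ?A m' \<sigma>] eval_monom_superset[of ?A "m + m'" \<sigma>]
    by (simp add: lookup_add power_add prod.distrib)
qed

lemma eval_monom_single [simp]: "eval_monom \<sigma> (Poly_Mapping.single \<eta> k) = \<sigma> \<eta> ^ k"
  by (cases "k = 0") (simp_all add: eval_monom_def)

lemma pm_sum_single:
  fixes p :: "'k \<Rightarrow>\<^sub>0 'c::comm_monoid_add"
  shows "p = (\<Sum>m\<in>Poly_Mapping.keys p. Poly_Mapping.single m (Poly_Mapping.lookup p m))"
proof (rule poly_mapping_eqI)
  fix k
  have "(\<Sum>m\<in>Poly_Mapping.keys p. Poly_Mapping.lookup (Poly_Mapping.single m (Poly_Mapping.lookup p m)) k)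
     = (\<Sum>m\<in>Poly_Mapping.keys p. if m = k then Poly_Mapping.lookup p k else 0)"
    by (intro sum.cong) (auto simp: lookup_single when_def)
  then show "Poly_Mapping.lookup p k = Poly_Mapping.lookup (\<Sum>m\<in>Poly_Mapping.keys p. Poly_Mapping.single m (Poly_Mapping.lookup p m)) k"
    by (simp add: lookup_sum in_keys_iff)
qed

lemma yvar_power: "yvar \<eta> ^ k = Poly_Mapping.single (Poly_Mapping.single \<eta> k) 1"
  by (induction k) (simp_all add: yvar_def mult_single flip: single_add)

lemma eval_monom_yvar: "eval_monom yvar m = Poly_Mapping.single m 1"
proof -
  have "eval_monom yvar (\<Sum>\<eta>\<in>A. Poly_Mapping.single \<eta> (f \<eta>)) = Poly_Mapping.single (\<Sum>\<eta>\<in>A. Poly_Mapping.single \<eta> (f \<eta>)) 1"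
    if "finite A" for A f
    using that by (induction A) (simp_all add: eval_monom_add yvar_power mult_single)
  from this[of "Poly_Mapping.keys m" "Poly_Mapping.lookup m"] show ?thesis
    using pm_sum_single[of m] by simp
qed

lemma single_pconst_mon: "Poly_Mapping.single m c = pconst c * eval_monom yvar m"
  by (simp add: eval_monom_yvar pconst_def mult_single)

lemma pol_sum: "p = (\<Sum>m\<in>Poly_Mapping.keys p. pconst (Poly_Mapping.lookup p m) * eval_monom yvar m)"
  using pm_sum_single[of p] by (simp flip: single_pconst_mon)

lemma pol_induct [case_names const var add mult]:
  assumes "\<And>c. P (pconst c)" "\<And>\<eta>. P (yvar \<eta>)" "\<And>p q. P p \<Longrightarrow> P q \<Longrightarrow> P (p + q)" "\<And>p q. P p \<Longrightarrow> P q \<Longrightarrow> P (p * q)"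
  shows "P p"
proof -
  have 1: "P 1" using assms(1)[of 1] by (simp add: pconst_def)
  have 0: "P 0" using assms(1)[of 0] by (simp add: pconst_def)
  have "P (yvar \<eta> ^ k)" for \<eta> k by (induction k) (auto simp: 1 assms)
  then have "P (\<Prod>\<eta>\<in>A. yvar \<eta> ^ k \<eta>)" for A k by (induction A rule: infinite_finite_induct) (auto simp: 1 assms)
  then have "P (\<Sum>m\<in>A. pconst (f m) * eval_monom yvar m)" for A f
    by (induction A rule: infinite_finite_induct) (auto simp: 0 assms eval_monom_def)
  then show ?thesis by (subst pol_sum)
qed

lemma comm_ring_hom_pconst: "comm_ring_hom (pconst :: 'a::field_char_0 \<Rightarrow> 'a pol)"
  by unfold_locales (auto simp: pconst_def single_add mult_single)

lemma pconst_0 [simp]: "pconst 0 = 0"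
  by (simp add: pconst_def)

lemma pconst_1 [simp]: "pconst 1 = 1"
  by (simp add: pconst_def)

lemma peval_single:
  assumes "comm_ring_hom \<phi>"
  shows "peval \<phi> \<sigma> (Poly_Mapping.single m c) = \<phi> c * eval_monom \<sigma> m"
proof -
  interpret comm_ring_hom \<phi> by fact
  show ?thesis by (cases "c = 0") (simp_all add: peval_def)
qed

lemma comm_ring_hom_peval:
  assumes "comm_ring_hom \<phi>"
  shows "comm_ring_hom (peval \<phi> \<sigma>)"
proof -
  interpret \<phi>: comm_ring_hom \<phi> by fact
  have add: "peval \<phi> \<sigma> (p + q) = peval \<phi> \<sigma> p + peval \<phi> \<sigma> q" for p q
    unfolding peval_def by (rule setsum_keys_plus_distrib) (auto simp: \<phi>.hom_add distrib_right)
  have z: "peval \<phi> \<sigma> 0 = 0"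
    by (simp add: peval_def)
  have sum: "peval \<phi> \<sigma> (\<Sum>i\<in>A. f i) = (\<Sum>i\<in>A. peval \<phi> \<sigma> (f i))" for A and f :: "'c \<Rightarrow> 'a pol"
    by (induction A rule: infinite_finite_induct) (simp_all add: add z)
  note s = peval_single[OF assms]
  have mult: "peval \<phi> \<sigma> (p * q) = peval \<phi> \<sigma> p * peval \<phi> \<sigma> q" for p q
  proof -
    have "p * q = (\<Sum>m\<in>Poly_Mapping.keys p. \<Sum>m'\<in>Poly_Mapping.keys q.
        Poly_Mapping.single (m + m') (Poly_Mapping.lookup p m * Poly_Mapping.lookup q m'))"
      by (subst (1) pm_sum_single[of p], subst (1) pm_sum_single[of q]) (simp add: sum_product mult_single)
    then show ?thesis
      by (simp add: sum s eval_monom_add \<phi>.hom_mult peval_def[of _ _ p] peval_def[of _ _ q] sum_product mult_ac)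
  qed
  show ?thesis
  proof
    show "peval \<phi> \<sigma> 1 = 1" using s[of \<sigma> 0 1] by simp
    show "peval \<phi> \<sigma> 0 = 0" by (simp add: peval_def)
  qed (auto simp: add mult)
qed

lemma peval_pconst: "comm_ring_hom \<phi> \<Longrightarrow> peval \<phi> \<sigma> (pconst c) = \<phi> c"
  by (simp add: pconst_def peval_single)

lemma peval_yvar:
  assumes "comm_ring_hom \<phi>"
  shows "peval \<phi> \<sigma> (yvar \<eta>) = \<sigma> \<eta>"
proof -
  interpret comm_ring_hom \<phi> by fact
  show ?thesis by (simp add: yvar_def peval_single[OF assms])
qed

lemma comm_ring_hom_psubst: "comm_ring_hom (psubst \<sigma> :: 'a::field_char_0 pol \<Rightarrow> 'a pol)"
  unfolding psubst_peval by (rule comm_ring_hom_peval[OF comm_ring_hom_pconst])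

lemma psubst_pconst [simp]: "psubst \<sigma> (pconst c) = pconst c"
  unfolding psubst_peval by (rule peval_pconst[OF comm_ring_hom_pconst])

lemma psubst_yvar [simp]: "psubst \<sigma> (yvar \<eta>) = \<sigma> \<eta>"
  unfolding psubst_peval by (rule peval_yvar[OF comm_ring_hom_pconst])

lemma comm_ring_hom_eqI:
  assumes "comm_ring_hom F" "comm_ring_hom G" "\<And>c. F (pconst c) = G (pconst c)" "\<And>\<eta>. F (yvar \<eta>) = G (yvar \<eta>)"
  shows "F p = G p"
proof -
  interpret F: comm_ring_hom F by fact
  interpret G: comm_ring_hom G by fact
  show ?thesis by (induction p rule: pol_induct) (auto simp: assms F.hom_add G.hom_add F.hom_mult G.hom_mult)
qed

lemma keys_pm_minus: "Poly_Mapping.keys (p - q) \<subseteq> Poly_Mapping.keys p \<union> Poly_Mapping.keys q"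
  for p q :: "'k \<Rightarrow>\<^sub>0 'c::ab_group_add"
  by (auto simp: in_keys_iff lookup_minus)

lemma S_alg_add: "p \<in> S_alg n M \<Longrightarrow> q \<in> S_alg n M \<Longrightarrow> p + q \<in> S_alg n M"
  unfolding S_alg_def using keys_add[of p q] by fastforce

lemma S_alg_diff: "p \<in> S_alg n M \<Longrightarrow> q \<in> S_alg n M \<Longrightarrow> p - q \<in> S_alg n M"
  unfolding S_alg_def using keys_pm_minus[of p q] by fastforce

lemma S_alg_mult:
  assumes "p \<in> S_alg n M" "q \<in> S_alg n M"
  shows "p * q \<in> S_alg n M"
  unfolding S_alg_def
proof (intro CollectI ballI)
  fix m assume "m \<in> Poly_Mapping.keys (p * q)"
  then obtain a b where "m = a + b" "a \<in> Poly_Mapping.keys p" "b \<in> Poly_Mapping.keys q"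
    using keys_mult[of p q] by blast
  then show "Poly_Mapping.keys m \<subseteq> Delta n - M"
    using assms keys_add[of a b] unfolding S_alg_def by blast
qed

lemma S_alg_pconst [simp]: "pconst c \<in> S_alg n M"
  by (simp add: S_alg_def pconst_def)

lemma S_alg_0 [simp]: "0 \<in> S_alg n M"
  by (simp add: S_alg_def)

lemma S_alg_1 [simp]: "1 \<in> S_alg n M"
  by (simp add: S_alg_def)

lemma S_alg_yvar: "\<eta> \<in> Delta n - M \<Longrightarrow> yvar \<eta> \<in> S_alg n M"
  by (simp add: S_alg_def yvar_def)

lemma S_alg_uminus: "p \<in> S_alg n M \<Longrightarrow> - p \<in> S_alg n M"
  using S_alg_diff[of 0 n M p] by simp

lemma S_alg_sum: "(\<And>i. i \<in> A \<Longrightarrow> f i \<in> S_alg n M) \<Longrightarrow> sum f A \<in> S_alg n M"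
  by (induction A rule: infinite_finite_induct) (auto intro: S_alg_add)

lemma S_alg_prod: "(\<And>i. i \<in> A \<Longrightarrow> f i \<in> S_alg n M) \<Longrightarrow> prod f A \<in> S_alg n M"
  by (induction A rule: infinite_finite_induct) (auto intro: S_alg_mult)

lemma S_alg_power: "p \<in> S_alg n M \<Longrightarrow> p ^ k \<in> S_alg n M"
  by (induction k) (auto intro: S_alg_mult)

lemma psubst_S_alg:
  assumes "p \<in> S_alg n M" "\<And>\<eta>. \<eta> \<in> Delta n - M \<Longrightarrow> \<sigma> \<eta> \<in> S_alg n M"
  shows "psubst \<sigma> p \<in> S_alg n M"
  unfolding psubst_def using assms
  by (intro S_alg_sum S_alg_mult S_alg_prod S_alg_power S_alg_pconst assms(2)) (auto simp: S_alg_def)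

lemma psubst_cong_S_alg:
  assumes "p \<in> S_alg n M" "\<And>\<eta>. \<eta> \<in> Delta n - M \<Longrightarrow> \<sigma> \<eta> = \<tau> \<eta>"
  shows "psubst \<sigma> p = psubst \<tau> p"
  unfolding psubst_def using assms
  by (intro sum.cong arg_cong2[where f = "(*)"] prod.cong refl) (auto simp: S_alg_def subset_iff)

section \<open>Filtration by weight\<close>

definition wdeg :: "(place \<Rightarrow> nat) \<Rightarrow> (place \<Rightarrow>\<^sub>0 nat) \<Rightarrow> nat" where
  "wdeg wt m = (\<Sum>\<eta>\<in>Poly_Mapping.keys m. Poly_Mapping.lookup m \<eta> * wt \<eta>)"

lemma wdeg_add: "wdeg wt (m + m') = wdeg wt m + wdeg wt m'"
  unfolding wdeg_def
  by (rule setsum_keys_plus_distrib[where f = "\<lambda>\<eta> k. k * wt \<eta>"]) (auto simp: distrib_right)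

lemma wdeg_single [simp]: "wdeg wt (Poly_Mapping.single \<eta> k) = k * wt \<eta>"
  by (cases "k = 0") (simp_all add: wdeg_def)

lemma wdeg_0 [simp]: "wdeg wt 0 = 0"
  by (simp add: wdeg_def)

definition below_weight :: "(place \<Rightarrow> nat) \<Rightarrow> nat \<Rightarrow> 'a::field_char_0 pol set" where
  "below_weight wt N = {p. \<forall>m\<in>Poly_Mapping.keys p. wdeg wt m < N}"

lemma below_weight_add: "p \<in> below_weight wt N \<Longrightarrow> q \<in> below_weight wt N \<Longrightarrow> p + q \<in> below_weight wt N"
  unfolding below_weight_def using keys_add[of p q] by fastforce

lemma below_weight_0 [simp]: "0 \<in> below_weight wt N"
  by (simp add: below_weight_def)

lemma below_weight_sum: "(\<And>i. i \<in> A \<Longrightarrow> f i \<in> below_weight wt N) \<Longrightarrow> sum f A \<in> below_weight wt N"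
  by (induction A rule: infinite_finite_induct) (simp_all add: below_weight_add)

lemma below_weight_mult:
  assumes "p \<in> below_weight wt N" "q \<in> below_weight wt (Suc N')"
  shows "p * q \<in> below_weight wt (N + N')"
  unfolding below_weight_def
proof (intro CollectI ballI)
  fix m assume "m \<in> Poly_Mapping.keys (p * q)"
  then obtain a b where "m = a + b" "a \<in> Poly_Mapping.keys p" "b \<in> Poly_Mapping.keys q"
    using keys_mult[of p q] by blast
  then show "wdeg wt m < N + N'"
    using assms unfolding below_weight_def by (fastforce simp: wdeg_add)
qed

lemma below_weight_mono: "p \<in> below_weight wt N \<Longrightarrow> N \<le> N' \<Longrightarrow> p \<in> below_weight wt N'"
  unfolding below_weight_def by fastforce

lemma pconst_mult_below: "p \<in> below_weight wt N \<Longrightarrow> pconst c * p \<in> below_weight wt N"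
  using below_weight_mult[of p wt N "pconst c" 0] by (simp add: below_weight_def pconst_def mult.commute)

lemma eval_monom_below: "eval_monom yvar m \<in> below_weight wt (Suc (wdeg wt m))"
  by (simp add: eval_monom_yvar below_weight_def)

lemma diff_below_mult:
  assumes "a - b \<in> below_weight wt w" "b \<in> below_weight wt (Suc w)" "a' - b' \<in> below_weight wt w'" "b' \<in> below_weight wt (Suc w')"
  shows "a * a' - b * b' \<in> below_weight wt (w + w')"
proof -
  have "(a' - b') + b' \<in> below_weight wt (Suc w')"
    by (intro below_weight_add below_weight_mono[OF assms(3)] assms(4)) simp
  then have "(a - b) * a' \<in> below_weight wt (w + w')" "(a' - b') * b \<in> below_weight wt (w' + w)"
    using below_weight_mult[OF assms(1)] below_weight_mult[OF assms(3,2)] by simp_all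
  then have "(a - b) * a' + (a' - b') * b \<in> below_weight wt (w + w')"
    by (intro below_weight_add) (simp_all add: add.commute)
  then show ?thesis by (simp add: algebra_simps)
qed

lemma eval_monom_diff_below:
  assumes "\<And>\<eta>. \<eta> \<in> Poly_Mapping.keys m \<Longrightarrow> \<sigma> \<eta> - yvar \<eta> \<in> below_weight wt (wt \<eta>)"
  shows "eval_monom \<sigma> m - eval_monom yvar m \<in> below_weight wt (wdeg wt m)"
proof -
  have pw: "\<sigma> \<eta> ^ k - yvar \<eta> ^ k \<in> below_weight wt (k * wt \<eta>)" if "\<eta> \<in> Poly_Mapping.keys m" for \<eta> k
  proof (induction k)
    case (Suc k)
    have "yvar \<eta> ^ k \<in> (below_weight wt (Suc (k * wt \<eta>)) :: 'a pol set)" for k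
      using eval_monom_below[of "Poly_Mapping.single \<eta> k" wt] by simp
    from diff_below_mult[OF assms[OF that] _ Suc this] this[of 1] show ?case by simp
  qed (simp add: below_weight_def)
  have "(\<Prod>\<eta>\<in>A. \<sigma> \<eta> ^ Poly_Mapping.lookup m \<eta>) - (\<Prod>\<eta>\<in>A. yvar \<eta> ^ Poly_Mapping.lookup m \<eta>)
       \<in> below_weight wt (\<Sum>\<eta>\<in>A. Poly_Mapping.lookup m \<eta> * wt \<eta>) \<and>
     (\<Prod>\<eta>\<in>A. yvar \<eta> ^ Poly_Mapping.lookup m \<eta>) \<in> (below_weight wt (Suc (\<Sum>\<eta>\<in>A. Poly_Mapping.lookup m \<eta> * wt \<eta>)) :: 'a pol set)"
    if "finite A" "A \<subseteq> Poly_Mapping.keys m" for A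
    using that
  proof (induction A)
    case (insert \<eta> A)
    have y: "yvar \<eta> ^ Poly_Mapping.lookup m \<eta> \<in> (below_weight wt (Suc (Poly_Mapping.lookup m \<eta> * wt \<eta>)) :: 'a pol set)"
      using eval_monom_below[of "Poly_Mapping.single \<eta> (Poly_Mapping.lookup m \<eta>)" wt] by simp
    have IH: "(\<Prod>\<eta>\<in>A. \<sigma> \<eta> ^ Poly_Mapping.lookup m \<eta>) - (\<Prod>\<eta>\<in>A. yvar \<eta> ^ Poly_Mapping.lookup m \<eta>)
       \<in> below_weight wt (\<Sum>\<eta>\<in>A. Poly_Mapping.lookup m \<eta> * wt \<eta>)"
     "(\<Prod>\<eta>\<in>A. yvar \<eta> ^ Poly_Mapping.lookup m \<eta>) \<in> (below_weight wt (Suc (\<Sum>\<eta>\<in>A. Poly_Mapping.lookup m \<eta> * wt \<eta>)) :: 'a pol set)"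
      using insert by auto
    show ?case
      using diff_below_mult[OF pw y IH] below_weight_mult[OF y IH(2)] insert by simp
  qed (simp add: below_weight_def)
  from this[of "Poly_Mapping.keys m"] show ?thesis
    by (simp add: eval_monom_def wdeg_def)
qed

lemma psubst_diff_below:
  assumes "p \<in> below_weight wt (Suc N)" "p \<in> S_alg n M"
    and "\<And>\<eta>. \<eta> \<in> Delta n - M \<Longrightarrow> \<sigma> \<eta> - yvar \<eta> \<in> below_weight wt (wt \<eta>)"
  shows "psubst \<sigma> p - p \<in> below_weight wt N"
proof -
  have "psubst \<sigma> p - p = (\<Sum>m\<in>Poly_Mapping.keys p. pconst (Poly_Mapping.lookup p m) * (eval_monom \<sigma> m - eval_monom yvar m))"
    by (subst (2) pol_sum) (simp add: psubst_peval peval_def algebra_simps sum_subtractf)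
  also have "\<dots> \<in> below_weight wt N"
  proof (intro below_weight_sum pconst_mult_below)
    fix m assume m: "m \<in> Poly_Mapping.keys p"
    have "eval_monom \<sigma> m - eval_monom yvar m \<in> below_weight wt (wdeg wt m)"
      using m assms(2) by (intro eval_monom_diff_below assms(3)) (auto simp: S_alg_def)
    then show "eval_monom \<sigma> m - eval_monom yvar m \<in> below_weight wt N"
      by (rule below_weight_mono) (use m assms(1) in \<open>auto simp: below_weight_def less_Suc_eq_le\<close>)
  qed
  finally show ?thesis .
qed

text \<open>The substitution changes p by terms of smaller weight only, so the part of maximal
  weight survives.\<close>

lemma psubst_nonzero:
  assumes "p \<noteq> 0" "p \<in> S_alg n M"
    and "\<And>\<eta>. \<eta> \<in> Delta n - M \<Longrightarrow> \<sigma> \<eta> - yvar \<eta> \<in> below_weight wt (wt \<eta>)"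
  shows "psubst \<sigma> p \<noteq> 0"
proof
  assume z: "psubst \<sigma> p = 0"
  let ?N = "Max (wdeg wt ` Poly_Mapping.keys p)"
  have fin: "finite (wdeg wt ` Poly_Mapping.keys p)" "wdeg wt ` Poly_Mapping.keys p \<noteq> {}"
    using assms(1) by auto
  then obtain m where m: "m \<in> Poly_Mapping.keys p" "wdeg wt m = ?N"
    using Max_in by (metis (no_types, lifting) imageE)
  have "p \<in> below_weight wt (Suc ?N)"
    using fin by (auto simp: below_weight_def less_Suc_eq_le)
  from psubst_diff_below[OF this assms(2,3)] have "- p \<in> below_weight wt ?N"
    using z by simp
  moreover have "m \<in> Poly_Mapping.keys (- p)"
    using m(1) by (simp add: in_keys_iff)
  ultimately have "wdeg wt m < ?N"
    unfolding below_weight_def by blast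
  then show False
    using m(2) by simp
qed

section \<open>The coadjoint action on polynomials and fractions\<close>

lemma UT_carrier:
  "g \<in> carrier (UT n) \<longleftrightarrow> g \<in> carrier_mat n n \<and> (\<forall>i<n. g $$ (i, i) = 1) \<and> (\<forall>i j. i < j \<longrightarrow> j < n \<longrightarrow> g $$ (i, j) = 0)"
  by (simp add: UT_def)

lemma UT_mult [simp]: "g \<otimes>\<^bsub>UT n\<^esub> h = g * h"
  by (simp add: UT_def)

lemma UT_one [simp]: "\<one>\<^bsub>UT n\<^esub> = 1\<^sub>m n"
  by (simp add: UT_def)

lemma mat_mult_entry:
  "A \<in> carrier_mat n n \<Longrightarrow> B \<in> carrier_mat n n \<Longrightarrow> i < n \<Longrightarrow> j < n \<Longrightarrow> (A * B) $$ (i, j) = (\<Sum>l<n. A $$ (i, l) * B $$ (l, j))"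
  by (simp add: scalar_prod_def atLeast0LessThan)

lemma UT_mult_closed:
  assumes g: "g \<in> carrier (UT n)" and h: "h \<in> carrier (UT n)"
  shows "g * h \<in> carrier (UT n)"
proof -
  have c: "g \<in> carrier_mat n n" "h \<in> carrier_mat n n"
    using g h by (auto simp: UT_carrier)
  have "(g * h) $$ (i, i) = 1" if i: "i < n" for i
  proof -
    have "(g * h) $$ (i, i) = (\<Sum>l<n. if l = i then 1 else 0)"
      unfolding mat_mult_entry[OF c i i]
    proof (rule sum.cong[OF refl])
      fix l assume "l \<in> {..<n}"
      then show "g $$ (i, l) * h $$ (l, i) = (if l = i then 1 else 0)"
        using g h i unfolding UT_carrier by (cases "l < i"; cases "l = i") auto
    qed
    then show ?thesis using i by simp
  qed
  moreover have "(g * h) $$ (i, j) = 0" if ij: "i < j" "j < n" for i j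
    unfolding mat_mult_entry[OF c less_trans[OF ij] ij(2)]
  proof (rule sum.neutral, rule ballI)
    fix l assume "l \<in> {..<n}"
    then show "g $$ (i, l) * h $$ (l, j) = 0"
      using g h ij unfolding UT_carrier by (cases "i < l") auto
  qed
  ultimately show ?thesis
    using c by (simp add: UT_carrier)
qed

text \<open>Determinant 1 gives an inverse matrix, and forward substitution row by row shows that it
  is again unitriangular.\<close>

lemma UT_inverse:
  assumes g: "g \<in> carrier (UT n)"
  shows "\<exists>h\<in>carrier (UT n). h * g = 1\<^sub>m n \<and> g * h = 1\<^sub>m n"
proof -
  have c: "g \<in> carrier_mat n n" using g by (simp add: UT_carrier)
  have "det g = prod_list (diag_mat g)"
    by (rule det_lower_triangular[OF _ c]) (use g in \<open>auto simp: UT_carrier\<close>)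
  also have "\<dots> = 1"
    using g c by (auto simp: prod_list_diag_prod UT_carrier)
  finally have "det g \<noteq> 0" by simp
  then have "g \<in> Units (ring_mat TYPE('a) n ())"
    by (rule det_non_zero_imp_unit[OF c])
  then obtain h where h: "h \<in> carrier_mat n n" "h * g = 1\<^sub>m n" "g * h = 1\<^sub>m n"
    by (auto simp: Units_def ring_mat_def)
  have e: "h $$ (i, j) = (if i = j then 1 else 0) - (\<Sum>l<i. g $$ (i, l) * h $$ (l, j))" if ij: "i < n" "j < n" for i j
  proof -
    have "(if i = j then 1 else 0) = (g * h) $$ (i, j)"
      using h(3) ij by simp
    also have "\<dots> = (\<Sum>l<n. g $$ (i, l) * h $$ (l, j))"
      by (rule mat_mult_entry[OF c h(1) ij])
    also have "\<dots> = (\<Sum>l<Suc i. g $$ (i, l) * h $$ (l, j))"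
      using g ij by (intro sum.mono_neutral_right) (auto simp: UT_carrier)
    also have "\<dots> = (\<Sum>l<i. g $$ (i, l) * h $$ (l, j)) + h $$ (i, j)"
      using g ij by (simp add: UT_carrier)
    finally show ?thesis by simp
  qed
  have "i < n \<Longrightarrow> (i = j \<longrightarrow> h $$ (i, j) = 1) \<and> (i < j \<longrightarrow> h $$ (i, j) = 0)" if j: "j < n" for i j
  proof (induction i rule: less_induct)
    case (less i)
    have "(\<Sum>l<i. g $$ (i, l) * h $$ (l, j)) = 0" if "i \<le> j"
      using less that by (intro sum.neutral) auto
    then show ?case using e[OF less.prems j] by auto
  qed
  then have "h \<in> carrier (UT n)"
    using h(1) by (auto simp: UT_carrier)
  then show ?thesis using h by blast
qed

lemma group_UT: "group (UT n :: 'a::field_char_0 mat monoid)"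
proof (rule groupI)
  fix x y z :: "'a mat"
  assume xyz: "x \<in> carrier (UT n)" "y \<in> carrier (UT n)" "z \<in> carrier (UT n)"
  then show "x \<otimes>\<^bsub>UT n\<^esub> y \<otimes>\<^bsub>UT n\<^esub> z = x \<otimes>\<^bsub>UT n\<^esub> (y \<otimes>\<^bsub>UT n\<^esub> z)"
    by (auto simp: UT_carrier intro: assoc_mult_mat)
next
  fix x :: "'a mat" assume "x \<in> carrier (UT n)"
  then show "\<exists>y\<in>carrier (UT n). y \<otimes>\<^bsub>UT n\<^esub> x = \<one>\<^bsub>UT n\<^esub>" "\<one>\<^bsub>UT n\<^esub> \<otimes>\<^bsub>UT n\<^esub> x = x"
    using UT_inverse[of x n] by (auto simp: UT_carrier)
qed (auto simp: UT_mult_closed, auto simp: UT_carrier)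

lemma UT_inv:
  assumes "g \<in> carrier (UT n)"
  shows "inv\<^bsub>UT n\<^esub> g \<in> carrier (UT n)" "inv\<^bsub>UT n\<^esub> g * g = 1\<^sub>m n" "inv\<^bsub>UT n\<^esub> (inv\<^bsub>UT n\<^esub> g) = g"
  using group.inv_closed[OF group_UT assms] group.l_inv[OF group_UT assms] group.inv_inv[OF group_UT assms]
  by simp_all

text \<open>Each factor x moves the support one diagonal further down.\<close>

lemma pow_strict_lower:
  fixes x :: "'a::field_char_0 mat"
  assumes x: "x \<in> carrier_mat n n" "\<And>i j. i < n \<Longrightarrow> j < n \<Longrightarrow> i \<le> j \<Longrightarrow> x $$ (i, j) = 0"
  shows "i < n \<Longrightarrow> j < n \<Longrightarrow> i < j + k \<Longrightarrow> (x ^\<^sub>m k) $$ (i, j) = 0"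
proof (induction k arbitrary: i j)
  case (Suc k)
  have "(x ^\<^sub>m Suc k) $$ (i, j) = (\<Sum>l<n. (x ^\<^sub>m k) $$ (i, l) * x $$ (l, j))"
    using mat_mult_entry[of "x ^\<^sub>m k" n x i j] x(1) Suc.prems by simp
  also have "\<dots> = 0"
  proof (rule sum.neutral, rule ballI)
    fix l assume "l \<in> {..<n}"
    then show "(x ^\<^sub>m k) $$ (i, l) * x $$ (l, j) = 0"
      using Suc x(2)[of l j] by (cases "l \<le> j") auto
  qed
  finally show ?case .
qed (use x in auto)

lemma nil_exp_UT:
  assumes M: "M \<subseteq> Delta n" and x: "x \<in> m_ideal n M" and n: "1 \<le> n"
  shows "nil_exp n x \<in> carrier (UT n)"
proof -
  have c: "x \<in> carrier_mat n n" using x by (auto simp: m_ideal_def)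
  have z: "x $$ (i, j) = 0" if "i < n" "j < n" "i \<le> j" for i j
    using x M that by (auto simp: m_ideal_def Delta_def)
  note p = pow_strict_lower[OF c z]
  have "(\<Sum>k<n. (x ^\<^sub>m k) $$ (i, i) / fact k) = 1" if "i < n" for i
  proof -
    have "(\<Sum>k<n. (x ^\<^sub>m k) $$ (i, i) / fact k) = (\<Sum>k<n. if k = 0 then 1 else 0)"
      using p[of i i] that c by (intro sum.cong) auto
    then show ?thesis using n by simp
  qed
  moreover have "(\<Sum>k<n. (x ^\<^sub>m k) $$ (i, j) / fact k) = 0" if "i < j" "j < n" for i j
    using p[of i j] that by (intro sum.neutral) auto
  ultimately show ?thesis
    by (auto simp: UT_carrier nil_exp_def)
qed

lemma nil_exp_zero:
  assumes n: "1 \<le> n"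
  shows "(1\<^sub>m n :: 'a::field_char_0 mat) \<in> nil_exp n ` m_ideal n M"
proof -
  let ?x = "0\<^sub>m n n :: 'a mat"
  have "?x \<in> m_ideal n M"
    unfolding m_ideal_def by (intro CollectI exI[of _ "\<lambda>_. 0"]) (auto intro: eq_matI)
  moreover have "nil_exp n ?x = 1\<^sub>m n"
  proof (rule eq_matI)
    fix i j assume "i < dim_row (1\<^sub>m n :: 'a mat)" "j < dim_col (1\<^sub>m n :: 'a mat)"
    then have ij: "i < n" "j < n" by auto
    have "(?x ^\<^sub>m k) $$ (i, j) = (if k = 0 then 1\<^sub>m n $$ (i, j) else 0)" for k
      using ij by (cases k) (auto simp: right_mult_zero_mat[of _ n n])
    then have "(\<Sum>k<n. (?x ^\<^sub>m k) $$ (i, j) / fact k) = (\<Sum>k<n. if k = 0 then 1\<^sub>m n $$ (i, j) else 0)"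
      by (intro sum.cong) auto
    then show "nil_exp n ?x $$ (i, j) = 1\<^sub>m n $$ (i, j)"
      using n ij by (simp add: nil_exp_def)
  qed (auto simp: nil_exp_def)
  ultimately show ?thesis by force
qed

text \<open>The exponential of the ideal lies in \<open>UT n\<close> and contains the identity, so
  its cosets lie in \<open>UT n\<close> and cover it: the representatives of elements of L are
  exactly the elements of \<open>UT n\<close>.\<close>

lemma invariant_field_eq:
  assumes "M \<subseteq> Delta n" "1 \<le> n"
  shows "(invariant_field n M :: 'a::field_char_0 ratfun set) = {F \<in> K_L n M. \<forall>g\<in>carrier (UT n). act_rat n M g F = F}"
proof -
  let ?H = "nil_exp n ` m_ideal n M :: 'a mat set"
  have car: "carrier (L_group n M) = (\<Union>a\<in>carrier (UT n). {?H #>\<^bsub>UT n\<^esub> a})"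
    by (simp add: L_group_def FactGroup_def RCOSETS_def)
  have "g \<in> carrier (UT n)" if "c \<in> carrier (L_group n M)" "g \<in> c" for c and g :: "'a mat"
    using that nil_exp_UT[OF assms(1) _ assms(2)] unfolding car by (auto simp: r_coset_def intro: UT_mult_closed)
  moreover have "\<exists>c\<in>carrier (L_group n M). g \<in> c" if g: "g \<in> carrier (UT n)" for g :: "'a mat"
  proof -
    have "1\<^sub>m n * g \<in> ?H #>\<^bsub>UT n\<^esub> g"
      unfolding r_coset_def UT_mult using nil_exp_zero[OF assms(2), of M] by blast
    moreover have "1\<^sub>m n * g = g"
      using g unfolding UT_carrier by (intro left_mult_one_mat[of _ n n]) blast
    ultimately show ?thesis using g unfolding car by auto
  qed
  ultimately show ?thesis
    unfolding invariant_field_def by blast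
qed

section \<open>The action on coordinates\<close>

text \<open>Q is a parameter because two matrices occur: \<open>Delta n - M\<close> gives the
  generic one, \<open>S_set n M\<close> its restriction to \<Sigma>.\<close>

definition phi :: "nat \<Rightarrow> place set \<Rightarrow> nat \<Rightarrow> nat \<Rightarrow> 'a::field_char_0 pol" where
  "phi n Q i j = (if (i, j) \<in> Q then yvar (i, j) else 0)"

definition gen_act :: "nat \<Rightarrow> place set \<Rightarrow> 'a::field_char_0 mat \<Rightarrow> place \<Rightarrow> 'a pol" where
  "gen_act n M g \<eta> = coAd n (inv\<^bsub>UT n\<^esub> g) (generic_functional n M) (mat_unit n \<eta>)"

text \<open>The transpose, with 1-based indices: coordinates on \<open>\<nn>\<^sup>*\<close> transform by the transpose of \<open>g\<close>.\<close>

definition upper_of :: "'a mat \<Rightarrow> nat \<Rightarrow> nat \<Rightarrow> 'a" where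
  "upper_of g i j = g $$ (j - 1, i - 1)"

lemma act_pol_psubst: "act_pol n M g p = psubst (gen_act n M g) p"
  by (simp add: act_pol_def gen_act_def[abs_def])

lemma Delta_finite_diff [simp]: "finite (Delta n - M)"
  using finite_Delta by simp

text \<open>The inverse in \<open>gen_act\<close> cancels the one in \<open>coAd\<close>, so the
  coordinate at (i, j) becomes the value at the conjugate of a matrix unit by g. The (k, l) entry of
  this conjugate is a product of an entry of g and one of its inverse.\<close>

lemma gen_act_sum:
  assumes g: "g \<in> carrier (UT n)" and ij: "i \<in> {1..n}" "j \<in> {1..n}"
  shows "gen_act n M g (i, j) =
    (\<Sum>(k, l)\<in>Delta n - M. pconst (upper_of g i k * upper_of (inv\<^bsub>UT n\<^esub> g) l j) * yvar (k, l))"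
proof -
  let ?h = "inv\<^bsub>UT n\<^esub> g"
  have c: "g \<in> carrier_mat n n" "?h \<in> carrier_mat n n"
    using g UT_inv(1)[OF g] by (simp_all add: UT_carrier)
  have E: "mat_unit n (i, j) \<in> carrier_mat n n" by (simp add: mat_unit_def)
  have "(g * mat_unit n (i, j) * ?h) $$ (k - 1, l - 1) = g $$ (k - 1, i - 1) * ?h $$ (j - 1, l - 1)"
    if "(k, l) \<in> Delta n" for k l
  proof -
    have kl: "k - 1 < n" "l - 1 < n" using that by (auto simp: Delta_def)
    have gE: "(g * mat_unit n (i, j)) $$ (k - 1, b) = (if b = j - 1 then g $$ (k - 1, i - 1) else 0)" if "b < n" for b
    proof -
      have "(g * mat_unit n (i, j)) $$ (k - 1, b) = (\<Sum>a<n. g $$ (k - 1, a) * mat_unit n (i, j) $$ (a, b))"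
        by (rule mat_mult_entry[OF c(1) E kl(1) that])
      also have "\<dots> = (\<Sum>a<n. if a = i - 1 then (if b = j - 1 then g $$ (k - 1, i - 1) else 0) else 0)"
        using ij that by (intro sum.cong) (auto simp: mat_unit_def)
      finally show ?thesis using ij by auto
    qed
    have "(g * mat_unit n (i, j) * ?h) $$ (k - 1, l - 1) = (\<Sum>b<n. (g * mat_unit n (i, j)) $$ (k - 1, b) * ?h $$ (b, l - 1))"
      by (rule mat_mult_entry[OF mult_carrier_mat[OF c(1) E] c(2) kl])
    also have "\<dots> = (\<Sum>b<n. if b = j - 1 then g $$ (k - 1, i - 1) * ?h $$ (j - 1, l - 1) else 0)"
      using gE by (intro sum.cong) auto
    finally show ?thesis using ij by auto
  qed
  then show ?thesis
    unfolding gen_act_def coAd_def generic_functional_def Ad_def UT_inv(3)[OF g] upper_of_def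
    by (intro sum.cong) auto
qed

lemma upper_of_unitri:
  assumes "g \<in> carrier (UT n)"
  shows "unitri n (upper_of g)"
  using assms by (auto simp: unitri_def upper_of_def UT_carrier)

lemma upper_of_inv:
  assumes g: "g \<in> carrier (UT n)" and ij: "i \<in> {1..n}" "j \<in> {1..n}"
  shows "(\<Sum>k\<in>{1..n}. upper_of g i k * upper_of (inv\<^bsub>UT n\<^esub> g) k j) = (if i = j then 1 else 0)"
proof -
  let ?h = "inv\<^bsub>UT n\<^esub> g"
  have c: "g \<in> carrier_mat n n" "?h \<in> carrier_mat n n"
    using g UT_inv(1)[OF g] by (simp_all add: UT_carrier)
  have "(\<Sum>k\<in>{1..n}. upper_of g i k * upper_of ?h k j) = (\<Sum>k<n. ?h $$ (j - 1, k) * g $$ (k, i - 1))"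
    by (rule sum.reindex_bij_witness[of _ Suc "\<lambda>k. k - 1"]) (auto simp: upper_of_def)
  also have "\<dots> = (?h * g) $$ (j - 1, i - 1)"
    by (rule mat_mult_entry[OF c(2,1), symmetric]) (use ij in auto)
  finally show ?thesis
    using UT_inv(2)[OF g] ij by auto
qed

lemma gen_act_conj_by:
  assumes g: "g \<in> carrier (UT n)" and ij: "i \<in> {1..n}" "j \<in> {1..n}"
  shows "gen_act n M g (i, j) = conj_by n (\<lambda>i j. pconst (upper_of g i j)) (phi n (Delta n - M))
     (\<lambda>i j. pconst (upper_of (inv\<^bsub>UT n\<^esub> g) i j)) i j"
proof -
  interpret comm_ring_hom "pconst :: 'a \<Rightarrow> 'a pol" by (rule comm_ring_hom_pconst)
  let ?v = "upper_of g" and ?w = "upper_of (inv\<^bsub>UT n\<^esub> g)"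
  have "conj_by n (\<lambda>i j. pconst (?v i j)) (phi n (Delta n - M)) (\<lambda>i j. pconst (?w i j)) i j
     = (\<Sum>(k, l)\<in>{1..n} \<times> {1..n}. pconst (?v i k) * phi n (Delta n - M) k l * pconst (?w l j))"
    by (simp add: conj_by_def sum.cartesian_product)
  also have "\<dots> = (\<Sum>(k, l)\<in>Delta n - M. pconst (?v i k) * phi n (Delta n - M) k l * pconst (?w l j))"
    by (rule sum.mono_neutral_right) (auto simp: phi_def Delta_def split: if_splits)
  also have "\<dots> = gen_act n M g (i, j)"
    unfolding gen_act_sum[OF g ij] by (intro sum.cong) (auto simp: phi_def hom_mult mult_ac)
  finally show ?thesis ..
qed

text \<open>Contributions to (i, j) come from places weakly below and to the left of it, and these
  stay in M.\<close>

lemma gen_act_M: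
  assumes g: "g \<in> carrier (UT n)" and M: "left_down n M" "M \<subseteq> Delta n" and ij: "(i, j) \<in> M"
  shows "gen_act n M g (i, j) = 0"
proof -
  have ij': "i \<in> {1..n}" "j \<in> {1..n}" using ij M(2) by (auto simp: Delta_def)
  show ?thesis
    unfolding gen_act_sum[OF g ij']
  proof (rule sum.neutral, safe)
    fix k l assume kl: "(k, l) \<in> Delta n" "(k, l) \<notin> M"
    then have kl': "k \<in> {1..n}" "l \<in> {1..n}" by (auto simp: Delta_def)
    have "\<not> (i \<le> k \<and> l \<le> j)"
      using left_downD[OF M(1) ij, of k l] kl by (auto simp: Delta_def)
    then have "k < i \<or> j < l" by linarith
    then have "upper_of g i k = 0 \<or> upper_of (inv\<^bsub>UT n\<^esub> g) l j = 0"
      using upper_of_unitri[OF g] upper_of_unitri[OF UT_inv(1)[OF g]] ij' kl' by (auto simp: unitri_def)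
    then show "pconst (upper_of g i k * upper_of (inv\<^bsub>UT n\<^esub> g) l j) * yvar (k, l) = 0" by auto
  qed
qed

text \<open>The weight drops on moving away from the diagonal, which is where the extra terms of the
  action come from. The summand n keeps it a natural number.\<close>

definition pwt :: "nat \<Rightarrow> place \<Rightarrow> nat" where
  "pwt n \<eta> = n + snd \<eta> - fst \<eta>"

lemma gen_act_below:
  assumes g: "g \<in> carrier (UT n)" and \<eta>: "\<eta> \<in> Delta n - M"
  shows "gen_act n M g \<eta> - yvar \<eta> \<in> below_weight (pwt n) (pwt n \<eta>)"
proof -
  obtain i j where e: "\<eta> = (i, j)" by (cases \<eta>)
  have ij: "i \<in> {1..n}" "j \<in> {1..n}" "(i, j) \<in> Delta n - M" "j < i" using \<eta> e by (auto simp: Delta_def)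
  let ?f = "\<lambda>(k, l). pconst (upper_of g i k * upper_of (inv\<^bsub>UT n\<^esub> g) l j) * yvar (k, l)"
  have u: "unitri n (upper_of g)" "unitri n (upper_of (inv\<^bsub>UT n\<^esub> g))"
    using upper_of_unitri[OF g] upper_of_unitri[OF UT_inv(1)[OF g]] .
  have "gen_act n M g \<eta> = ?f (i, j) + sum ?f (Delta n - M - {(i, j)})"
    unfolding e gen_act_sum[OF g ij(1,2)] by (rule sum.remove) (use ij in auto)
  also have "?f (i, j) = yvar \<eta>"
    using u ij by (simp add: unitri_def e)
  finally have "gen_act n M g \<eta> - yvar \<eta> = sum ?f (Delta n - M - {(i, j)})" by simp
  also have "\<dots> \<in> below_weight (pwt n) (pwt n \<eta>)"
  proof (rule below_weight_sum)
    fix \<xi> assume \<xi>: "\<xi> \<in> Delta n - M - {(i, j)}"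
    obtain k l where kl: "\<xi> = (k, l)" by (cases \<xi>)
    have kl': "k \<in> {1..n}" "l \<in> {1..n}" "l < k" "(k, l) \<noteq> (i, j)" using \<xi> kl by (auto simp: Delta_def)
    show "?f \<xi> \<in> below_weight (pwt n) (pwt n \<eta>)"
    proof (cases "k < i \<or> j < l")
      case True
      then have "upper_of g i k * upper_of (inv\<^bsub>UT n\<^esub> g) l j = 0"
        using u ij kl' by (auto simp: unitri_def)
      then show ?thesis by (auto simp: kl)
    next
      case False
      then have "pwt n \<xi> < pwt n \<eta>"
        using kl' ij unfolding pwt_def kl e by auto
      then have "yvar \<xi> \<in> below_weight (pwt n) (pwt n \<eta>)"
        by (simp add: below_weight_def yvar_def)
      from pconst_mult_below[OF this] show ?thesis unfolding kl prod.case .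
    qed
  qed
  finally show ?thesis .
qed

lemma gen_act_S_alg:
  assumes g: "g \<in> carrier (UT n)" and \<eta>: "\<eta> \<in> Delta n - M"
  shows "gen_act n M g \<eta> \<in> S_alg n M"
proof -
  obtain i j where e: "\<eta> = (i, j)" by (cases \<eta>)
  have ij: "i \<in> {1..n}" "j \<in> {1..n}" using \<eta> e by (auto simp: Delta_def)
  show ?thesis
    unfolding e gen_act_sum[OF g ij]
    by (rule S_alg_sum) (auto intro!: S_alg_mult S_alg_yvar)
qed

lemma act_pol_S_alg: "g \<in> carrier (UT n) \<Longrightarrow> p \<in> S_alg n M \<Longrightarrow> act_pol n M g p \<in> S_alg n M"
  unfolding act_pol_psubst by (rule psubst_S_alg) (auto intro: gen_act_S_alg)

lemma act_pol_nonzero: "g \<in> carrier (UT n) \<Longrightarrow> p \<in> S_alg n M \<Longrightarrow> p \<noteq> 0 \<Longrightarrow> act_pol n M g p \<noteq> 0"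
  unfolding act_pol_psubst by (rule psubst_nonzero[where wt = "pwt n"]) (auto intro: gen_act_below)

lemma comm_ring_hom_act_pol: "comm_ring_hom (act_pol n M g)"
  unfolding act_pol_psubst[abs_def] by (rule comm_ring_hom_psubst)

lemma act_rat_Fract:
  assumes g: "g \<in> carrier (UT n)" and pq: "p \<in> S_alg n M" "q \<in> S_alg n M" "q \<noteq> 0"
  shows "act_rat n M g (Fraction_Field.Fract p q) = Fraction_Field.Fract (act_pol n M g p) (act_pol n M g q)"
  unfolding act_rat_def
proof (rule the_equality)
  interpret comm_ring_hom "act_pol n M g" by (rule comm_ring_hom_act_pol)
  fix G
  assume "\<exists>p' q'. p' \<in> S_alg n M \<and> q' \<in> S_alg n M \<and> q' \<noteq> 0 \<and> Fraction_Field.Fract p q = Fraction_Field.Fract p' q' \<and>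
     G = Fraction_Field.Fract (act_pol n M g p') (act_pol n M g q')"
  then obtain p' q' where h: "p' \<in> S_alg n M" "q' \<in> S_alg n M" "q' \<noteq> 0" "Fraction_Field.Fract p q = Fraction_Field.Fract p' q'"
    and G: "G = Fraction_Field.Fract (act_pol n M g p') (act_pol n M g q')" by blast
  have "p * q' = p' * q" using h(3,4) pq(3) by (simp add: eq_fract)
  then have "act_pol n M g p * act_pol n M g q' = act_pol n M g p' * act_pol n M g q"
    by (metis hom_mult)
  then show "G = Fraction_Field.Fract (act_pol n M g p) (act_pol n M g q)"
    unfolding G using act_pol_nonzero[OF g] pq h by (simp add: eq_fract)
qed (use pq in blast)

section \<open>Invariant fractions as quotients of invariant polynomials\<close>

definition inv_pol :: "nat \<Rightarrow> place set \<Rightarrow> 'a::field_char_0 pol set" where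
  "inv_pol n M = {p \<in> S_alg n M. \<forall>g\<in>carrier (UT n). act_pol n M g p = p}"

theorem invariant_field_fractions:
  assumes M: "M \<subseteq> Delta n" and n: "1 \<le> n"
  shows "(invariant_field n M :: 'a::field_char_0 ratfun set) =
    {Fraction_Field.Fract p q | p q. p \<in> inv_pol n M \<and> q \<in> inv_pol n M \<and> q \<noteq> 0}"
proof (intro equalityI subsetI)
  fix F :: "'a ratfun" assume "F \<in> {Fraction_Field.Fract p q | p q. p \<in> inv_pol n M \<and> q \<in> inv_pol n M \<and> q \<noteq> 0}"
  then obtain p q where pq: "F = Fraction_Field.Fract p q" "p \<in> inv_pol n M" "q \<in> inv_pol n M" "q \<noteq> 0" by blast
  then show "F \<in> invariant_field n M"
    unfolding invariant_field_eq[OF M n] by (auto simp: inv_pol_def act_rat_Fract K_L_def)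
next
  fix F :: "'a ratfun" assume "F \<in> invariant_field n M"
  then have FK: "F \<in> K_L n M" and inv: "\<And>g. g \<in> carrier (UT n) \<Longrightarrow> act_rat n M g F = F"
    unfolding invariant_field_eq[OF M n] by auto
  have "\<exists>p\<in>inv_pol n M. \<exists>q\<in>inv_pol n M. q \<noteq> 0 \<and> F = Fraction_Field.Fract p q"
    if "p \<in> S_alg n M" "q \<in> S_alg n M" "q \<noteq> 0" "F = Fraction_Field.Fract p q" "q \<in> below_weight (pwt n) N" for N p q
    using that
  proof (induction N arbitrary: p q)
    case 0
    then have "Poly_Mapping.keys q = {}" by (auto simp: below_weight_def)
    then show ?case using 0 by simp
  next
    case (Suc N)
    have fr: "p * act_pol n M g q = act_pol n M g p * q" if g: "g \<in> carrier (UT n)" for g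
    proof -
      have "Fraction_Field.Fract (act_pol n M g p) (act_pol n M g q) = Fraction_Field.Fract p q"
        using inv[OF g] act_rat_Fract[OF g Suc.prems(1-3)] Suc.prems(4) by simp
      then show ?thesis
        using act_pol_nonzero[OF g Suc.prems(2,3)] Suc.prems(3) by (simp add: eq_fract)
    qed
    show ?case
    proof (cases "\<forall>g\<in>carrier (UT n). act_pol n M g q = q")
      case True
      then have q: "q \<in> inv_pol n M" using Suc.prems by (simp add: inv_pol_def)
      have "act_pol n M g p = p" if "g \<in> carrier (UT n)" for g
        using fr[OF that] True that Suc.prems(3) by simp
      then have "p \<in> inv_pol n M" using Suc.prems by (simp add: inv_pol_def)
      then show ?thesis using q Suc.prems by blast
    next
      case False
      then obtain g where g: "g \<in> carrier (UT n)" "act_pol n M g q \<noteq> q" by blast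
      let ?q = "act_pol n M g q - q" and ?p = "act_pol n M g p - p"
      have "?q \<in> below_weight (pwt n) N"
        unfolding act_pol_psubst by (rule psubst_diff_below[OF Suc.prems(5,2)]) (rule gen_act_below[OF g(1)])
      moreover have "?p \<in> S_alg n M" "?q \<in> S_alg n M"
        using Suc.prems g by (auto intro: S_alg_diff act_pol_S_alg)
      moreover have "?q \<noteq> 0" using g by simp
      moreover have "F = Fraction_Field.Fract ?p ?q"
        using fr[OF g(1)] g(2) Suc.prems(3,4) by (simp add: eq_fract algebra_simps)
      ultimately show ?thesis using Suc.IH by blast
    qed
  qed
  moreover obtain p q where pq: "p \<in> S_alg n M" "q \<in> S_alg n M" "q \<noteq> 0" "F = Fraction_Field.Fract p q"
    using FK by (auto simp: K_L_def)
  moreover have "q \<in> below_weight (pwt n) (Suc (Max (wdeg (pwt n) ` Poly_Mapping.keys q)))"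
    by (auto simp: below_weight_def less_Suc_eq_le)
  ultimately show "F \<in> {Fraction_Field.Fract p q | p q. p \<in> inv_pol n M \<and> q \<in> inv_pol n M \<and> q \<noteq> 0}"
    by blast
qed

section \<open>Invariants are determined by their restriction to \<open>S\<close>\<close>

text \<open>The derivation with y_\<eta> \<mapsto> f \<eta>, applied to the monomial m.\<close>

definition dmon :: "(place \<Rightarrow> 'a pol) \<Rightarrow> (place \<Rightarrow>\<^sub>0 nat) \<Rightarrow> 'a::field_char_0 pol" where
  "dmon f m = (\<Sum>\<eta>\<in>Poly_Mapping.keys m. of_nat (Poly_Mapping.lookup m \<eta>) * f \<eta> * eval_monom yvar (m - Poly_Mapping.single \<eta> 1))"

lemma coeff_1_mult: "coeff (A * B) (Suc 0) = coeff A 0 * coeff B (Suc 0) + coeff A (Suc 0) * coeff B 0"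
  by (simp add: coeff_mult)

lemma coeff_prod_0: "coeff (\<Prod>\<eta>\<in>A. F \<eta>) 0 = (\<Prod>\<eta>\<in>A. coeff (F \<eta> :: 'b::comm_ring_1 poly) 0)"
  by (induction A rule: infinite_finite_induct) (simp_all add: coeff_mult)

lemma coeff_prod_1:
  "coeff (\<Prod>\<eta>\<in>A. F \<eta>) (Suc 0) = (\<Sum>\<eta>\<in>A. coeff (F \<eta> :: 'b::comm_ring_1 poly) (Suc 0) * (\<Prod>\<zeta>\<in>A - {\<eta>}. coeff (F \<zeta>) 0))"
proof (induction A rule: infinite_finite_induct)
  case (insert x A)
  have "(\<Sum>\<eta>\<in>A. coeff (F \<eta>) (Suc 0) * (\<Prod>\<zeta>\<in>insert x A - {\<eta>}. coeff (F \<zeta>) 0))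
      = (\<Sum>\<eta>\<in>A. coeff (F x) 0 * (coeff (F \<eta>) (Suc 0) * (\<Prod>\<zeta>\<in>A - {\<eta>}. coeff (F \<zeta>) 0)))"
  proof (rule sum.cong[OF refl])
    fix \<eta> assume "\<eta> \<in> A"
    then have "insert x A - {\<eta>} = insert x (A - {\<eta>})" using insert by auto
    then show "coeff (F \<eta>) (Suc 0) * (\<Prod>\<zeta>\<in>insert x A - {\<eta>}. coeff (F \<zeta>) 0)
       = coeff (F x) 0 * (coeff (F \<eta>) (Suc 0) * (\<Prod>\<zeta>\<in>A - {\<eta>}. coeff (F \<zeta>) 0))"
      using insert by (simp add: mult_ac)
  qed
  then show ?case
    using insert by (simp add: coeff_1_mult coeff_prod_0 sum_distrib_left add.commute)
qed simp_all

lemma coeff_linear_power: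
  "coeff ([:y, l:] ^ k) 0 = (y :: 'b::comm_ring_1) ^ k \<and> coeff ([:y, l:] ^ k) (Suc 0) = of_nat k * l * y ^ (k - 1)"
proof (induction k)
  case (Suc k)
  then show ?case
    by (cases k) (simp_all add: coeff_1_mult coeff_mult algebra_simps del: mult_pCons_left)
qed simp

lemma coeff_mon_linear:
  fixes f :: "place \<Rightarrow> 'a::field_char_0 pol"
  shows "coeff (eval_monom (\<lambda>\<eta>. [:yvar \<eta>, f \<eta>:]) m) (Suc 0) = dmon f m"
  unfolding eval_monom_def dmon_def coeff_prod_1
proof (rule sum.cong[OF refl])
  fix \<eta> assume \<eta>: "\<eta> \<in> Poly_Mapping.keys m"
  let ?k = "Poly_Mapping.lookup m" and ?m = "m - Poly_Mapping.single \<eta> 1"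
  have l: "Poly_Mapping.lookup ?m \<zeta> = (if \<zeta> = \<eta> then ?k \<eta> - 1 else ?k \<zeta>)" for \<zeta>
    by (simp add: lookup_minus lookup_single when_def)
  have sub: "Poly_Mapping.keys ?m \<subseteq> Poly_Mapping.keys m"
    by (auto simp: in_keys_iff l split: if_splits simp del: One_nat_def)
  have "(eval_monom yvar ?m :: 'a pol) = (\<Prod>\<zeta>\<in>Poly_Mapping.keys m. yvar \<zeta> ^ Poly_Mapping.lookup ?m \<zeta>)"
    by (rule eval_monom_superset[OF finite_keys sub])
  also have "\<dots> = yvar \<eta> ^ (?k \<eta> - 1) * (\<Prod>\<zeta>\<in>Poly_Mapping.keys m - {\<eta>}. yvar \<zeta> ^ ?k \<zeta>)"
    by (subst prod.remove[OF finite_keys \<eta>])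
      (auto simp: l simp del: One_nat_def intro!: arg_cong2[where f = "(*)"] prod.cong)
  finally show "coeff ([:yvar \<eta>, f \<eta>:] ^ ?k \<eta>) (Suc 0) * (\<Prod>\<zeta>\<in>Poly_Mapping.keys m - {\<eta>}. coeff ([:yvar \<zeta>, f \<zeta>:] ^ ?k \<zeta>) 0)
      = of_nat (?k \<eta>) * f \<eta> * (\<Prod>\<zeta>\<in>Poly_Mapping.keys ?m. yvar \<zeta> ^ Poly_Mapping.lookup ?m \<zeta>)"
    using coeff_linear_power[of "yvar \<eta>" "f \<eta>" "?k \<eta>"] coeff_linear_power[of "yvar _" "f _" "?k _"]
    by (simp add: eval_monom_def mult.assoc)
qed

lemma comm_ring_hom_comp:
  assumes "comm_ring_hom F" "comm_ring_hom G"
  shows "comm_ring_hom (\<lambda>x. F (G x))"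
proof -
  interpret F: comm_ring_hom F by fact
  interpret G: comm_ring_hom G by fact
  show ?thesis by unfold_locales (auto simp: F.hom_add G.hom_add F.hom_mult G.hom_mult)
qed

lemma comm_ring_hom_const_poly: "comm_ring_hom (\<lambda>c :: 'b::comm_ring_1. [:c:])"
  by unfold_locales (auto simp: one_pCons)

lemma comm_ring_hom_poly_at: "comm_ring_hom (\<lambda>P :: 'b::comm_ring_1 poly. poly P x)"
  by unfold_locales auto

text \<open>With s replaced by an indeterminate, the substituted polynomial takes the value p at
  infinitely many constants, since K is infinite. So it is constant in s, and its linear
  coefficient, which is the derivation applied to p, vanishes.\<close>

lemma invariant_derivation:
  fixes p :: "'a::field_char_0 pol"
  assumes inv: "\<And>s. psubst (\<lambda>\<eta>. yvar \<eta> + pconst s * f \<eta>) p = p"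
  shows "(\<Sum>m\<in>Poly_Mapping.keys p. pconst (Poly_Mapping.lookup p m) * dmon f m) = 0"
proof -
  define \<phi> where "\<phi> c = [:pconst c :: 'a pol:]" for c
  have \<phi>: "comm_ring_hom \<phi>"
    unfolding \<phi>_def by (rule comm_ring_hom_comp[OF comm_ring_hom_const_poly comm_ring_hom_pconst])
  let ?P = "peval \<phi> (\<lambda>\<eta>. [:yvar \<eta>, f \<eta>:]) p"
  have ev: "poly ?P (pconst s) = p" for s
  proof -
    have "poly ?P (pconst s) = psubst (\<lambda>\<eta>. yvar \<eta> + pconst s * f \<eta>) p"
      by (rule comm_ring_hom_eqI[where F = "\<lambda>p. poly (peval \<phi> (\<lambda>\<eta>. [:yvar \<eta>, f \<eta>:]) p) (pconst s)"])
        (auto intro!: comm_ring_hom_comp[OF comm_ring_hom_poly_at] comm_ring_hom_peval \<phi> comm_ring_hom_psubst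
          simp: peval_pconst[OF \<phi>] peval_yvar[OF \<phi>] \<phi>_def mult.commute)
    then show ?thesis using inv by simp
  qed
  have "?P - [:p:] = 0"
  proof (rule ccontr)
    assume "?P - [:p:] \<noteq> 0"
    then have "finite {x. poly (?P - [:p:]) x = 0}"
      by (rule poly_roots_finite)
    moreover have "range pconst \<subseteq> {x. poly (?P - [:p:]) x = 0}"
      using ev by auto
    ultimately have "finite (range (pconst :: 'a \<Rightarrow> 'a pol))"
      by (rule rev_finite_subset)
    moreover have "inj (pconst :: 'a \<Rightarrow> 'a pol)"
      by (auto simp: pconst_def inj_def dest: injD[OF inj_single])
    ultimately show False
      using finite_imageD infinite_UNIV_char_0 by blast
  qed
  then have "coeff ?P (Suc 0) = 0"
    by simp
  then show ?thesis
    by (simp add: peval_def coeff_sum \<phi>_def coeff_mon_linear)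
qed

text \<open>The infinitesimal action of the root vector of (a, b): row b gains row a, and column a
  loses column b.\<close>

definition ell :: "nat \<Rightarrow> place set \<Rightarrow> nat \<Rightarrow> nat \<Rightarrow> place \<Rightarrow> 'a::field_char_0 pol" where
  "ell n M a b \<eta> = (if fst \<eta> = b then phi n (Delta n - M) a (snd \<eta>) else 0)
     - (if snd \<eta> = a then phi n (Delta n - M) (fst \<eta>) b else 0)"

definition elementary :: "nat \<Rightarrow> nat \<Rightarrow> nat \<Rightarrow> 'a::field_char_0 \<Rightarrow> 'a mat" where
  "elementary n a b s = mat n n (\<lambda>(i, j). (if i = j then 1 else 0) + (if Suc i = a \<and> Suc j = b then s else 0))"

lemma elementary_UT: "b < a \<Longrightarrow> elementary n a b s \<in> carrier (UT n)"
  by (auto simp: UT_carrier elementary_def)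

lemma elementary_inv:
  assumes ab: "b < a" "a \<le> n" "1 \<le> b"
  shows "inv\<^bsub>UT n\<^esub> (elementary n a b s) = elementary n a b (- s :: 'a::field_char_0)"
proof (rule group.inv_equality[OF group_UT])
  have c: "elementary n a b s \<in> carrier_mat n n" for s :: 'a by (simp add: elementary_def)
  have "elementary n a b (- s) * elementary n a b s = 1\<^sub>m n"
  proof (rule eq_matI)
    fix i j assume "i < dim_row (1\<^sub>m n :: 'a mat)" "j < dim_col (1\<^sub>m n :: 'a mat)"
    then have ij: "i < n" "j < n" by auto
    have "(elementary n a b (- s) * elementary n a b s) $$ (i, j) = (\<Sum>l<n. elementary n a b (- s) $$ (i, l) * elementary n a b s $$ (l, j))"
      by (rule mat_mult_entry[OF c c ij])
    also have "\<dots> = (\<Sum>l<n. (if l = i then (if i = j then 1 else 0) + (if Suc i = a \<and> Suc j = b then s else 0) else 0)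
        + (if l = j then (if Suc i = a \<and> Suc j = b then - s else 0) else 0))"
      using ij ab by (intro sum.cong) (auto simp: elementary_def)
    also have "\<dots> = 1\<^sub>m n $$ (i, j)"
      using ij by (simp add: sum.distrib)
    finally show "(elementary n a b (- s) * elementary n a b s) $$ (i, j) = 1\<^sub>m n $$ (i, j)" .
  qed (auto simp: elementary_def)
  then show "elementary n a b (- s) \<otimes>\<^bsub>UT n\<^esub> elementary n a b s = \<one>\<^bsub>UT n\<^esub>" by simp
qed (use elementary_UT ab in auto)

text \<open>The term quadratic in s arises only at (b, a), which lies above the diagonal, so on
  \<open>Delta n - M\<close> the action is affine in s.\<close>

lemma gen_act_elementary:
  assumes ab: "b < a" "a \<le> n" "1 \<le> b" and \<eta>: "\<eta> \<in> Delta n - M"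
  shows "gen_act n M (elementary n a b s) \<eta> = yvar \<eta> + pconst s * ell n M a b \<eta>"
proof -
  interpret comm_ring_hom "pconst :: 'a \<Rightarrow> 'a pol" by (rule comm_ring_hom_pconst)
  obtain i j where e: "\<eta> = (i, j)" by (cases \<eta>)
  have ij: "i \<in> {1..n}" "j \<in> {1..n}" "(i, j) \<in> Delta n - M" "j < i" using \<eta> e by (auto simp: Delta_def)
  let ?F = "phi n (Delta n - M)"
  have up: "pconst (upper_of (elementary n a b s) x y) = (if y = x then 1 else 0) + (if y = a then (if x = b then pconst s else 0) else 0)"
    if "x \<in> {1..n}" "y \<in> {1..n}" for x y and s :: 'a
    using that ab by (auto simp: upper_of_def elementary_def)
  have inner: "(\<Sum>l\<in>{1..n}. ?F k l * pconst (upper_of (elementary n a b (- s)) l j)) = ?F k j + (if j = a then - pconst s * ?F k b else 0)" for k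
  proof -
    have "(\<Sum>l\<in>{1..n}. ?F k l * pconst (upper_of (elementary n a b (- s)) l j))
       = (\<Sum>l\<in>{1..n}. (if l = j then ?F k j else 0) + (if l = b then (if j = a then - pconst s * ?F k b else 0) else 0))"
      using ij by (intro sum.cong refl) (auto simp: up hom_uminus algebra_simps)
    then show ?thesis using ij ab by (simp add: sum.distrib)
  qed
  let ?G = "\<lambda>k. ?F k j + (if j = a then - pconst s * ?F k b else 0)"
  have "gen_act n M (elementary n a b s) \<eta> = (\<Sum>k\<in>{1..n}. pconst (upper_of (elementary n a b s) i k) * ?G k)"
    unfolding e gen_act_conj_by[OF elementary_UT[OF ab(1)] ij(1,2)] elementary_inv[OF ab] conj_by_def
    by (simp only: mult.assoc sum_distrib_left[symmetric] inner)
  also have "\<dots> = (\<Sum>k\<in>{1..n}. (if k = i then ?G i else 0) + (if k = a then (if i = b then pconst s * ?G a else 0) else 0))"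
    using ij by (intro sum.cong refl) (auto simp: up distrib_right)
  also have "\<dots> = ?G i + (if i = b then pconst s * ?G a else 0)"
    using ij ab by (simp add: sum.distrib)
  also have "\<dots> = yvar \<eta> + pconst s * ell n M a b \<eta>"
    using ij ab e by (auto simp: ell_def phi_def algebra_simps)
  finally show ?thesis .
qed

lemma inv_pol_derivation:
  assumes p: "p \<in> inv_pol n M" and ab: "(a, b) \<in> Delta n"
  shows "(\<Sum>m\<in>Poly_Mapping.keys p. pconst (Poly_Mapping.lookup p m) * dmon (ell n M a b) m) = 0"
proof (rule invariant_derivation)
  fix s :: 'a
  have ab': "b < a" "a \<le> n" "1 \<le> b" using ab by (auto simp: Delta_def)
  have "psubst (\<lambda>\<eta>. yvar \<eta> + pconst s * ell n M a b \<eta>) p = psubst (gen_act n M (elementary n a b s)) p"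
    using p by (intro psubst_cong_S_alg[of _ n M]) (auto simp: inv_pol_def gen_act_elementary[OF ab'])
  also have "\<dots> = p"
    using p elementary_UT[OF ab'(1), of n s] by (simp add: inv_pol_def flip: act_pol_psubst)
  finally show "psubst (\<lambda>\<eta>. yvar \<eta> + pconst s * ell n M a b \<eta>) p = p" .
qed

text \<open>Up to sign, the variable at this place is what the derivation puts in for y_\<eta>. For
  \<eta> in \<open>Delta n\<close> and b < a the two conditions exclude each other.\<close>

definition splace :: "nat \<Rightarrow> nat \<Rightarrow> place \<Rightarrow> place option" where
  "splace a b \<eta> = (if fst \<eta> = b then Some (a, snd \<eta>) else if snd \<eta> = a then Some (fst \<eta>, b) else None)"

lemma ell_splace:
  assumes "(a, b) \<in> Delta n" "\<eta> \<in> Delta n"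
  shows "\<exists>e \<in> {1, -1}. ell n M a b \<eta> = (case splace a b \<eta> of None \<Rightarrow> 0 | Some \<zeta> \<Rightarrow>
     if \<zeta> \<in> Delta n - M then pconst e * yvar \<zeta> else 0)"
proof -
  interpret comm_ring_hom "pconst :: 'a \<Rightarrow> 'a pol" by (rule comm_ring_hom_pconst)
  show ?thesis
    using assms by (cases \<eta>) (auto simp: ell_def splace_def phi_def Delta_def hom_uminus)
qed

section \<open>The order in which places are filled\<close>

definition diagram_at :: "nat \<Rightarrow> place set \<Rightarrow> nat \<Rightarrow> diagram" where
  "diagram_at n M i = fold dstep (take i (places n)) (diagram_init M)"

lemma diagram_at_Suc: "i < length (places n) \<Longrightarrow> diagram_at n M (Suc i) = dstep (places n ! i) (diagram_at n M i)"
  by (simp add: diagram_at_def take_Suc_conv_app_nth)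

lemma diagram_at_mono: "i \<le> j \<Longrightarrow> diagram_at n M i \<eta> \<noteq> None \<Longrightarrow> diagram_at n M j \<eta> = diagram_at n M i \<eta>"
proof (induction j rule: dec_induct)
  case (step j)
  show ?case
  proof (cases "j < length (places n)")
    case True
    then show ?thesis using step dstep_keeps by (simp add: diagram_at_Suc)
  next
    case False
    then have "diagram_at n M (Suc j) = diagram_at n M j" by (simp add: diagram_at_def)
    then show ?thesis using step by simp
  qed
qed simp

lemma diagram_at_final: "diagram_at n M (length (places n)) = diagram n M"
  by (simp add: diagram_at_def diagram_fold)

definition fill_time :: "nat \<Rightarrow> place set \<Rightarrow> place \<Rightarrow> nat" where
  "fill_time n M \<eta> = (LEAST i. diagram_at n M (Suc i) \<eta> \<noteq> None)"

lemma fill_time_props: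
  assumes "\<eta> \<in> Delta n - M"
  shows "diagram_at n M i \<eta> = None \<longleftrightarrow> i \<le> fill_time n M \<eta>" "fill_time n M \<eta> < length (places n)"
proof -
  have init: "diagram_at n M 0 \<eta> = None" using assms by (simp add: diagram_at_def diagram_init_def)
  have fin: "diagram_at n M (length (places n)) \<eta> \<noteq> None"
    using diagram_full[of \<eta> n M] assms by (simp add: diagram_at_final)
  then have "length (places n) \<noteq> 0" using init by metis
  then have fin': "diagram_at n M (Suc (length (places n) - 1)) \<eta> \<noteq> None" using fin by simp
  then have ex: "diagram_at n M (Suc (fill_time n M \<eta>)) \<eta> \<noteq> None"
    unfolding fill_time_def by (rule LeastI)
  have lt: "diagram_at n M (Suc i) \<eta> = None" if "i < fill_time n M \<eta>" for i
    using not_less_Least[OF that[unfolded fill_time_def]] by simp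
  show "diagram_at n M i \<eta> = None \<longleftrightarrow> i \<le> fill_time n M \<eta>"
  proof (cases "i \<le> fill_time n M \<eta>")
    case True
    then show ?thesis using init lt by (cases i) auto
  next
    case False
    then show ?thesis using diagram_at_mono[OF _ ex, of i] ex by auto
  qed
  show "fill_time n M \<eta> < length (places n)"
    using Least_le[of "\<lambda>i. diagram_at n M (Suc i) \<eta> \<noteq> None", OF fin'] \<open>length (places n) \<noteq> 0\<close>
    unfolding fill_time_def by linarith
qed

lemma dstep_cases:
  assumes "D \<eta> = None" "dstep (k, t) D \<eta> \<noteq> None"
  shows "D (k, t) = None" "(\<eta> = (k, t) \<and> dstep (k, t) D \<eta> = Some Otimes) \<or>
    (dstep (k, t) D \<eta> \<noteq> Some Otimes \<and> (\<exists>j. t < j \<and> j < k \<and> D (k, j) = None \<and> D (j, t) = None \<and> (\<eta> = (k, j) \<or> \<eta> = (j, t))))"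
  using assms by (cases \<eta>, auto simp: dstep_def fill_def split: if_splits)+

lemma dstep_both:
  assumes "D (k, t) = None" "t < j" "j < k" "D (k, j) = None" "D (j, t) = None"
  shows "dstep (k, t) D (k, j) \<noteq> None" "dstep (k, t) D (j, t) \<noteq> None"
  using assms by (auto simp: dstep_def fill_def)

lemma S_set_Delta: "S_set n M \<subseteq> Delta n"
  by (auto simp: S_set_def S_list_def set_places)

lemma S_set_notM: "S_set n M \<subseteq> Delta n - M"
proof
  fix \<eta> assume S: "\<eta> \<in> S_set n M"
  then have "diagram n M \<eta> = Some Otimes" by (simp add: S_set_def S_list_def)
  moreover have "diagram n M \<eta> = Some Bullet" if "\<eta> \<in> M"
    using diagram_at_mono[of 0 "length (places n)" n M \<eta>] that by (simp add: diagram_at_final) (simp add: diagram_at_def diagram_init_def)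
  ultimately show "\<eta> \<in> Delta n - M"
    using S S_set_Delta by force
qed

lemma fill_time_S:
  assumes \<eta>: "\<eta> \<in> Delta n - M"
  shows "\<eta> \<in> S_set n M \<longleftrightarrow> places n ! fill_time n M \<eta> = \<eta>"
    and "places n ! fill_time n M \<eta> \<in> S_set n M"
proof -
  let ?i = "fill_time n M \<eta>" and ?N = "length (places n)"
  obtain k t where kt: "places n ! ?i = (k, t)" by fastforce
  note fp = fill_time_props[OF \<eta>]
  have S: "\<zeta> \<in> S_set n M \<longleftrightarrow> diagram_at n M (Suc ?i) \<zeta> = Some Otimes" if "diagram_at n M (Suc ?i) \<zeta> \<noteq> None" "\<zeta> \<in> Delta n" for \<zeta>
    using diagram_at_mono[of "Suc ?i" ?N n M \<zeta>] that fp(2) by (simp add: diagram_at_final S_set_def S_list_def set_places)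
  have D: "diagram_at n M ?i \<eta> = None" "dstep (k, t) (diagram_at n M ?i) \<eta> \<noteq> None"
    using fp(1)[of ?i] fp(1)[of "Suc ?i"] diagram_at_Suc[OF fp(2)] kt by auto
  note c = dstep_cases[OF D]
  show "\<eta> \<in> S_set n M \<longleftrightarrow> places n ! fill_time n M \<eta> = \<eta>"
    using c(2) S[of \<eta>] D(2) \<eta> unfolding kt diagram_at_Suc[OF fp(2), unfolded kt] by auto
  have "dstep (k, t) (diagram_at n M ?i) (k, t) = Some Otimes"
    using c(1) by (simp add: dstep_def fill_def)
  moreover have "(k, t) \<in> Delta n" using kt fp(2) nth_mem set_places by metis
  ultimately show "places n ! fill_time n M \<eta> \<in> S_set n M"
    using S[of "(k, t)"] unfolding kt diagram_at_Suc[OF fp(2), unfolded kt] by auto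
qed

text \<open>Decreasing along the construction, so that the weights \<open>2 ^ stage\<close> let earlier steps dominate.\<close>

definition stage :: "nat \<Rightarrow> place set \<Rightarrow> place \<Rightarrow> nat" where
  "stage n M \<eta> = length (places n) - fill_time n M \<eta>"

text \<open>The derivation for \<open>(a, b)\<close> replaces \<open>y\<^sub>\<eta>\<close> by \<open>\<plusminus>y\<^sub>\<xi>\<close>, where \<open>\<eta>\<close> is filled in the step of \<open>\<xi>\<close>. Any other
  replacement \<open>\<eta>' \<mapsto> \<xi>'\<close> that lands in \<open>S\<close> happens after this step, or \<open>\<eta>'\<close> was filled
  before \<open>\<xi>'\<close>.\<close>

lemma partner_exists:
  assumes \<eta>: "\<eta> \<in> Delta n - M" "\<eta> \<notin> S_set n M"
  shows "\<exists>a b \<xi>. (a, b) \<in> Delta n \<and> \<xi> \<in> S_set n M \<and> stage n M \<xi> = stage n M \<eta> \<and> splace a b \<eta> = Some \<xi> \<and>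
    (\<forall>\<eta>'\<in>Delta n - M. \<forall>\<xi>'\<in>S_set n M. splace a b \<eta>' = Some \<xi>' \<longrightarrow> \<eta>' \<noteq> \<eta> \<longrightarrow>
      stage n M \<xi>' < stage n M \<xi> \<or> (stage n M \<xi> < stage n M \<xi>' \<and> stage n M \<xi>' < stage n M \<eta>'))"
proof -
  let ?i = "fill_time n M \<eta>" and ?N = "length (places n)"
  obtain k t where kt: "places n ! ?i = (k, t)" by fastforce
  note fp = fill_time_props[OF \<eta>(1)]
  have D: "diagram_at n M ?i \<eta> = None" "dstep (k, t) (diagram_at n M ?i) \<eta> \<noteq> None"
    using fp(1)[of ?i] fp(1)[of "Suc ?i"] diagram_at_Suc[OF fp(2)] kt by auto
  have ktS: "(k, t) \<in> S_set n M" using fill_time_S(2)[OF \<eta>(1)] kt by simp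
  have ktD: "(k, t) \<in> Delta n - M" using ktS S_set_notM by blast
  have "\<eta> \<noteq> (k, t)" using \<eta>(2) ktS by auto
  then obtain j where j: "t < j" "j < k" "diagram_at n M ?i (k, j) = None" "diagram_at n M ?i (j, t) = None" "\<eta> = (k, j) \<or> \<eta> = (j, t)"
    using dstep_cases(2)[OF D] by auto
  have notM: "diagram_at n M i \<zeta> = None \<Longrightarrow> \<zeta> \<notin> M" for i \<zeta>
    using diagram_at_mono[of 0 i n M \<zeta>] by (auto simp: diagram_at_def diagram_init_def)
  \<comment> \<open>(a, b) is the place filled together with \<eta> in the step of (k, t), with the
    opposite sign.\<close>
  obtain a b where ab: "(a, b) = (if \<eta> = (k, j) then (j, t) else (k, j))" by (metis surj_pair)
  have abD: "(a, b) \<in> Delta n - M"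
    using ab j ktD notM[OF j(3)] notM[OF j(4)] by (auto simp: Delta_def split: if_splits)
  have kt0: "diagram_at n M ?i (k, t) = None" by (rule dstep_cases(1)[OF D])
  have ab0: "diagram_at n M ?i (a, b) = None" using ab j by (auto split: if_splits)
  have ab1: "diagram_at n M (Suc ?i) (a, b) \<noteq> None"
    using dstep_both[OF kt0 j(1-4)] ab unfolding diagram_at_Suc[OF fp(2)] kt by (auto split: if_splits)
  have fab: "fill_time n M (a, b) = ?i"
    using fill_time_props(1)[OF abD, of ?i] fill_time_props(1)[OF abD, of "Suc ?i"] ab0 ab1 by simp
  have "dstep (k, t) (diagram_at n M ?i) (k, t) \<noteq> None" by (rule dstep_self)
  then have fkt: "fill_time n M (k, t) = ?i"
  proof -
    have "\<not> Suc ?i \<le> fill_time n M (k, t)"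
      using fill_time_props(1)[OF ktD, of "Suc ?i"] \<open>dstep (k, t) (diagram_at n M ?i) (k, t) \<noteq> None\<close>
      unfolding diagram_at_Suc[OF fp(2)] kt by blast
    moreover have "?i \<le> fill_time n M (k, t)"
      using fill_time_props(1)[OF ktD, of ?i] kt0 by blast
    ultimately show ?thesis by linarith
  qed
  have sp: "splace a b \<eta> = Some (k, t)"
    using ab j by (auto simp: splace_def split: if_splits)
  have "stage n M \<xi>' < stage n M (k, t) \<or> (stage n M (k, t) < stage n M \<xi>' \<and> stage n M \<xi>' < stage n M \<eta>')"
    if h: "\<eta>' \<in> Delta n - M" "\<xi>' \<in> S_set n M" "splace a b \<eta>' = Some \<xi>'" "\<eta>' \<noteq> \<eta>" for \<eta>' \<xi>'
  proof -
    obtain k' t' where x: "\<xi>' = (k', t')" by fastforce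
    have xD: "(k', t') \<in> Delta n - M" using h(2) x S_set_notM by blast
    let ?i' = "fill_time n M (k', t')"
    have pi: "places n ! ?i' = (k', t')" using fill_time_S(1)[OF xD] h(2) x by simp
    have fi: "?i' < ?N" using fill_time_props(2)[OF xD] .
    obtain j' where j': "t' < j'" "j' < k'" "((a, b) = (k', j') \<and> \<eta>' = (j', t')) \<or> ((a, b) = (j', t') \<and> \<eta>' = (k', j'))"
      using h(1,3) abD x by (cases \<eta>') (auto simp: splace_def Delta_def split: if_splits)
    have ne: "?i' \<noteq> ?i"
    proof
      assume "?i' = ?i"
      then have "(k', t') = (k, t)" using pi kt by simp
      then have "\<eta>' = \<eta>" using j' ab j by (auto split: if_splits)
      then show False using h(4) by simp
    qed
    show ?thesis
    proof (cases "?i' < ?i")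
      case False
      then have "?i < ?i'" using ne by linarith
      then show ?thesis using fi unfolding stage_def x fkt by linarith
    next
      case True
      have A: "diagram_at n M ?i' (a, b) = None" using fill_time_props(1)[OF abD] fab True by simp
      have B: "dstep (k', t') (diagram_at n M ?i') (a, b) = None"
        using fill_time_props(1)[OF abD, of "Suc ?i'"] fab True diagram_at_Suc[OF fi, of M] pi by simp
      have C: "diagram_at n M ?i' (k', t') = None" using fill_time_props(1)[OF xD] by simp
      \<comment> \<open>The step of \<xi>' came earlier and left (a, b) empty. Had \<eta>' been
        empty as well, that step would have filled both.\<close>
      have "diagram_at n M ?i' \<eta>' \<noteq> None"
      proof
        assume E: "diagram_at n M ?i' \<eta>' = None"
        from j'(3) show False
        proof
          assume "(a, b) = (k', j') \<and> \<eta>' = (j', t')"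
          then show False using dstep_both(1)[where D = "diagram_at n M ?i'", OF C j'(1,2)] A B E by simp
        next
          assume "(a, b) = (j', t') \<and> \<eta>' = (k', j')"
          then show False using dstep_both(2)[where D = "diagram_at n M ?i'", OF C j'(1,2)] A B E by simp
        qed
      qed
      then have "fill_time n M \<eta>' < ?i'" using fill_time_props(1)[OF h(1)] by simp
      then show ?thesis using True fi fp(2) unfolding stage_def x fkt by linarith
    qed
  qed
  then show ?thesis
    using abD ktS sp fkt by (intro exI[of _ a] exI[of _ b] exI[of _ "(k, t)"]) (auto simp: stage_def)
qed

section \<open>Restriction to \<Sigma> is injective on invariants\<close>

definition restr :: "nat \<Rightarrow> place set \<Rightarrow> 'a::field_char_0 pol \<Rightarrow> 'a pol" where
  "restr n M = psubst (\<lambda>\<eta>. if \<eta> \<in> S_set n M then yvar \<eta> else 0)"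

lemma restr_zero_keys:
  assumes "restr n M p = 0" "m \<in> Poly_Mapping.keys p"
  shows "\<not> Poly_Mapping.keys m \<subseteq> S_set n M"
proof
  assume sub: "Poly_Mapping.keys m \<subseteq> S_set n M"
  let ?s = "\<lambda>\<eta>. if \<eta> \<in> S_set n M then yvar \<eta> else 0 :: 'a pol"
  have eval_monom: "eval_monom ?s m' = (if Poly_Mapping.keys m' \<subseteq> S_set n M then eval_monom yvar m' else 0)" for m'
  proof (cases "Poly_Mapping.keys m' \<subseteq> S_set n M")
    case True
    then show ?thesis by (auto simp: eval_monom_def subset_iff intro!: prod.cong)
  next
    case False
    then obtain \<eta> where "\<eta> \<in> Poly_Mapping.keys m'" "\<eta> \<notin> S_set n M" by blast
    then have "\<exists>\<eta>\<in>Poly_Mapping.keys m'. ?s \<eta> ^ Poly_Mapping.lookup m' \<eta> = 0"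
      by (intro bexI[of _ \<eta>]) (auto simp: in_keys_iff)
    then show ?thesis using False unfolding eval_monom_def by (simp add: prod_zero)
  qed
  have "Poly_Mapping.lookup (restr n M p) m
      = (\<Sum>m'\<in>Poly_Mapping.keys p. if m' = m then Poly_Mapping.lookup p m else 0)"
    unfolding restr_def psubst_peval peval_def lookup_sum
  proof (rule sum.cong[OF refl])
    fix m' assume "m' \<in> Poly_Mapping.keys p"
    have "pconst (Poly_Mapping.lookup p m') * eval_monom ?s m'
        = (if Poly_Mapping.keys m' \<subseteq> S_set n M then Poly_Mapping.single m' (Poly_Mapping.lookup p m') else 0)"
      by (simp add: eval_monom single_pconst_mon)
    then show "Poly_Mapping.lookup (pconst (Poly_Mapping.lookup p m') * eval_monom ?s m') m
        = (if m' = m then Poly_Mapping.lookup p m else 0)"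
      using sub by (auto simp: lookup_single when_def)
  qed
  then have "Poly_Mapping.lookup (restr n M p) m = Poly_Mapping.lookup p m"
    using assms(2) by simp
  then show False using assms by (simp add: in_keys_iff)
qed

lemma lookup_pconst_mult: "Poly_Mapping.lookup (pconst c * p) m = c * Poly_Mapping.lookup p m"
proof -
  have "Poly_Mapping.lookup (pconst c * (\<Sum>k\<in>A. Poly_Mapping.single k (f k))) m
     = c * Poly_Mapping.lookup (\<Sum>k\<in>A. Poly_Mapping.single k (f k)) m" for A f
    by (induction A rule: infinite_finite_induct)
      (auto simp: distrib_left lookup_add pconst_def mult_single lookup_single when_def)
  from this[of _ "Poly_Mapping.keys p"] show ?thesis
    using pm_sum_single[of p] by metis
qed

lemma of_nat_pconst: "(of_nat k :: 'a::field_char_0 pol) = pconst (of_nat k)"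
  by (simp add: pconst_def)

text \<open>The condition on monomials is written additively because subtraction of exponents is
  truncated.\<close>

lemma lookup_dmon_term:
  assumes "(a, b) \<in> Delta n" "\<eta> \<in> Delta n" "\<eta> \<in> Poly_Mapping.keys m"
  shows "\<exists>e\<in>{1, -1}. Poly_Mapping.lookup (of_nat (Poly_Mapping.lookup m \<eta>) * ell n M a b \<eta> * eval_monom yvar (m - Poly_Mapping.single \<eta> 1)) \<mu> =
    (case splace a b \<eta> of None \<Rightarrow> 0 | Some \<zeta> \<Rightarrow>
      if \<zeta> \<in> Delta n - M \<and> m + Poly_Mapping.single \<zeta> 1 = \<mu> + Poly_Mapping.single \<eta> 1
      then e * of_nat (Poly_Mapping.lookup m \<eta>) else (0::'a::field_char_0))"
proof -
  obtain e :: 'a where e: "e \<in> {1, -1}" "ell n M a b \<eta> = (case splace a b \<eta> of None \<Rightarrow> 0 | Some \<zeta> \<Rightarrow>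
     if \<zeta> \<in> Delta n - M then pconst e * yvar \<zeta> else 0)"
    using ell_splace[OF assms(1,2)] by blast
  have m: "m = (m - Poly_Mapping.single \<eta> 1) + Poly_Mapping.single \<eta> 1"
  proof (rule poly_mapping_eqI)
    fix k
    have "Poly_Mapping.lookup m \<eta> \<ge> 1" using assms(3) by (simp add: in_keys_iff)
    then show "Poly_Mapping.lookup m k = Poly_Mapping.lookup (m - Poly_Mapping.single \<eta> 1 + Poly_Mapping.single \<eta> 1) k"
      by (auto simp: lookup_add lookup_minus lookup_single when_def)
  qed
  let ?m = "m - Poly_Mapping.single \<eta> 1"
  have eq: "Poly_Mapping.lookup (of_nat (Poly_Mapping.lookup m \<eta>) * (pconst e * yvar \<zeta>) * eval_monom yvar ?m) \<mu>
      = (if m + Poly_Mapping.single \<zeta> 1 = \<mu> + Poly_Mapping.single \<eta> 1 then e * of_nat (Poly_Mapping.lookup m \<eta>) else 0)" for \<zeta>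
  proof -
    have "of_nat (Poly_Mapping.lookup m \<eta>) * (pconst e * yvar \<zeta>) * eval_monom yvar ?m
        = Poly_Mapping.single (Poly_Mapping.single \<zeta> 1 + ?m) (e * of_nat (Poly_Mapping.lookup m \<eta>))"
      unfolding of_nat_pconst eval_monom_yvar yvar_def pconst_def
      by (simp only: mult_single add_0_left mult_1_right) (simp only: mult.commute)
    moreover have "Poly_Mapping.single \<zeta> 1 + ?m = \<mu> \<longleftrightarrow> m + Poly_Mapping.single \<zeta> 1 = \<mu> + Poly_Mapping.single \<eta> 1"
    proof -
      have "Poly_Mapping.single \<zeta> 1 + ?m = \<mu> \<longleftrightarrow> (Poly_Mapping.single \<zeta> 1 + ?m) + Poly_Mapping.single \<eta> 1 = \<mu> + Poly_Mapping.single \<eta> 1"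
        by (rule add_right_cancel[symmetric])
      also have "(Poly_Mapping.single \<zeta> 1 + ?m) + Poly_Mapping.single \<eta> 1 = m + Poly_Mapping.single \<zeta> 1"
        using m by (metis add.assoc add.commute)
      finally show ?thesis .
    qed
    ultimately show ?thesis by (simp add: lookup_single when_def)
  qed
  show ?thesis
    using e(1) eq unfolding e(2) by (intro bexI[of _ e]) (auto split: option.split)
qed

text \<open>Let the derivation that pairs \<eta>0 with \<xi> turn m0 into \<mu>. If another pair (m,
  \<eta>) led to \<mu> through \<eta> \<mapsto> \<zeta>, minimality of the degree outside S would
  force \<zeta> into S and \<eta> out of it, and maximality of \<open>val\<close> would give
  \<open>2 ^ stage n M \<xi> + 2 ^ stage n M \<eta> \<le> 2 * 2 ^ stage n M \<zeta>\<close>. But by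
  \<open>partner_exists\<close> the stage of \<zeta> is smaller than that of \<xi> or that of
  \<eta>.\<close>

theorem inv_pol_restr_zero:
  fixes p :: "'a::field_char_0 pol"
  assumes p: "p \<in> inv_pol n M" and z: "restr n M p = 0"
  shows "p = 0"
proof (rule ccontr)
  assume nz: "p \<noteq> 0"
  let ?S = "S_set n M" and ?K = "Poly_Mapping.keys p"
  let ?e = "wdeg (\<lambda>\<eta>. if \<eta> \<in> ?S then 0 else 1)"
  \<comment> \<open>The factor 2 makes a factor in S weigh as much in \<open>?W\<close> as
    \<open>2 ^ stage\<close> of a place one stage higher.\<close>
  let ?W = "wdeg (\<lambda>\<eta>. if \<eta> \<in> ?S then 2 * 2 ^ stage n M \<eta> else 0)"
  have keys: "Poly_Mapping.keys m \<subseteq> Delta n - M" if "m \<in> ?K" for m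
    using p that by (auto simp: inv_pol_def S_alg_def)
  define d where "d = Min (?e ` ?K)"
  have dle: "d \<le> ?e m" if "m \<in> ?K" for m
    unfolding d_def using that by (intro Min_le) auto
  let ?Q = "{(m, \<eta>). m \<in> ?K \<and> ?e m = d \<and> \<eta> \<in> Poly_Mapping.keys m \<and> \<eta> \<notin> ?S}"
  have finQ: "finite ?Q"
    by (rule finite_subset[of _ "Sigma ?K Poly_Mapping.keys"]) auto
  have "d \<in> ?e ` ?K" unfolding d_def using nz by (intro Min_in) auto
  then obtain m1 where m1: "m1 \<in> ?K" "?e m1 = d" by auto
  moreover obtain \<eta>1 where "\<eta>1 \<in> Poly_Mapping.keys m1" "\<eta>1 \<notin> ?S"
    using restr_zero_keys[OF z m1(1)] by blast
  ultimately have neQ: "?Q \<noteq> {}" by blast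
  define val where "val = (\<lambda>(m, \<eta>). ?W m + 2 ^ stage n M \<eta>)"
  have "Max (val ` ?Q) \<in> val ` ?Q" using finQ neQ by (intro Max_in) auto
  then obtain m0 \<eta>0 where Q0: "(m0, \<eta>0) \<in> ?Q" and max0: "val (m0, \<eta>0) = Max (val ` ?Q)" by force
  have maxQ: "?W m + 2 ^ stage n M \<eta> \<le> ?W m0 + 2 ^ stage n M \<eta>0" if "(m, \<eta>) \<in> ?Q" for m \<eta>
  proof -
    have "val (m, \<eta>) \<le> val (m0, \<eta>0)"
      unfolding max0 by (rule Max_ge) (use finQ that in auto)
    then show ?thesis by (simp add: val_def)
  qed
  have m0: "m0 \<in> ?K" "?e m0 = d" "\<eta>0 \<in> Poly_Mapping.keys m0" "\<eta>0 \<notin> ?S" "\<eta>0 \<in> Delta n - M"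
    using Q0 keys by auto
  obtain a b \<xi> where ab: "(a, b) \<in> Delta n" and \<xi>: "\<xi> \<in> ?S" "stage n M \<xi> = stage n M \<eta>0" "splace a b \<eta>0 = Some \<xi>"
    and others: "\<And>\<eta>' \<xi>'. \<eta>' \<in> Delta n - M \<Longrightarrow> \<xi>' \<in> ?S \<Longrightarrow> splace a b \<eta>' = Some \<xi>' \<Longrightarrow> \<eta>' \<noteq> \<eta>0 \<Longrightarrow>
      stage n M \<xi>' < stage n M \<xi> \<or> (stage n M \<xi> < stage n M \<xi>' \<and> stage n M \<xi>' < stage n M \<eta>')"
    using partner_exists[OF m0(5,4)] by blast
  let ?s = "\<lambda>\<eta>. Poly_Mapping.single \<eta> (1::nat)"
  define \<mu> where "\<mu> = m0 - ?s \<eta>0 + ?s \<xi>"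
  have \<mu>: "m0 + ?s \<xi> = \<mu> + ?s \<eta>0"
  proof (rule poly_mapping_eqI)
    fix k
    have "Poly_Mapping.lookup m0 \<eta>0 \<ge> 1" using m0(3) by (simp add: in_keys_iff)
    then show "Poly_Mapping.lookup (m0 + ?s \<xi>) k = Poly_Mapping.lookup (\<mu> + ?s \<eta>0) k"
      by (auto simp: \<mu>_def lookup_add lookup_minus lookup_single when_def)
  qed
  let ?T = "\<lambda>m \<eta>. of_nat (Poly_Mapping.lookup m \<eta>) * ell n M a b \<eta> * eval_monom yvar (m - ?s \<eta>) :: 'a pol"
  have unique: "m = m0 \<and> \<eta> = \<eta>0"
    if h: "m \<in> ?K" "\<eta> \<in> Poly_Mapping.keys m" "splace a b \<eta> = Some \<zeta>" "\<zeta> \<in> Delta n - M" "m + ?s \<zeta> = \<mu> + ?s \<eta>" for m \<eta> \<zeta>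
  proof (cases "\<eta> = \<eta>0")
    case True
    then have "m + ?s \<xi> = m0 + ?s \<xi>" using h \<xi>(3) \<mu> by simp
    then show ?thesis using True by simp
  next
    case False
    have sum: "m + ?s \<zeta> + ?s \<eta>0 = m0 + ?s \<xi> + ?s \<eta>"
      using h(5) \<mu> by (metis add.assoc add.commute)
    have "?e m + (if \<zeta> \<in> ?S then 0 else 1) + 1 = ?e m0 + (if \<eta> \<in> ?S then 0 else 1)"
      using arg_cong[OF sum, of ?e] m0(4) \<xi>(1) by (simp add: wdeg_add)
    then have em: "?e m = d" "\<zeta> \<in> ?S" "\<eta> \<notin> ?S"
      using dle[OF h(1)] m0(2) by (auto split: if_splits)
    have "?W m + 2 * 2 ^ stage n M \<zeta> = ?W m0 + 2 * 2 ^ stage n M \<xi>"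
      using arg_cong[OF sum, of ?W] m0(4) \<xi>(1) em by (simp add: wdeg_add)
    moreover have "?W m + 2 ^ stage n M \<eta> \<le> ?W m0 + 2 ^ stage n M \<eta>0"
      using h em by (intro maxQ) auto
    ultimately have le: "2 * 2 ^ stage n M \<xi> + 2 ^ stage n M \<eta> \<le> 2 * 2 ^ stage n M \<zeta> + (2::nat) ^ stage n M \<xi>"
      using \<xi>(2) by simp
    have "\<eta> \<in> Delta n - M" using h keys by blast
    from others[OF this em(2) h(3) False] show ?thesis
    proof
      assume "stage n M \<zeta> < stage n M \<xi>"
      then have "(2::nat) ^ Suc (stage n M \<zeta>) \<le> 2 ^ stage n M \<xi>"
        by (intro power_increasing) auto
      moreover have "(0::nat) < 2 ^ stage n M \<eta>" by simp
      ultimately have False using le by simp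
      then show ?thesis ..
    next
      assume "stage n M \<xi> < stage n M \<zeta> \<and> stage n M \<zeta> < stage n M \<eta>"
      then have "(2::nat) ^ Suc (stage n M \<zeta>) \<le> 2 ^ stage n M \<eta>"
        by (intro power_increasing) auto
      moreover have "(0::nat) < 2 ^ stage n M \<xi>" by simp
      ultimately have False using le by simp
      then show ?thesis ..
    qed
  qed
  have other0: "Poly_Mapping.lookup (?T m \<eta>) \<mu> = 0"
    if "m \<in> ?K" "\<eta> \<in> Poly_Mapping.keys m" "(m, \<eta>) \<noteq> (m0, \<eta>0)" for m \<eta>
  proof -
    have "\<eta> \<in> Delta n" using keys that by blast
    then show ?thesis
      using lookup_dmon_term[OF ab _ that(2), where M = M and \<mu> = \<mu>, where ?'a = 'a] unique[OF that(1,2)] that(3)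
      by (auto split: option.splits if_splits)
  qed
  have main: "Poly_Mapping.lookup (?T m0 \<eta>0) \<mu> \<noteq> 0"
  proof -
    have "Poly_Mapping.lookup m0 \<eta>0 \<noteq> 0" using m0(3) by (simp add: in_keys_iff)
    moreover have "\<eta>0 \<in> Delta n" "\<xi> \<in> Delta n - M" using m0(5) \<xi>(1) S_set_notM by blast+
    ultimately show ?thesis
      using lookup_dmon_term[OF ab _ m0(3), where M = M and \<mu> = \<mu>, where ?'a = 'a] \<xi>(3) \<mu>
      by auto
  qed
  have "0 = Poly_Mapping.lookup (\<Sum>m\<in>?K. pconst (Poly_Mapping.lookup p m) * dmon (ell n M a b) m) \<mu>"
    using inv_pol_derivation[OF p ab] by simp
  also have "\<dots> = (\<Sum>m\<in>?K. Poly_Mapping.lookup p m * (\<Sum>\<eta>\<in>Poly_Mapping.keys m. Poly_Mapping.lookup (?T m \<eta>) \<mu>))"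
    by (simp add: lookup_sum lookup_pconst_mult dmon_def)
  also have "\<dots> = (\<Sum>m\<in>?K. if m = m0 then Poly_Mapping.lookup p m0 * Poly_Mapping.lookup (?T m0 \<eta>0) \<mu> else 0)"
  proof (rule sum.cong[OF refl])
    fix m assume m: "m \<in> ?K"
    have "(\<Sum>\<eta>\<in>Poly_Mapping.keys m. Poly_Mapping.lookup (?T m \<eta>) \<mu>)
       = (\<Sum>\<eta>\<in>Poly_Mapping.keys m. if \<eta> = \<eta>0 then (if m = m0 then Poly_Mapping.lookup (?T m0 \<eta>0) \<mu> else 0) else 0)"
      using other0[OF m] by (intro sum.cong refl) auto
    also have "\<dots> = (if m = m0 then Poly_Mapping.lookup (?T m0 \<eta>0) \<mu> else 0)"
      using m0(3) by auto
    finally show "Poly_Mapping.lookup p m * (\<Sum>\<eta>\<in>Poly_Mapping.keys m. Poly_Mapping.lookup (?T m \<eta>) \<mu>)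
       = (if m = m0 then Poly_Mapping.lookup p m0 * Poly_Mapping.lookup (?T m0 \<eta>0) \<mu> else 0)" by simp
  qed
  also have "\<dots> = Poly_Mapping.lookup p m0 * Poly_Mapping.lookup (?T m0 \<eta>0) \<mu>"
    using m0(1) by simp
  finally show False
    using main m0(1) by (simp add: in_keys_iff)
qed

section \<open>The invariants as leading coefficients\<close>

text \<open>The elimination divides by pivots, so it takes place over the field of fractions;
  injectivity brings the results back to polynomials.\<close>

definition emb :: "'a::field_char_0 pol \<Rightarrow> 'a ratfun" where
  "emb p = Fraction_Field.Fract p 1"

lemma comm_ring_hom_emb: "comm_ring_hom (emb :: 'a::field_char_0 pol \<Rightarrow> 'a ratfun)"
  by unfold_locales (auto simp: emb_def Zero_fract_def One_fract_def)

lemma emb_eq_iff [simp]: "emb p = emb q \<longleftrightarrow> p = q"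
  by (simp add: emb_def eq_fract)

lemma emb_0 [simp]: "emb 0 = 0"
  by (simp add: emb_def Zero_fract_def)

lemma emb_1 [simp]: "emb 1 = 1"
  by (simp add: emb_def One_fract_def)

lemma emb_eq_0_iff [simp]: "emb p = 0 \<longleftrightarrow> p = 0"
  using emb_eq_iff[of p 0] by (simp del: emb_eq_iff)

lemma emb_mult: "emb (p * q) = emb p * emb q"
  by (simp add: emb_def)

lemma emb_add: "emb (p + q) = emb p + emb q"
  by (simp add: emb_def)

lemma emb_uminus: "emb (- p) = - emb p"
  by (simp add: emb_def)

definition cmat :: "(nat \<Rightarrow> nat \<Rightarrow> 'a::field_char_0 pol) \<Rightarrow> nat \<Rightarrow> nat \<Rightarrow> 'a pol poly" where
  "cmat A i j = [:A i j, if i = j then -1 else 0:]"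

text \<open>\<open>f = \<mu>^r P(1/\<mu>)\<close>.\<close>

definition reversed :: "nat \<Rightarrow> 'a::field_char_0 pol poly \<Rightarrow> 'a ratfun fps \<Rightarrow> bool" where
  "reversed r P f \<longleftrightarrow> (\<forall>k>r. coeff P k = 0) \<and> (\<forall>i. fps_nth f i = (if i \<le> r then emb (coeff P (r - i)) else 0))"

lemma reversed_linear:
  assumes "reversed r P f"
  shows "reversed (Suc r) (P * [:x, y:]) (f * (fps_const (emb y) + fps_const (emb x) * fps_X))"
proof -
  have c: "coeff (P * [:x, y:]) k = x * coeff P k + (case k of 0 \<Rightarrow> 0 | Suc k \<Rightarrow> y * coeff P k)" for k
    by (simp add: mult_pCons_right coeff_pCons split: nat.split)
  have f: "fps_nth (f * (fps_const (emb y) + fps_const (emb x) * fps_X)) i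
      = emb y * fps_nth f i + (case i of 0 \<Rightarrow> 0 | Suc i \<Rightarrow> emb x * fps_nth f i)" for i
  proof -
    have "f * (fps_const (emb y) + fps_const (emb x) * fps_X) = fps_const (emb y) * f + fps_const (emb x) * (f * fps_X)"
      by (simp add: algebra_simps)
    then show ?thesis by (simp split: nat.split)
  qed
  have P: "\<And>k. k > r \<Longrightarrow> coeff P k = 0" and F: "\<And>i. fps_nth f i = (if i \<le> r then emb (coeff P (r - i)) else 0)"
    using assms by (auto simp: reversed_def)
  show ?thesis
    unfolding reversed_def
  proof (intro conjI allI impI)
    fix k assume "k > Suc r" then show "coeff (P * [:x, y:]) k = 0"
      unfolding c using P by (cases k) auto
  next
    fix i
    show "fps_nth (f * (fps_const (emb y) + fps_const (emb x) * fps_X)) i = (if i \<le> Suc r then emb (coeff (P * [:x, y:]) (Suc r - i)) else 0)"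
    proof (cases i)
      case 0
      then show ?thesis unfolding f c F using P[of "Suc r"] by (simp add: emb_mult)
    next
      case (Suc j)
      consider "j < r" | "j = r" | "r < j" by linarith
      then show ?thesis
      proof cases
        case 1
        then have "r - j = Suc (r - Suc j)" by simp
        then show ?thesis unfolding f c F Suc using 1 by (simp add: emb_add emb_mult add.commute)
      qed (unfold f c F Suc, simp_all add: emb_mult)
    qed
  qed
qed

lemma reversed_prod:
  "reversed k (\<Prod>i = 0..<k. [:x i, y i:]) (\<Prod>i = 0..<k. fps_const (emb (y i)) + fps_const (emb (x i)) * fps_X)"
proof (induction k)
  case 0
  then show ?case by (auto simp: reversed_def)
next
  case (Suc k)
  then show ?case using reversed_linear[OF Suc, of "x k" "y k"] by simp
qed

lemma reversed_sum: "(\<And>i. i \<in> A \<Longrightarrow> reversed r (P i) (f i)) \<Longrightarrow> reversed r (\<Sum>i\<in>A. P i) (\<Sum>i\<in>A. f i)"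
proof (induction A rule: infinite_finite_induct)
  case (insert a A)
  have "reversed r (P a + Q) (f a + g)" if "reversed r Q g" for Q g
    using that insert.prems[of a] by (auto simp: reversed_def emb_add)
  then show ?case using insert by simp
qed (auto simp: reversed_def)

lemma reversed_sign: "reversed r P f \<Longrightarrow> reversed r (signof p * P) (signof p * f)"
  by (auto simp: reversed_def sign_def emb_uminus)

text \<open>Each Leibniz term is a product of \<open>length rs\<close> linear factors, and x +
  y\<lambda> reverses to y + x\<mu>. Reversing all terms with respect to the same nominal degree
  makes reversal compatible with the sum.\<close>

lemma reversed_lminor:
  assumes "length cs = length rs"
  shows "reversed (length rs) (lminor (cmat A) rs cs) (lminor (charmat (\<lambda>i j. emb (A i j))) rs cs)"
proof -
  let ?r = "length rs"
  let ?y = "\<lambda>i j. if i = j then -1 else 0 :: 'a pol"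
  have e: "charmat (\<lambda>i j. emb (A i j)) i j = fps_const (emb (?y i j)) + fps_const (emb (A i j)) * fps_X" for i j
    by (auto simp: charmat_def emb_uminus simp flip: fps_const_neg)
  have 1: "lminor (cmat A) rs cs = (\<Sum>p\<in>{p. p permutes {0..<?r}}. signof p * (\<Prod>i = 0..<?r. [:A (rs ! i) (cs ! p i), ?y (rs ! i) (cs ! p i):]))"
    unfolding lminor_def by (subst det_def'[of _ ?r]) (auto intro!: sum.cong prod.cong simp: permutes_in_image cmat_def)
  have 2: "lminor (charmat (\<lambda>i j. emb (A i j))) rs cs = (\<Sum>p\<in>{p. p permutes {0..<?r}}. signof p *
     (\<Prod>i = 0..<?r. fps_const (emb (?y (rs ! i) (cs ! p i))) + fps_const (emb (A (rs ! i) (cs ! p i))) * fps_X))"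
    unfolding lminor_def
    by (subst det_def'[of _ ?r]) (auto intro!: sum.cong prod.cong simp: permutes_in_image e simp del: fps_const_add fps_const_mult)
  show ?thesis
    unfolding 1 2 by (intro reversed_sum reversed_sign reversed_prod)
qed

section \<open>Highest coefficients and their non-vanishing\<close>

text \<open>The index is fixed by the combinatorics and not by the degree, so the coefficient
  commutes with ring homomorphisms even where it becomes zero.\<close>

definition top_coeff :: "nat \<Rightarrow> place set \<Rightarrow> nat \<Rightarrow> nat \<Rightarrow> (nat \<Rightarrow> nat \<Rightarrow> 'a::field_char_0 pol) \<Rightarrow> 'a pol" where
  "top_coeff n M h t A = (case proc n M h t of (rs, cs, d) \<Rightarrow> coeff (lminor (cmat A) rs cs) (length rs - d))"

abbreviation eleads :: "nat \<Rightarrow> place set \<Rightarrow> nat \<Rightarrow> (nat \<Rightarrow> nat \<Rightarrow> 'a::field_char_0 pol) \<Rightarrow> nat \<Rightarrow> (nat \<Rightarrow> nat \<Rightarrow> 'a ratfun) \<times> 'a ratfun" where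
  "eleads n M h A t \<equiv> lead n M h (\<lambda>i j. emb (A i j)) t"

lemma lower_part_refl: "(\<And>i j. (i, j) \<in> M \<Longrightarrow> y i j = 0) \<Longrightarrow> lower_part n M y y"
  by (auto simp: lower_part_def)

lemma top_coeff_0: "top_coeff n M h 0 A = 1"
  by (simp add: top_coeff_def)

lemma top_coeff_lead:
  assumes h: "1 \<le> h" and M: "left_down n M" and t: "Suc t \<le> n" and nz: "snd (eleads n M h A t) \<noteq> 0"
    and A: "\<And>i j. (i, j) \<in> M \<Longrightarrow> A i j = 0"
  shows "emb (top_coeff n M h (Suc t) A) = snd (eleads n M h A (Suc t))"
    and "proc n M h (Suc t) = (rs, cs, d) \<Longrightarrow> k > length rs - d \<Longrightarrow> coeff (lminor (cmat A) rs cs) k = 0"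
proof -
  obtain rs cs d where p: "proc n M h (Suc t) = (rs, cs, d)" by (cases "proc n M h (Suc t)")
  have f: "length cs = length rs" "d \<le> length rs" using proc_facts[OF p t] by auto
  have low: "lower_part n M (\<lambda>i j. emb (A i j)) (\<lambda>i j. emb (A i j))"
    by (rule lower_part_refl) (simp add: A)
  have la: "lead_at (lminor (charmat (\<lambda>i j. emb (A i j))) rs cs) d (snd (eleads n M h A (Suc t)))"
    by (rule lead_at_lminor[OF h M low t nz p])
  have rev: "reversed (length rs) (lminor (cmat A) rs cs) (lminor (charmat (\<lambda>i j. emb (A i j))) rs cs)"
    by (rule reversed_lminor[OF f(1)])
  show "emb (top_coeff n M h (Suc t) A) = snd (eleads n M h A (Suc t))"
    using la rev f(2) unfolding top_coeff_def p prod.case lead_at_def reversed_def by auto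
  have "coeff (lminor (cmat A) rs cs) k = 0" if "k > length rs - d" for k
  proof (cases "k > length rs")
    case True
    then show ?thesis using rev by (simp add: reversed_def)
  next
    case False
    then have "length rs - k < d" "length rs - (length rs - k) = k" using that f(2) by auto
    then have "emb (coeff (lminor (cmat A) rs cs) k) = 0"
      using la rev unfolding lead_at_def reversed_def by (metis diff_le_self)
    then show ?thesis by simp
  qed
  then show "proc n M h (Suc t) = (rs', cs', d') \<Longrightarrow> k > length rs' - d' \<Longrightarrow> coeff (lminor (cmat A) rs' cs') k = 0" for rs' cs' d' k
    using p by simp
qed

lemma comm_ring_hom_map_poly:
  assumes "comm_ring_hom \<theta>"
  shows "comm_ring_hom (map_poly \<theta> :: 'b::comm_ring_1 poly \<Rightarrow> 'c::comm_ring_1 poly)"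
proof -
  interpret comm_ring_hom \<theta> by fact
  have c: "coeff (map_poly \<theta> P) k = \<theta> (coeff P k)" for P k
    by (simp add: coeff_map_poly)
  show ?thesis
    by unfold_locales (auto intro!: poly_eqI simp: c hom_add coeff_mult hom_sum hom_mult)
qed

lemma top_coeff_hom:
  assumes \<theta>: "comm_ring_hom \<theta>" and t: "t \<le> n"
  shows "top_coeff n M h t (\<lambda>i j. \<theta> (A i j)) = \<theta> (top_coeff n M h t A)"
proof -
  interpret comm_ring_hom \<theta> by fact
  obtain rs cs d where p: "proc n M h t = (rs, cs, d)" by (cases "proc n M h t")
  have f: "length cs = length rs" using proc_facts[OF p t] by auto
  have e: "cmat (\<lambda>i j. \<theta> (A i j)) = (\<lambda>i j. map_poly \<theta> (cmat A i j))"
    by (intro ext) (simp add: cmat_def map_poly_pCons hom_uminus)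
  show ?thesis
    unfolding top_coeff_def p prod.case e lminor_hom[OF comm_ring_hom_map_poly[OF \<theta>] f]
    by (simp add: coeff_map_poly)
qed

lemma lead_cong:
  assumes "\<And>b j. j \<le> t \<Longrightarrow> y b j = y' b j"
  shows "lead n M h y t = lead n M h y' t"
  using assms
proof (induction t)
  case (Suc t)
  have IH: "lead n M h y t = lead n M h y' t" using Suc by simp
  have "psi y q rs (Suc t) = psi y' q rs (Suc t)" for q rs
    by (intro ext) (simp add: psi_def Suc.prems)
  then show ?case by (simp add: IH)
qed simp

lemma lead_Suc_snd:
  assumes "proc n M h t = (rs, cs, d)"
  shows "snd (lead n M h y (Suc t)) = (if h \<le> Suc t \<and> Suc t \<notin> set rs then - snd (lead n M h y t)
     else if cand n M h (Suc t) rs = {} then snd (lead n M h y t)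
     else snd (lead n M h y t) * psi y (fst (lead n M h y t)) rs (Suc t) (Max (cand n M h (Suc t) rs)))"
  by (cases "lead n M h y t") (simp add: assms Let_def)

definition set_entry :: "nat \<Rightarrow> nat \<Rightarrow> 'b \<Rightarrow> (nat \<Rightarrow> nat \<Rightarrow> 'b) \<Rightarrow> nat \<Rightarrow> nat \<Rightarrow> 'b" where
  "set_entry k t c A i j = (if i = k \<and> j = t then c else A i j)"

text \<open>The entry at the pivot place occurs in \<open>psi\<close> once with coefficient 1, as
  the sum there runs over rows below k, and it does not occur in the data of earlier columns. So the
  coefficient is affine in this entry, with the lead of the previous column as slope.\<close>

lemma jump_formula:
  assumes h: "1 \<le> h" and M: "left_down n M" and t: "Suc t \<le> n" and nz: "snd (eleads n M h A t) \<noteq> 0"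
    and A: "\<And>i j. (i, j) \<in> M \<Longrightarrow> A i j = 0"
    and p: "proc n M h t = (rs, cs, d)" and jump: "\<not> (h \<le> Suc t \<and> Suc t \<notin> set rs)" "cand n M h (Suc t) rs \<noteq> {}"
    and k: "k = Max (cand n M h (Suc t) rs)"
  shows "emb (top_coeff n M h (Suc t) (set_entry k (Suc t) c A)) =
    snd (eleads n M h A t) * (emb c + (psi (\<lambda>i j. emb (set_entry k (Suc t) 0 A i j)) (fst (eleads n M h A t)) rs (Suc t) k))"
proof -
  have "k \<in> cand n M h (Suc t) rs"
    unfolding k by (rule Max_in) (use jump in \<open>auto simp: cand_def intro: finite_subset[of _ "{..n}"]\<close>)
  then have kM: "(k, Suc t) \<notin> M" by (simp add: cand_def)
  let ?A = "set_entry k (Suc t) c A"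
  have e: "eleads n M h ?A t = eleads n M h A t"
    by (rule lead_cong) (simp add: set_entry_def)
  have "emb (top_coeff n M h (Suc t) ?A) = snd (eleads n M h ?A (Suc t))"
    by (rule top_coeff_lead(1)[OF h M t]) (use e nz A kM in \<open>auto simp: set_entry_def\<close>)
  also have "\<dots> = snd (eleads n M h A t) * psi (\<lambda>i j. emb (?A i j)) (fst (eleads n M h A t)) rs (Suc t) k"
    using jump unfolding lead_Suc_snd[OF p] e k[symmetric] by auto
  also have "psi (\<lambda>i j. emb (?A i j)) (fst (eleads n M h A t)) rs (Suc t) k
     = emb c + (psi (\<lambda>i j. emb (set_entry k (Suc t) 0 A i j)) (fst (eleads n M h A t)) rs (Suc t) k)"
  proof -
    have "(\<Sum>a\<in>{a \<in> set rs. k < a}. f a * emb (?A a (Suc t))) = (\<Sum>a\<in>{a \<in> set rs. k < a}. f a * emb (set_entry k (Suc t) 0 A a (Suc t)))" for f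
      by (intro sum.cong refl) (auto simp: set_entry_def)
    then show ?thesis by (simp add: psi_def) (simp add: set_entry_def)
  qed
  finally show ?thesis .
qed

lemma set_entry_same: "set_entry k t (A k t) A = A"
  by (intro ext) (simp add: set_entry_def)

lemma phi_set_entry: "set_entry k t (pconst c) (phi n Q) = (\<lambda>i j. psubst (\<lambda>\<eta>. if \<eta> = (k, t) then pconst c else yvar \<eta>) (phi n Q i j))"
  if "(k, t) \<in> Q"
proof -
  interpret comm_ring_hom "psubst (\<lambda>\<eta>. if \<eta> = (k, t) then pconst c else yvar \<eta>)"
    by (rule comm_ring_hom_psubst)
  show ?thesis
    using that by (intro ext) (auto simp: set_entry_def phi_def)
qed

text \<open>A pivot of order 1 stands where a chip lands, and such places belong to S; so its
  variable survives the restriction to \<Sigma>.\<close>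

lemma proc_step_S:
  assumes M: "left_down n M" and h: "1 \<le> h" and t: "Suc t \<le> n"
    and p: "proc n M h t = (rs, cs, d)" and jump: "\<not> (h \<le> Suc t \<and> Suc t \<notin> set rs)" "cand n M h (Suc t) rs \<noteq> {}"
  shows "(Max (cand n M h (Suc t) rs), Suc t) \<in> S_set n M"
proof -
  have rs: "set rs = {i\<in>{h..n}. i \<le> t \<or> i \<in> chips (sgm n M t) h}"
    using proc_sgm[OF M h _ p] t by simp
  have c: "cand n M h (Suc t) rs = landing n M h (Suc t)"
    by (rule cand_landing[OF M t rs])
  have "Suc t \<in> chips (sgm n M t) h"
  proof (cases "h \<le> Suc t")
    case True
    then show ?thesis using jump(1) rs by simp
  next
    case False
    then show ?thesis using sgm_above[OF M, of t "Suc t"] t by (auto simp: chips_def)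
  qed
  then show ?thesis
    using landing_in_S[OF M, of "Suc t" h] t jump(2) unfolding c by simp
qed

text \<open>If the lead vanished at a pivot of order 1, it would still vanish after setting the
  variable there to 0 and to 1. By \<open>jump_formula\<close> these two values differ by the lead
  of the previous column, which is non-zero by induction.\<close>

lemma lead_phi_nonzero:
  assumes M: "left_down n M" and h: "1 \<le> h" and Q: "S_set n M \<subseteq> Q" "Q \<inter> M = {}"
  shows "t \<le> n \<Longrightarrow> snd (eleads n M h (phi n Q :: nat \<Rightarrow> nat \<Rightarrow> 'a::field_char_0 pol) t) \<noteq> 0"
proof (induction t)
  case (Suc t)
  let ?A = "phi n Q :: nat \<Rightarrow> nat \<Rightarrow> 'a pol"
  have IH: "snd (eleads n M h ?A t) \<noteq> 0" using Suc by simp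
  have A: "?A i j = 0" if "(i, j) \<in> M" for i j using that Q by (auto simp: phi_def)
  obtain rs cs d where p: "proc n M h t = (rs, cs, d)" by (cases "proc n M h t")
  consider "h \<le> Suc t \<and> Suc t \<notin> set rs" | "\<not> (h \<le> Suc t \<and> Suc t \<notin> set rs)" "cand n M h (Suc t) rs = {}"
    | "\<not> (h \<le> Suc t \<and> Suc t \<notin> set rs)" "cand n M h (Suc t) rs \<noteq> {}" by blast
  then show ?case
  proof cases
    case 1
    then show ?thesis using IH unfolding lead_Suc_snd[OF p] by simp
  next
    case 2
    then show ?thesis using IH unfolding lead_Suc_snd[OF p] by simp
  next
    case 3
    define k where "k = Max (cand n M h (Suc t) rs)"
    have kS: "(k, Suc t) \<in> Q"
      using proc_step_S[OF M h Suc.prems p 3] Q by (auto simp: k_def)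
    show ?thesis
    proof
      assume z: "snd (eleads n M h ?A (Suc t)) = 0"
      then have z': "top_coeff n M h (Suc t) ?A = 0"
        using top_coeff_lead(1)[OF h M Suc.prems IH A] by simp
      have "emb (top_coeff n M h (Suc t) (set_entry k (Suc t) (pconst c) ?A)) = 0" for c
      proof -
        let ?\<theta> = "psubst (\<lambda>\<eta>. if \<eta> = (k, Suc t) then pconst c else yvar \<eta>) :: 'a pol \<Rightarrow> 'a pol"
        interpret \<theta>: comm_ring_hom ?\<theta> by (rule comm_ring_hom_psubst)
        have "top_coeff n M h (Suc t) (set_entry k (Suc t) (pconst c) ?A) = ?\<theta> (top_coeff n M h (Suc t) ?A)"
          unfolding phi_set_entry[OF kS] by (rule top_coeff_hom[OF comm_ring_hom_psubst Suc.prems])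
        then show ?thesis using z' by simp
      qed
      then have "snd (eleads n M h ?A t) * (emb (pconst c) + psi (\<lambda>i j. emb (set_entry k (Suc t) 0 ?A i j)) (fst (eleads n M h ?A t)) rs (Suc t) k) = 0" for c
        using jump_formula[OF h M Suc.prems IH A p 3 k_def, of "pconst c"] by simp
      from this[of 0] this[of 1] show False
        using IH by simp
    qed
  qed
qed simp

section \<open>From submatrices to pivot lists\<close>

lemma lminor_perm_rows:
  assumes "distinct rs" "distinct rs'" "set rs' = set rs"
  shows "\<exists>s\<in>{1, -1}. lminor A rs' cs = s * lminor A rs cs"
proof -
  let ?r = "length rs"
  have len: "length rs' = ?r" using assms by (metis distinct_card)
  have "mset rs' = mset rs" using assms by (metis set_eq_iff_mset_eq_distinct)
  then obtain p where p: "p permutes {..<?r}" "permute_list p rs = rs'"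
    by (rule mset_eq_permutation)
  have p0: "p permutes {0..<?r}" using p(1) by (simp add: atLeast0LessThan)
  let ?A = "mat ?r ?r (\<lambda>(a, b). A (rs ! a) (cs ! b))"
  have "mat ?r ?r (\<lambda>(a, b). A (rs' ! a) (cs ! b)) = mat ?r ?r (\<lambda>(i, j). ?A $$ (p i, j))"
    using permutes_in_image[OF p(1)] by (intro cong_mat) (auto simp: p(2)[symmetric] permute_list_nth[OF p(1)])
  then have "lminor A rs' cs = signof p * lminor A rs cs"
    unfolding lminor_def len using det_permute_rows[of ?A ?r p] p0 by simp
  moreover have "signof p \<in> {1, - 1 :: 'a}"
    by (simp add: sign_def)
  ultimately show ?thesis by (intro bexI[of _ "signof p"])
qed

lemma lminor_swap:
  assumes "length cs = length rs"
  shows "lminor (\<lambda>i j. A j i) cs rs = lminor A rs cs"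
proof -
  let ?A = "mat (length rs) (length rs) (\<lambda>(a, b). A (rs ! a) (cs ! b))"
  have "mat (length cs) (length cs) (\<lambda>(a, b). A (rs ! b) (cs ! a)) = transpose_mat ?A"
    by (rule eq_matI) (auto simp: assms)
  then show ?thesis
    unfolding lminor_def using det_transpose[of ?A "length rs"] by simp
qed

lemma lminor_perm:
  assumes "distinct rs" "distinct rs'" "set rs' = set rs" "distinct cs" "distinct cs'" "set cs' = set cs" "length cs = length rs"
  shows "\<exists>s\<in>{1, -1}. lminor A rs' cs' = s * lminor A rs cs"
proof -
  have len: "length rs' = length rs" "length cs' = length cs" using assms by (metis distinct_card)+
  obtain s where s: "s \<in> {1, -1}" "lminor A rs' cs' = s * lminor A rs cs'"
    using lminor_perm_rows[OF assms(1-3)] by blast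
  obtain s' where s': "s' \<in> {1, -1}" "lminor (\<lambda>i j. A j i) cs' rs = s' * lminor (\<lambda>i j. A j i) cs rs"
    using lminor_perm_rows[OF assms(4-6)] by blast
  have "lminor A rs' cs' = (s * s') * lminor A rs cs"
    using s s' lminor_swap[of cs' rs A] lminor_swap[of cs rs A] len assms(7) by (simp add: mult.assoc)
  moreover have "s * s' \<in> {1, -1}" using s s' by auto
  ultimately show ?thesis by blast
qed

lemma submatrix_lminor:
  assumes I: "I \<subseteq> {1..n}" and J: "J \<subseteq> {1..n}" and card: "card I = card J"
  shows "\<exists>rs cs. distinct rs \<and> set rs = I \<and> distinct cs \<and> set cs = J \<and>
    det (submatrix (mat n n (\<lambda>(i, j). A (Suc i) (Suc j))) {i. Suc i \<in> I} {j. Suc j \<in> J}) = lminor A rs cs"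
proof -
  have pick: "\<exists>rs. distinct rs \<and> set rs = K \<and> length rs = card K \<and> (\<forall>i<card K. rs ! i = Suc (pick {i. Suc i \<in> K} i) \<and> pick {i. Suc i \<in> K} i < n)"
    and cardK: "card {i. i < n \<and> Suc i \<in> K} = card K" if K: "K \<subseteq> {1..n}" for K
  proof -
    let ?K = "{i. Suc i \<in> K}"
    have im: "Suc ` ?K = K"
    proof
      show "K \<subseteq> Suc ` ?K"
      proof
        fix x assume "x \<in> K"
        then have "x = Suc (x - 1)" "Suc (x - 1) \<in> K" using K by force+
        then show "x \<in> Suc ` ?K" by blast
      qed
    qed auto
    have eqK: "{i. i < n \<and> Suc i \<in> K} = ?K" using K by (auto simp: Suc_le_eq)
    have c: "card ?K = card K" using card_image[of Suc ?K] im by simp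
    then show "card {i. i < n \<and> Suc i \<in> K} = card K" using eqK by simp
    have inset: "pick ?K i \<in> ?K" if "i < card K" for i
      using that c by (intro pick_in_set) auto
    have mono: "pick ?K i < pick ?K j" if "i < j" "j < card K" for i j
      using that c pick_mono by (metis inf.strict_order_iff min_def)
    let ?rs = "map (\<lambda>i. Suc (pick ?K i)) [0..<card K]"
    have inj: "inj_on (\<lambda>i. Suc (pick ?K i)) {0..<card K}"
      by (rule linorder_inj_onI) (auto dest: mono)
    have "set ?rs \<subseteq> K" using inset by auto
    moreover have "card (set ?rs) = card K" using card_image[OF inj] by simp
    moreover have "finite K" using K finite_subset by blast
    ultimately have "set ?rs = K" by (simp add: card_subset_eq)
    moreover have "distinct ?rs" using inj by (simp add: distinct_map)
    moreover have "pick ?K i < n" if "i < card K" for i using inset[OF that] K by auto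
    ultimately show "\<exists>rs. distinct rs \<and> set rs = K \<and> length rs = card K \<and> (\<forall>i<card K. rs ! i = Suc (pick ?K i) \<and> pick ?K i < n)"
      by (intro exI[of _ ?rs]) auto
  qed
  obtain rs where rs: "distinct rs" "set rs = I" "length rs = card I" "\<forall>i<card I. rs ! i = Suc (pick {i. Suc i \<in> I} i) \<and> pick {i. Suc i \<in> I} i < n"
    using pick[OF I] by blast
  obtain cs where cs: "distinct cs" "set cs = J" "length cs = card J" "\<forall>i<card J. cs ! i = Suc (pick {i. Suc i \<in> J} i) \<and> pick {i. Suc i \<in> J} i < n"
    using pick[OF J] by blast
  have "submatrix (mat n n (\<lambda>(i, j). A (Suc i) (Suc j))) {i. Suc i \<in> I} {j. Suc j \<in> J}
      = mat (length rs) (length rs) (\<lambda>(a, b). A (rs ! a) (cs ! b))"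
    unfolding submatrix_def using cardK[OF I] cardK[OF J] rs cs card by (intro cong_mat) auto
  then show ?thesis
    using rs cs unfolding lminor_def by (intro exI[of _ rs] exI[of _ cs]) simp
qed

lemma Phi_lambda_cmat: "Phi_lambda n M = mat n n (\<lambda>(i, j). cmat (phi n (Delta n - M)) (Suc i) (Suc j))"
  by (rule eq_matI) (auto simp: Phi_lambda_def Phi_def cmat_def phi_def one_pCons)

lemma S_setD:
  assumes "(k, t) \<in> S_set n M"
  shows "1 \<le> t" "t < k" "k \<le> n" "(k, t) \<notin> M"
  using S_set_notM[of n M] assms by (auto simp: Delta_def)

text \<open>The pivots of the elimination with threshold \<open>w_xi n M (k, t) t\<close> are
  \<open>I_xi\<close> and \<open>J_xi\<close>. The order in which they are listed costs a sign, and
  non-vanishing of the lead shows that the index in \<open>top_coeff\<close> is the degree.\<close>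

lemma P_xi_top_coeff:
  assumes M: "left_down n M" "M \<subseteq> Delta n" and S: "(k, t) \<in> S_set n M"
  shows "\<exists>s\<in>{1, -1}. (P_xi n M (k, t) :: 'a::field_char_0 pol) = s * top_coeff n M (w_xi n M (k, t) t) t (phi n (Delta n - M))"
proof -
  let ?h = "w_xi n M (k, t) t" and ?A = "phi n (Delta n - M) :: nat \<Rightarrow> nat \<Rightarrow> 'a pol"
  note xf = xi_facts[OF M S refl]
  note kt = S_setD[OF S]
  obtain t' where t': "t = Suc t'" using kt by (cases t) auto
  obtain rs cs d where p: "proc n M ?h t = (rs, cs, d)" by (cases "proc n M ?h t")
  have tn: "t \<le> n" using kt by simp
  note f = proc_facts[OF p tn]
  have sets: "set rs = I_xi n M (k, t)" "set cs = J_xi n M (k, t)"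
    using proc_sgm[OF M(1) xf(1) tn p] xf(6,7) by simp_all
  have "I_xi n M (k, t) \<subseteq> {1..n}" "J_xi n M (k, t) \<subseteq> {1..n}"
    using f xf(1) tn unfolding sets[symmetric] by auto
  moreover have "card (I_xi n M (k, t)) = card (J_xi n M (k, t))"
    unfolding sets[symmetric] using f by (simp add: distinct_card)
  ultimately obtain rs' cs' where rc: "distinct rs'" "set rs' = I_xi n M (k, t)" "distinct cs'" "set cs' = J_xi n M (k, t)"
    "M_xi n M (k, t) = lminor (cmat ?A) rs' cs'"
    using submatrix_lminor[of "I_xi n M (k, t)" n "J_xi n M (k, t)" "cmat ?A"] unfolding M_xi_def Phi_lambda_cmat by auto
  have "\<exists>s\<in>{1, -1}. lminor (cmat ?A) rs' cs' = s * lminor (cmat ?A) rs cs"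
    by (rule lminor_perm) (use f rc sets in auto)
  then obtain s where s: "s \<in> {1, -1}" "M_xi n M (k, t) = s * lminor (cmat ?A) rs cs"
    unfolding rc(5) by blast
  have A: "?A i j = 0" if "(i, j) \<in> M" for i j using that by (simp add: phi_def)
  have nz: "snd (eleads n M ?h ?A j) \<noteq> 0" if "j \<le> n" for j
    by (rule lead_phi_nonzero[OF M(1) xf(1) S_set_notM _ that]) auto
  have top: "emb (top_coeff n M ?h t ?A) \<noteq> 0"
    using top_coeff_lead(1)[OF xf(1) M(1) _ nz A, of t'] nz[of t] tn unfolding t' by simp
  have hi: "coeff (lminor (cmat ?A) rs cs) j = 0" if "j > length rs - d" for j
    using top_coeff_lead(2)[OF xf(1) M(1) _ nz A, of t'] p tn that unfolding t' by simp
  have tc: "top_coeff n M ?h t ?A = coeff (lminor (cmat ?A) rs cs) (length rs - d)"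
    by (simp add: top_coeff_def p)
  have "degree (lminor (cmat ?A) rs cs) = length rs - d"
  proof (rule antisym)
    show "degree (lminor (cmat ?A) rs cs) \<le> length rs - d"
      by (rule degree_le) (use hi in auto)
    show "length rs - d \<le> degree (lminor (cmat ?A) rs cs)"
      by (rule le_degree) (use top tc in auto)
  qed
  then have "lead_coeff (lminor (cmat ?A) rs cs) = top_coeff n M ?h t ?A"
    using tc by simp
  then show ?thesis
    using s unfolding P_xi_def by (auto simp: lead_coeff_mult)
qed

section \<open>The field of invariants\<close>

lemma inv_pol_closed:
  fixes p q :: "'a::field_char_0 pol" and c :: 'a
  shows "pconst c \<in> inv_pol n M"
    and "p \<in> inv_pol n M \<Longrightarrow> q \<in> inv_pol n M \<Longrightarrow> p + q \<in> inv_pol n M"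
    and "p \<in> inv_pol n M \<Longrightarrow> q \<in> inv_pol n M \<Longrightarrow> p * q \<in> inv_pol n M"
    and "p \<in> inv_pol n M \<Longrightarrow> - p \<in> inv_pol n M"
proof -
  have act: "act_pol n M g (pconst c) = pconst c" "act_pol n M g (p + q) = act_pol n M g p + act_pol n M g q"
    "act_pol n M g (p * q) = act_pol n M g p * act_pol n M g q" "act_pol n M g (- p) = - act_pol n M g p" for g
  proof -
    interpret comm_ring_hom "act_pol n M g" by (rule comm_ring_hom_act_pol)
    show "act_pol n M g (pconst c) = pconst c" by (simp add: act_pol_psubst)
    show "act_pol n M g (p + q) = act_pol n M g p + act_pol n M g q" by (rule hom_add)
    show "act_pol n M g (p * q) = act_pol n M g p * act_pol n M g q" by (rule hom_mult)
    show "act_pol n M g (- p) = - act_pol n M g p" by (rule hom_uminus)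
  qed
  show "pconst c \<in> inv_pol n M" by (simp add: inv_pol_def act)
  show "p \<in> inv_pol n M \<Longrightarrow> q \<in> inv_pol n M \<Longrightarrow> p + q \<in> inv_pol n M"
    by (simp add: inv_pol_def act S_alg_add)
  show "p \<in> inv_pol n M \<Longrightarrow> q \<in> inv_pol n M \<Longrightarrow> p * q \<in> inv_pol n M"
    by (simp add: inv_pol_def act S_alg_mult)
  show "p \<in> inv_pol n M \<Longrightarrow> - p \<in> inv_pol n M"
    by (simp add: inv_pol_def act S_alg_uminus)
qed

definition subring_set :: "'b::comm_ring_1 set \<Rightarrow> bool" where
  "subring_set R \<longleftrightarrow> 0 \<in> R \<and> 1 \<in> R \<and> (\<forall>a\<in>R. \<forall>b\<in>R. a + b \<in> R \<and> a * b \<in> R) \<and> (\<forall>a\<in>R. - a \<in> R)"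

lemma subring_set_sum: "subring_set R \<Longrightarrow> (\<And>i. i \<in> A \<Longrightarrow> f i \<in> R) \<Longrightarrow> sum f A \<in> R"
  by (induction A rule: infinite_finite_induct) (auto simp: subring_set_def)

lemma subring_set_prod: "subring_set R \<Longrightarrow> (\<And>i. i \<in> A \<Longrightarrow> f i \<in> R) \<Longrightarrow> prod f A \<in> R"
  by (induction A rule: infinite_finite_induct) (auto simp: subring_set_def)

lemma subring_set_poly:
  assumes R: "subring_set R"
  shows "subring_set {P. \<forall>k. coeff P k \<in> R}"
proof -
  have "(\<Sum>i\<le>k. coeff P i * coeff Q (k - i)) \<in> R" if "\<forall>k. coeff P k \<in> R" "\<forall>k. coeff Q k \<in> R" for P Q k
    using that R by (intro subring_set_sum[OF R]) (auto simp: subring_set_def)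
  then show ?thesis
    using R by (auto simp: subring_set_def coeff_mult coeff_pCons one_pCons split: nat.split)
qed

text \<open>By the Leibniz formula the coefficient is an integer polynomial in the entries that the
  minor contains.\<close>

lemma top_coeff_in_subring:
  assumes R: "subring_set R" and t: "t \<le> n" and p: "proc n M h t = (rs, cs, d)"
    and A: "\<And>i j. i \<in> set rs \<Longrightarrow> j \<in> set cs \<Longrightarrow> A i j \<in> R"
  shows "top_coeff n M h t A \<in> R"
proof -
  let ?R = "{P. \<forall>k. coeff P k \<in> R}" and ?r = "length rs"
  have RP: "subring_set ?R" by (rule subring_set_poly[OF R])
  have f: "length cs = ?r" using proc_facts[OF p t] by simp
  have R1: "- 1 \<in> R" "0 \<in> R" using R by (auto simp: subring_set_def)
  have "lminor (cmat A) rs cs = (\<Sum>p\<in>{p. p permutes {0..<?r}}. signof p * (\<Prod>i = 0..<?r. cmat A (rs ! i) (cs ! p i)))"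
    unfolding lminor_def by (subst det_def'[of _ ?r]) (auto intro!: sum.cong prod.cong simp: permutes_in_image)
  also have "\<dots> \<in> ?R"
  proof (rule subring_set_sum[OF RP])
    fix p assume "p \<in> {p. p permutes {0..<?r}}"
    then have p: "p permutes {0..<?r}" by simp
    have "cmat A (rs ! i) (cs ! p i) \<in> ?R" if "i \<in> {0..<?r}" for i
    proof -
      have "A (rs ! i) (cs ! p i) \<in> R"
        using A that permutes_in_image[OF p, of i] f by auto
      then show ?thesis using R1 by (auto simp: cmat_def coeff_pCons split: nat.split)
    qed
    then have "(\<Prod>i = 0..<?r. cmat A (rs ! i) (cs ! p i)) \<in> ?R"
      by (rule subring_set_prod[OF RP])
    then show "signof p * (\<Prod>i = 0..<?r. cmat A (rs ! i) (cs ! p i)) \<in> ?R"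
      using RP unfolding subring_set_def sign_def by auto
  qed
  finally show ?thesis by (simp add: top_coeff_def assms(3))
qed

lemma subring_S_alg: "subring_set (S_alg n M)"
  by (auto simp: subring_set_def S_alg_add S_alg_mult S_alg_uminus)

lemma phi_S_alg: "phi n (Delta n - M) i j \<in> S_alg n M"
  by (simp add: phi_def S_alg_yvar)

text \<open>Applying g to the entries gives a matrix that agrees with the conjugate of the generic
  matrix below the diagonal, while the conjugate may have further entries on and above it. As the
  lead depends on the lower part only, \<open>lead_conj_by\<close> identifies the leads before and
  after the action.\<close>

lemma top_coeff_inv_pol:
  assumes M: "left_down n M" "M \<subseteq> Delta n" and h: "1 \<le> h" and t: "t \<le> n"
  shows "(top_coeff n M h t (phi n (Delta n - M)) :: 'a::field_char_0 pol) \<in> inv_pol n M"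
proof (cases t)
  case 0
  then show ?thesis using inv_pol_closed(1)[of 1] by (simp add: top_coeff_0)
next
  case (Suc t')
  let ?A = "phi n (Delta n - M) :: nat \<Rightarrow> nat \<Rightarrow> 'a pol"
  have t': "Suc t' \<le> n" "t' \<le> n" using t Suc by simp_all
  obtain rs cs d where p: "proc n M h t = (rs, cs, d)" by (cases "proc n M h t")
  have "top_coeff n M h t ?A \<in> S_alg n M"
    by (rule top_coeff_in_subring[OF subring_S_alg t p]) (rule phi_S_alg)
  moreover have "act_pol n M g (top_coeff n M h t ?A) = top_coeff n M h t ?A" if g: "g \<in> carrier (UT n)" for g
  proof -
    interpret act: comm_ring_hom "act_pol n M g" by (rule comm_ring_hom_act_pol)
    interpret emb: comm_ring_hom "emb :: 'a pol \<Rightarrow> 'a ratfun" by (rule comm_ring_hom_emb)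
    interpret pc: comm_ring_hom "pconst :: 'a \<Rightarrow> 'a pol" by (rule comm_ring_hom_pconst)
    let ?B = "\<lambda>i j. act_pol n M g (?A i j)"
    define v where "v i j = emb (pconst (upper_of g i j))" for i j
    define w where "w i j = emb (pconst (upper_of (inv\<^bsub>UT n\<^esub> g) i j))" for i j
    let ?Z = "\<lambda>i j. emb (?A i j)"
    have uv: "unitri n v" "unitri n w"
      using upper_of_unitri[OF g] upper_of_unitri[OF UT_inv(1)[OF g]] by (auto simp: unitri_def v_def w_def)
    have vw: "(\<Sum>k\<in>{1..n}. v i k * w k j) = (if i = j then 1 else 0)" if "i \<in> {1..n}" "j \<in> {1..n}" for i j
    proof -
      have "(\<Sum>k\<in>{1..n}. v i k * w k j) = emb (pconst (\<Sum>k\<in>{1..n}. upper_of g i k * upper_of (inv\<^bsub>UT n\<^esub> g) k j))"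
        by (simp add: v_def w_def emb.hom_sum pc.hom_sum emb_mult pc.hom_mult)
      then show ?thesis using upper_of_inv[OF g that] by simp
    qed
    have conj: "conj_by n v ?Z w i j = emb (gen_act n M g (i, j))" if "i \<in> {1..n}" "j \<in> {1..n}" for i j
      unfolding gen_act_conj_by[OF g that]
      by (simp add: conj_by_def v_def w_def emb.hom_sum emb_mult)
    have B: "?B i j = gen_act n M g (i, j)" if "(i, j) \<in> Delta n" for i j
    proof (cases "(i, j) \<in> M")
      case True
      then show ?thesis using gen_act_M[OF g M True] by (simp add: phi_def)
    next
      case False
      then show ?thesis using that by (simp add: phi_def act_pol_psubst)
    qed
    have low: "lower_part n M (conj_by n v ?Z w) (\<lambda>i j. emb (?B i j))"
      unfolding lower_part_def
    proof (intro conjI ballI impI)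
      fix i j assume "i \<in> {1..n}" "j \<in> {1..n}" "j < i"
      then show "conj_by n v ?Z w i j = emb (?B i j)"
        using conj[of i j] B[of i j] by (simp add: Delta_def)
    next
      fix x assume "x \<in> M"
      then show "case x of (i, j) \<Rightarrow> j < i \<longrightarrow> conj_by n v ?Z w i j = 0"
        using conj gen_act_M[OF g M] M(2) by (cases x) (auto simp: Delta_def)
    qed
    have lowA: "lower_part n M ?Z ?Z"
      by (rule lower_part_refl) (simp add: phi_def)
    have nz: "snd (eleads n M h ?A j) \<noteq> 0" if "j \<le> n" for j
      by (rule lead_phi_nonzero[OF M(1) h S_set_notM _ that]) auto
    have eq: "snd (eleads n M h ?B j) = snd (eleads n M h ?A j)" if "j \<le> n" for j
      by (rule lead_conj_by[OF h M(1) uv vw lowA low that nz[OF that]])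
    have "emb (top_coeff n M h t ?B) = snd (eleads n M h ?B t)"
      unfolding Suc
    proof (rule top_coeff_lead(1)[OF h M(1) t'(1)])
      show "snd (eleads n M h ?B t') \<noteq> 0" using eq[OF t'(2)] nz[OF t'(2)] by simp
    qed (simp add: phi_def)
    also have "\<dots> = snd (eleads n M h ?A t)" by (rule eq[OF t])
    also have "\<dots> = emb (top_coeff n M h t ?A)"
      unfolding Suc by (rule top_coeff_lead(1)[OF h M(1) t'(1) nz[OF t'(2)], symmetric]) (simp add: phi_def)
    finally have "top_coeff n M h t ?B = top_coeff n M h t ?A" by simp
    moreover have "top_coeff n M h t ?B = act_pol n M g (top_coeff n M h t ?A)"
      by (rule top_coeff_hom[OF comm_ring_hom_act_pol t])
    ultimately show ?thesis by simp
  qed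
  ultimately show ?thesis by (simp add: inv_pol_def)
qed

section \<open>The generated subfield\<close>

lemma ring_of_type_algebra_ops:
  fixes x y :: "'b::field"
  defines "R \<equiv> ring_of_type_algebra :: 'b ring"
  shows "\<zero>\<^bsub>R\<^esub> = 0" "\<one>\<^bsub>R\<^esub> = 1" "x \<oplus>\<^bsub>R\<^esub> y = x + y" "x \<otimes>\<^bsub>R\<^esub> y = x * y"
    "\<ominus>\<^bsub>R\<^esub> x = - x" "x \<noteq> 0 \<Longrightarrow> inv\<^bsub>R\<^esub> x = inverse x"
proof -
  interpret R: Ring.field R unfolding R_def by (rule field_from_type_algebra)
  have ops: "carrier R = UNIV" "\<zero>\<^bsub>R\<^esub> = 0" "\<one>\<^bsub>R\<^esub> = 1" "x \<oplus>\<^bsub>R\<^esub> y = x + y" "x \<otimes>\<^bsub>R\<^esub> y = x * y" for x y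
    by (simp_all add: R_def ring_of_type_algebra_def)
  then show "\<zero>\<^bsub>R\<^esub> = 0" "\<one>\<^bsub>R\<^esub> = 1" "x \<oplus>\<^bsub>R\<^esub> y = x + y" "x \<otimes>\<^bsub>R\<^esub> y = x * y"
    by blast+
  have "x + \<ominus>\<^bsub>R\<^esub> x = 0" using R.r_neg[of x] by (simp add: ops)
  then show "\<ominus>\<^bsub>R\<^esub> x = - x" by (simp add: add_eq_0_iff)
  assume x: "x \<noteq> 0"
  then have "x \<in> Units R" by (simp add: R.field_Units ops)
  then have "x * inv\<^bsub>R\<^esub> x = 1" using R.Units_r_inv[of x] by (simp add: ops)
  then show "inv\<^bsub>R\<^esub> x = inverse x" using x by (metis inverse_unique)
qed

lemma field_adjoin_closed:
  fixes H :: "'a::field_char_0 ratfun set"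
  shows "emb (pconst c) \<in> field_adjoin H" "x \<in> H \<Longrightarrow> x \<in> field_adjoin H"
    "x \<in> field_adjoin H \<Longrightarrow> y \<in> field_adjoin H \<Longrightarrow> x + y \<in> field_adjoin H"
    "x \<in> field_adjoin H \<Longrightarrow> y \<in> field_adjoin H \<Longrightarrow> x * y \<in> field_adjoin H"
    "x \<in> field_adjoin H \<Longrightarrow> - x \<in> field_adjoin H"
    "x \<in> field_adjoin H \<Longrightarrow> x \<noteq> 0 \<Longrightarrow> inverse x \<in> field_adjoin H"
proof -
  let ?R = "ring_of_type_algebra :: 'a ratfun ring"
  show "emb (pconst c) \<in> field_adjoin H"
    unfolding field_adjoin_def emb_def by (rule generate_field.incl) blast
  show "x \<in> H \<Longrightarrow> x \<in> field_adjoin H"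
    unfolding field_adjoin_def by (rule generate_field.incl) blast
  show "x \<in> field_adjoin H \<Longrightarrow> y \<in> field_adjoin H \<Longrightarrow> x + y \<in> field_adjoin H"
    unfolding field_adjoin_def using generate_field.eng_add[where R = ?R] by (simp add: ring_of_type_algebra_ops)
  show "x \<in> field_adjoin H \<Longrightarrow> y \<in> field_adjoin H \<Longrightarrow> x * y \<in> field_adjoin H"
    unfolding field_adjoin_def using generate_field.eng_mult[where R = ?R] by (simp add: ring_of_type_algebra_ops)
  show "x \<in> field_adjoin H \<Longrightarrow> - x \<in> field_adjoin H"
    unfolding field_adjoin_def using generate_field.a_inv[where R = ?R] by (simp add: ring_of_type_algebra_ops)
  show "x \<in> field_adjoin H \<Longrightarrow> x \<noteq> 0 \<Longrightarrow> inverse x \<in> field_adjoin H"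
    unfolding field_adjoin_def using generate_field.m_inv[where R = ?R] by (metis ring_of_type_algebra_ops(1,6))
qed

lemma field_adjoin_induct [consumes 1, case_names const gen add mult uminus inverse]:
  fixes H :: "'a::field_char_0 ratfun set"
  assumes x: "x \<in> field_adjoin H"
    and "\<And>c. P (emb (pconst c))" "\<And>x. x \<in> H \<Longrightarrow> P x"
    "\<And>x y. P x \<Longrightarrow> P y \<Longrightarrow> P (x + y)" "\<And>x y. P x \<Longrightarrow> P y \<Longrightarrow> P (x * y)" "\<And>x. P x \<Longrightarrow> P (- x)"
    "\<And>x. P x \<Longrightarrow> x \<noteq> 0 \<Longrightarrow> P (inverse x)"
  shows "P x"
proof -
  show ?thesis
    using x unfolding field_adjoin_def
  proof (induction rule: generate_field.induct)
    case one
    then show ?case using assms(2)[of 1] by (simp add: ring_of_type_algebra_ops)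
  next
    case (incl h)
    then show ?case using assms(2,3) by (auto simp: emb_def)
  next
    case (a_inv h)
    then show ?case using assms(6) by (simp add: ring_of_type_algebra_ops)
  next
    case (m_inv h)
    then show ?case using assms(7) by (simp add: ring_of_type_algebra_ops)
  next
    case (eng_add h1 h2)
    then show ?case using assms(4) by (simp add: ring_of_type_algebra_ops)
  next
    case (eng_mult h1 h2)
    then show ?case using assms(5) by (simp add: ring_of_type_algebra_ops)
  qed
qed

definition gens :: "nat \<Rightarrow> place set \<Rightarrow> 'a::field_char_0 ratfun set" where
  "gens n M = (\<lambda>\<xi>. emb (P_xi n M \<xi>)) ` S_set n M"

definition expressible :: "nat \<Rightarrow> place set \<Rightarrow> 'a::field_char_0 pol set" where
  "expressible n M = {p \<in> inv_pol n M. emb p \<in> field_adjoin (gens n M)}"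

lemma subring_expressible: "subring_set (expressible n M)"
proof -
  have "1 \<in> expressible n M" "0 \<in> expressible n M"
    using inv_pol_closed(1)[of 1 n M] inv_pol_closed(1)[of 0 n M]
      field_adjoin_closed(1)[of 1 "gens n M"] field_adjoin_closed(1)[of 0 "gens n M"]
    by (auto simp: expressible_def)
  then show ?thesis
    by (auto simp: subring_set_def expressible_def emb_add emb_mult emb_uminus intro: inv_pol_closed field_adjoin_closed)
qed

lemma P_xi_inv_pol:
  assumes M: "left_down n M" "M \<subseteq> Delta n" and S: "\<xi> \<in> S_set n M"
  shows "(P_xi n M \<xi> :: 'a::field_char_0 pol) \<in> inv_pol n M"
proof -
  obtain k t where e: "\<xi> = (k, t)" by fastforce
  obtain s :: "'a pol" where s: "s \<in> {1, -1}" "P_xi n M (k, t) = s * top_coeff n M (w_xi n M (k, t) t) t (phi n (Delta n - M))"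
    using P_xi_top_coeff[OF M S[unfolded e]] by blast
  have "(top_coeff n M (w_xi n M (k, t) t) t (phi n (Delta n - M)) :: 'a pol) \<in> inv_pol n M"
    using S_setD[OF S[unfolded e]] by (intro top_coeff_inv_pol[OF M xi_facts(1)[OF M S[unfolded e] refl]]) simp
  then show ?thesis
    using s inv_pol_closed(4) unfolding e by auto
qed

lemma P_xi_expressible:
  "left_down n M \<Longrightarrow> M \<subseteq> Delta n \<Longrightarrow> \<xi> \<in> S_set n M \<Longrightarrow> P_xi n M \<xi> \<in> expressible n M"
  by (auto simp: expressible_def gens_def P_xi_inv_pol intro: field_adjoin_closed)

section \<open>Solving for the coordinates on \<Sigma>\<close>

text \<open>The polynomials on \<Sigma> that are restrictions of fractions of expressible
  invariants. The cross-multiplied form is used because a fraction restricts only if its denominator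
  does not vanish identically on \<Sigma>.\<close>

definition res_frac :: "nat \<Rightarrow> place set \<Rightarrow> 'a::field_char_0 pol set" where
  "res_frac n M = {a. \<exists>A\<in>expressible n M. \<exists>B\<in>expressible n M. restr n M B \<noteq> 0 \<and> a * restr n M B = restr n M A}"

lemma comm_ring_hom_restr: "comm_ring_hom (restr n M)"
  unfolding restr_def by (rule comm_ring_hom_psubst)

lemma restr_expressible:
  fixes A :: "'a::field_char_0 pol"
  assumes "A \<in> expressible n M"
  shows "restr n M A \<in> res_frac n M"
proof -
  interpret comm_ring_hom "restr n M :: 'a pol \<Rightarrow> 'a pol" by (rule comm_ring_hom_restr)
  have "(1 :: 'a pol) \<in> expressible n M" using subring_expressible[of n M, where ?'a = 'a] by (simp add: subring_set_def)
  then show ?thesis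
    unfolding res_frac_def using assms by (intro CollectI bexI[of _ A] bexI[of _ 1]) auto
qed

lemma subring_res_frac: "subring_set (res_frac n M :: 'a::field_char_0 pol set)"
proof -
  interpret comm_ring_hom "restr n M :: 'a pol \<Rightarrow> 'a pol" by (rule comm_ring_hom_restr)
  note E = subring_expressible[of n M, where ?'a = 'a, unfolded subring_set_def]
  have 01: "0 \<in> (res_frac n M :: 'a pol set)" "1 \<in> (res_frac n M :: 'a pol set)"
    using restr_expressible[of "0 :: 'a pol" n M] restr_expressible[of "1 :: 'a pol" n M] E by auto
  have "a + a' \<in> res_frac n M \<and> a * a' \<in> res_frac n M" if "a \<in> res_frac n M" "a' \<in> res_frac n M" for a a' :: "'a pol"
  proof -
    obtain A B where AB: "A \<in> expressible n M" "B \<in> expressible n M" "restr n M B \<noteq> 0" "a * restr n M B = restr n M A"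
      using \<open>a \<in> res_frac n M\<close> by (auto simp: res_frac_def)
    obtain A' B' where AB': "A' \<in> expressible n M" "B' \<in> expressible n M" "restr n M B' \<noteq> 0" "a' * restr n M B' = restr n M A'"
      using \<open>a' \<in> res_frac n M\<close> by (auto simp: res_frac_def)
    have "restr n M (B * B') \<noteq> 0" using AB AB' by (simp add: hom_mult)
    moreover have "(a + a') * restr n M (B * B') = restr n M (A * B' + A' * B)"
    proof -
      have "(a + a') * restr n M (B * B') = (a * restr n M B) * restr n M B' + (a' * restr n M B') * restr n M B"
        by (simp add: hom_mult algebra_simps)
      then show ?thesis by (simp add: AB(4) AB'(4) hom_add hom_mult)
    qed
    moreover have "(a * a') * restr n M (B * B') = restr n M (A * A')"
    proof -
      have "(a * a') * restr n M (B * B') = (a * restr n M B) * (a' * restr n M B')"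
        by (simp add: hom_mult algebra_simps)
      then show ?thesis by (simp add: AB(4) AB'(4) hom_mult)
    qed
    moreover have "B * B' \<in> expressible n M" "A * B' + A' * B \<in> expressible n M" "A * A' \<in> expressible n M"
      using E AB AB' by auto
    ultimately show ?thesis unfolding res_frac_def by blast
  qed
  moreover have "- a \<in> res_frac n M" if "a \<in> res_frac n M" for a :: "'a pol"
  proof -
    obtain A B where AB: "A \<in> expressible n M" "B \<in> expressible n M" "restr n M B \<noteq> 0" "a * restr n M B = restr n M A"
      using \<open>a \<in> res_frac n M\<close> by (auto simp: res_frac_def)
    then have "- A \<in> expressible n M" "(- a) * restr n M B = restr n M (- A)"
      using E by (auto simp: hom_uminus)
    then show ?thesis using AB unfolding res_frac_def by blast
  qed
  ultimately show ?thesis using 01 by (simp add: subring_set_def)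
qed

lemma res_frac_divide:
  fixes a c z :: "'a::field_char_0 pol"
  assumes "a \<in> res_frac n M" "c \<in> res_frac n M" "a \<noteq> 0" "z * a = c"
  shows "z \<in> res_frac n M"
proof -
  interpret comm_ring_hom "restr n M :: 'a pol \<Rightarrow> 'a pol" by (rule comm_ring_hom_restr)
  note E = subring_expressible[of n M, where ?'a = 'a, unfolded subring_set_def]
  obtain A B where AB: "A \<in> expressible n M" "B \<in> expressible n M" "restr n M B \<noteq> 0" "a * restr n M B = restr n M A"
    using assms(1) by (auto simp: res_frac_def)
  obtain C D where CD: "C \<in> expressible n M" "D \<in> expressible n M" "restr n M D \<noteq> 0" "c * restr n M D = restr n M C"
    using assms(2) by (auto simp: res_frac_def)
  have "restr n M A \<noteq> 0" using AB assms(3) by (metis mult_eq_0_iff)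
  then have "restr n M (A * D) \<noteq> 0" using CD by (simp add: hom_mult)
  moreover have "z * restr n M (A * D) = restr n M (C * B)"
  proof -
    have "z * restr n M (A * D) = z * (a * restr n M B) * restr n M D" by (simp add: hom_mult AB(4) mult.assoc)
    also have "\<dots> = (c * restr n M D) * restr n M B" unfolding assms(4)[symmetric] by (simp only: mult_ac)
    finally show ?thesis by (simp add: CD(4) hom_mult)
  qed
  moreover have "A * D \<in> expressible n M" "C * B \<in> expressible n M" using E AB CD by auto
  ultimately show ?thesis unfolding res_frac_def by blast
qed

lemma restr_phi: "restr n M (phi n (Delta n - M) i j :: 'a::field_char_0 pol) = phi n (S_set n M) i j"
proof -
  interpret comm_ring_hom "restr n M :: 'a pol \<Rightarrow> 'a pol" by (rule comm_ring_hom_restr)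
  have "restr n M (yvar \<eta> :: 'a pol) = (if \<eta> \<in> S_set n M then yvar \<eta> else 0)" for \<eta> by (simp add: restr_def)
  moreover have "(i, j) \<in> S_set n M \<Longrightarrow> (i, j) \<in> Delta n - M" using S_set_notM by blast
  ultimately show ?thesis by (auto simp: phi_def)
qed

lemma restr_P_xi:
  assumes M: "left_down n M" "M \<subseteq> Delta n" and S: "(k, t) \<in> S_set n M"
  shows "\<exists>s\<in>{1, -1}. restr n M (P_xi n M (k, t) :: 'a::field_char_0 pol) = s * top_coeff n M (w_xi n M (k, t) t) t (phi n (S_set n M))"
proof -
  interpret comm_ring_hom "restr n M :: 'a pol \<Rightarrow> 'a pol" by (rule comm_ring_hom_restr)
  obtain s :: "'a pol" where s: "s \<in> {1, -1}" "P_xi n M (k, t) = s * top_coeff n M (w_xi n M (k, t) t) t (phi n (Delta n - M))"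
    using P_xi_top_coeff[OF M S] by blast
  have "top_coeff n M (w_xi n M (k, t) t) t (\<lambda>i j. restr n M (phi n (Delta n - M) i j))
      = restr n M (top_coeff n M (w_xi n M (k, t) t) t (phi n (Delta n - M) :: nat \<Rightarrow> nat \<Rightarrow> 'a pol))"
    using S_setD[OF S] by (intro top_coeff_hom[OF comm_ring_hom_restr]) simp
  then have "top_coeff n M (w_xi n M (k, t) t) t (phi n (S_set n M))
      = restr n M (top_coeff n M (w_xi n M (k, t) t) t (phi n (Delta n - M) :: nat \<Rightarrow> nat \<Rightarrow> 'a pol))"
    by (simp add: restr_phi)
  then show ?thesis
    using s by (intro bexI[of _ s]) (auto simp: hom_mult hom_uminus)
qed

text \<open>Induction in the order of the places, encoded by the measure
  \<open>t * Suc n + (n - k)\<close>. On \<Sigma> the invariant of (k, t) is, up to sign, affine in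
  the coordinate at (k, t). Slope and constant term are coefficients of minors whose entries are
  zero or earlier coordinates, and the slope is non-zero, so the coordinate can be solved
  for.\<close>

lemma yvar_res_frac:
  assumes M: "left_down n M" "M \<subseteq> Delta n"
  shows "(k, t) \<in> S_set n M \<Longrightarrow> (yvar (k, t) :: 'a::field_char_0 pol) \<in> res_frac n M"
proof (induction "t * Suc n + (n - k)" arbitrary: k t rule: less_induct)
  case less
  note S = less.prems
  note kt = S_setD[OF S]
  note R = subring_res_frac[of n M, where ?'a = 'a, unfolded subring_set_def]
  let ?S = "S_set n M" and ?h = "w_xi n M (k, t) t"
  let ?A = "phi n (S_set n M) :: nat \<Rightarrow> nat \<Rightarrow> 'a pol"
  note xf = xi_facts[OF M S refl]
  obtain t' where t': "t = Suc t'" using kt by (cases t) auto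
  have tn: "Suc t' \<le> n" "t' \<le> n" using kt t' by simp_all
  obtain rs cs d where p: "proc n M ?h t' = (rs, cs, d)" by (cases "proc n M ?h t'")
  note f = proc_facts[OF p tn(2)]
  have rs: "set rs = {i\<in>{?h..n}. i \<le> t' \<or> i \<in> chips (sgm n M t') ?h}"
    using proc_sgm[OF M(1) xf(1) tn(2) p] by simp
  have c: "cand n M ?h (Suc t') rs = landing n M ?h t"
    unfolding t' by (rule cand_landing[OF M(1) tn(1) rs[unfolded t']])
  have jump: "\<not> (?h \<le> Suc t' \<and> Suc t' \<notin> set rs)" "cand n M ?h (Suc t') rs \<noteq> {}"
    using xf(3,4) tn unfolding c unfolding t' rs by auto
  have kM: "k = Max (cand n M ?h (Suc t') rs)" unfolding c using xf(5) by simp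
  have pt: "proc n M ?h t = (rs @ [k], cs @ [t], Suc d)"
    using jump p kM unfolding t' by auto
  have A: "?A i j = 0" if "(i, j) \<in> M" for i j
    using that S_set_notM by (auto simp: phi_def)
  have nz: "snd (eleads n M ?h ?A j) \<noteq> 0" if "j \<le> n" for j
    by (rule lead_phi_nonzero[OF M(1) xf(1) order_refl _ that]) (use S_set_notM in blast)
  \<comment> \<open>The slope in \<open>jump_formula\<close> is itself a coefficient of a minor, for
    the same threshold and one column less.\<close>
  have low: "emb (top_coeff n M ?h t' ?A) = snd (eleads n M ?h ?A t')"
  proof (cases t')
    case 0
    then show ?thesis by (simp add: top_coeff_0)
  next
    case (Suc u)
    show ?thesis unfolding Suc by (rule top_coeff_lead(1)[OF xf(1) M(1)]) (use tn Suc nz A in auto)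
  qed
  let ?B = "set_entry k t 0 ?A"
  note jf = jump_formula[OF xf(1) M(1) tn(1) nz[OF tn(2)] A p jump kM]
  have Akt: "set_entry k t (yvar (k, t)) ?A = ?A"
    using set_entry_same[of k t ?A] S by (simp add: phi_def)
  have "emb (top_coeff n M ?h t ?A) = emb (top_coeff n M ?h t' ?A) * emb (yvar (k, t)) + emb (top_coeff n M ?h t ?B)"
    using jf[of "yvar (k, t)"] jf[of 0] Akt unfolding t'[symmetric] low by (simp add: distrib_left)
  then have eq: "top_coeff n M ?h t ?A = top_coeff n M ?h t' ?A * yvar (k, t) + top_coeff n M ?h t ?B"
    by (simp flip: emb_mult emb_add)
  have entry: "?A a j \<in> res_frac n M" if "j < t \<or> (j = t \<and> k < a)" for a j
  proof (cases "(a, j) \<in> ?S")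
    case True
    note aj = S_setD[OF True]
    have "j * Suc n + (n - a) < t * Suc n + (n - k)"
    proof (cases "j < t")
      case True
      then have "Suc j * Suc n \<le> t * Suc n" by (intro mult_le_mono1) simp
      then show ?thesis by simp
    next
      case False
      then show ?thesis using that aj kt by auto
    qed
    then show ?thesis using less.hyps True by (simp add: phi_def)
  next
    case False
    then show ?thesis using R by (simp add: phi_def)
  qed
  have a_in: "top_coeff n M ?h t' ?A \<in> res_frac n M"
  proof (rule top_coeff_in_subring[OF subring_res_frac tn(2) p])
    fix i j assume "j \<in> set cs"
    then have "j < t" using f t' by auto
    then show "?A i j \<in> res_frac n M" by (intro entry) simp
  qed
  have b_in: "top_coeff n M ?h t ?B \<in> res_frac n M"
  proof (rule top_coeff_in_subring[OF subring_res_frac _ pt])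
    show "t \<le> n" using kt by simp
    fix i j assume i: "i \<in> set (rs @ [k])" and j: "j \<in> set (cs @ [t])"
    have "j \<le> t" using j f t' by auto
    show "?B i j \<in> res_frac n M"
    proof (cases "(i, j) \<in> ?S \<and> (i, j) \<noteq> (k, t)")
      case False
      then have "?B i j = 0" by (auto simp: set_entry_def phi_def)
      then show ?thesis using R by simp
    next
      case True
      then have e: "?B i j = ?A i j" by (auto simp: set_entry_def)
      \<comment> \<open>The minor may contain rows above k, but in column t these carry no place of
        S, by the last clause of \<open>xi_facts\<close>.\<close>
      have "j < t \<or> (j = t \<and> k < i)"
      proof (rule ccontr)
        assume "\<not> (j < t \<or> (j = t \<and> k < i))"
        then have jt: "j = t" "i < k" using \<open>j \<le> t\<close> True by auto
        have ti: "t < i" using S_setD[of i j n M] True jt by simp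
        have "i \<in> {i\<in>{?h..n}. i \<le> t \<or> i \<in> chips (sgm n M t) ?h}"
          using proc_sgm[OF M(1) xf(1) _ pt] kt i by auto
        then have "i \<in> chips (sgm n M t) ?h" using ti by simp
        then show False using xf(8)[OF ti jt(2)] True jt by simp
      qed
      then show ?thesis unfolding e by (rule entry)
    qed
  qed
  obtain s where s: "s \<in> {1, -1}" "restr n M (P_xi n M (k, t)) = s * top_coeff n M ?h t ?A"
    using restr_P_xi[OF M S] by blast
  have "restr n M (P_xi n M (k, t)) \<in> res_frac n M"
    by (rule restr_expressible[OF P_xi_expressible[OF M S]])
  then have "top_coeff n M ?h t ?A \<in> res_frac n M"
    using s R by (metis add.inverse_inverse insertE mult_1 mult_minus1 singletonD)
  then have "top_coeff n M ?h t ?A + - top_coeff n M ?h t ?B \<in> res_frac n M"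
    using b_in R by blast
  moreover have "top_coeff n M ?h t' ?A \<noteq> 0"
    using low nz[OF tn(2)] by auto
  moreover have "yvar (k, t) * top_coeff n M ?h t' ?A = top_coeff n M ?h t ?A + - top_coeff n M ?h t ?B"
    using eq by (simp add: mult.commute)
  ultimately show ?case
    using res_frac_divide[OF a_in] by blast
qed

lemma inv_pol_expressible:
  assumes M: "left_down n M" "M \<subseteq> Delta n" and p: "(p :: 'a::field_char_0 pol) \<in> inv_pol n M"
  shows "emb p \<in> field_adjoin (gens n M)"
proof -
  interpret comm_ring_hom "restr n M :: 'a pol \<Rightarrow> 'a pol" by (rule comm_ring_hom_restr)
  note R = subring_res_frac[of n M, where ?'a = 'a]
  have one: "1 \<in> (res_frac n M :: 'a pol set)" "0 \<in> (res_frac n M :: 'a pol set)" using R by (auto simp: subring_set_def)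
  have c: "pconst c \<in> res_frac n M" for c :: 'a
  proof -
    have "pconst c \<in> expressible n M"
      by (simp add: expressible_def inv_pol_closed field_adjoin_closed)
    from restr_expressible[OF this] show ?thesis by (simp add: restr_def)
  qed
  \<comment> \<open>The constants and the coordinates on \<Sigma> lie in this subring, hence so does
    every restriction.\<close>
  have "restr n M q \<in> res_frac n M" for q :: "'a pol"
  proof (induction q rule: pol_induct)
    case (const c)
    then show ?case using c by (simp add: restr_def)
  next
    case (var \<eta>)
    then show ?case using yvar_res_frac[OF M, where ?'a = 'a] one by (cases \<eta>) (auto simp: restr_def)
  next
    case (add p q)
    then show ?case using R by (simp add: hom_add subring_set_def)
  next
    case (mult p q)
    then show ?case using R by (simp add: hom_mult subring_set_def)
  qed
  then obtain A B where AB: "A \<in> expressible n M" "B \<in> expressible n M" "restr n M B \<noteq> 0" "restr n M p * restr n M B = restr n M A"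
    unfolding res_frac_def by blast
  then have inv: "A \<in> inv_pol n M" "B \<in> inv_pol n M" by (auto simp: expressible_def)
  \<comment> \<open>The fraction A/B represents p on \<Sigma> only. The difference is an invariant
    vanishing there, hence zero.\<close>
  have "p * B + - A \<in> inv_pol n M"
    by (intro inv_pol_closed p inv)
  moreover have "restr n M (p * B + - A) = 0"
    unfolding hom_add hom_mult hom_uminus using AB(4) by simp
  ultimately have "p * B + - A = 0" by (rule inv_pol_restr_zero)
  then have "emb p * emb B = emb A" by (simp flip: emb_mult)
  moreover have "emb B \<noteq> 0" using AB(3) by auto
  ultimately have "emb p = emb A * inverse (emb B)" by (simp add: field_simps)
  moreover have "emb A * inverse (emb B) \<in> field_adjoin (gens n M)"
    by (rule field_adjoin_closed(4)[OF _ field_adjoin_closed(6)])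
      (use AB(1,2) \<open>emb B \<noteq> 0\<close> in \<open>auto simp: expressible_def\<close>)
  ultimately show ?thesis by simp
qed

theorem theorem3p20:
  fixes n :: nat and M :: "place set"
  assumes "n \<ge> 1" and "ideal_places n M"
  shows "(invariant_field n M :: 'a::field_char_0 ratfun set) =
    field_adjoin ((\<lambda>\<xi>. Fraction_Field.Fract (P_xi n M \<xi>) 1) ` S_set n M)"
proof -
  have MD: "M \<subseteq> Delta n" using assms(2) by (simp add: ideal_places_def)
  have M: "left_down n M" by (rule ideal_places_left_down[OF assms(2)])
  have F: "Fraction_Field.Fract p q = emb p * inverse (emb q)" for p q :: "'a pol"
    by (simp add: emb_def)
  let ?F = "{Fraction_Field.Fract p q | p q. p \<in> inv_pol n M \<and> q \<in> inv_pol n M \<and> q \<noteq> 0} :: 'a ratfun set"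
  have "?F = field_adjoin (gens n M)"
  proof (intro equalityI subsetI)
    fix x assume "x \<in> ?F"
    then show "x \<in> field_adjoin (gens n M)"
      unfolding F using inv_pol_expressible[OF M MD]
      by (auto intro!: field_adjoin_closed(4,6))
  next
    have one: "(1 :: 'a pol) \<in> inv_pol n M" using inv_pol_closed(1)[of "1 :: 'a" n M] by simp
    have e: "emb p \<in> ?F" if "p \<in> inv_pol n M" for p :: "'a pol"
      using that one unfolding emb_def by (intro CollectI exI[of _ p] exI[of _ 1]) simp
    fix x :: "'a ratfun" assume "x \<in> field_adjoin (gens n M)"
    \<comment> \<open>Fractions of invariant polynomials contain the generators and are closed under
      the field operations.\<close>
    then show "x \<in> ?F"
    proof (induction rule: field_adjoin_induct)
      case (const c)
      then show ?case by (rule e[OF inv_pol_closed(1)])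
    next
      case (gen x)
      then obtain \<xi> where "\<xi> \<in> S_set n M" "x = emb (P_xi n M \<xi>)" by (auto simp: gens_def)
      then show ?case using e[OF P_xi_inv_pol[OF M MD]] by simp
    next
      case (add x y)
      then obtain p q p' q' where h: "x = Fraction_Field.Fract p q" "p \<in> inv_pol n M" "q \<in> inv_pol n M" "q \<noteq> 0"
        "y = Fraction_Field.Fract p' q'" "p' \<in> inv_pol n M" "q' \<in> inv_pol n M" "q' \<noteq> 0" by blast
      then have "x + y = Fraction_Field.Fract (p * q' + p' * q) (q * q')" by simp
      moreover have "p * q' + p' * q \<in> inv_pol n M" "q * q' \<in> inv_pol n M" "q * q' \<noteq> 0"
        using h by (auto intro!: inv_pol_closed)
      ultimately show ?case by blast
    next
      case (mult x y)
      then obtain p q p' q' where h: "x = Fraction_Field.Fract p q" "p \<in> inv_pol n M" "q \<in> inv_pol n M" "q \<noteq> 0"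
        "y = Fraction_Field.Fract p' q'" "p' \<in> inv_pol n M" "q' \<in> inv_pol n M" "q' \<noteq> 0" by blast
      then have "x * y = Fraction_Field.Fract (p * p') (q * q')" by simp
      moreover have "p * p' \<in> inv_pol n M" "q * q' \<in> inv_pol n M" "q * q' \<noteq> 0"
        using h by (auto intro!: inv_pol_closed)
      ultimately show ?case by blast
    next
      case (uminus x)
      then obtain p q where h: "x = Fraction_Field.Fract p q" "p \<in> inv_pol n M" "q \<in> inv_pol n M" "q \<noteq> 0" by blast
      then have "- x = Fraction_Field.Fract (- p) q" by simp
      then show ?case using h inv_pol_closed(4) by blast
    next
      case (inverse x)
      then obtain p q where h: "x = Fraction_Field.Fract p q" "p \<in> inv_pol n M" "q \<in> inv_pol n M" "q \<noteq> 0" by blast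
      then have "inverse x = Fraction_Field.Fract q p" by simp
      moreover have "p \<noteq> 0" using inverse(2) h by (auto simp: fract_collapse)
      ultimately show ?case using h by blast
    qed
  qed
  then show ?thesis
    unfolding invariant_field_fractions[OF MD assms(1)] gens_def emb_def .
qed

end
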